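(* Let Assumption (A) (items (1)-(6) in the context) hold, and consider the sequential algorithm (Steps 1-3 for $n\ge 1$, with the initialization at levels $0$ and $1$ described in the context). If the time step satisfies $$\tau\le\frac{2\theta_m a_0}{M^2},$$ then the algorithm has a unique solution $(\mathbf u_h^n,p_h^n,T_h^n)\in \mathbf V_h\times Q_h\times S_h$ (at every time level $n=1,\dots,N$).
   Context: Continuous problem. $\Omega\subset\mathbb R^d$ ($d=2,3$) is a convex polygonal or polyhedral domain with Lipschitz boundary, $t_f>0$. $(\cdot,\cdot)$ and $\|\cdot\|$ are the $L^2(\Omega)$ inner product and norm (scalar, vector or tensor), $\|\cdot\|_k$ the $H^k(\Omega)$ norm, $|\cdot|$ the Euclidean norm. $\bm\epsilon(\mathbf u)=\frac12(\nabla\mathbf u+\nabla\mathbf u^{\mathsf T})$. $\mathbf V=(H_0^1(\Omega))^d$, $Q=W=H_0^1(\Omega)$, and $a(\mathbf u,\mathbf v)=2\mu(\bm\epsilon(\mathbf u),\bm\epsilon(\mathbf v))+\lambda(\nabla\cdot\mathbf u,\nabla\cdot\mathbf v)$, $c_p(p,q)=(\mathbf K\nabla p,\nabla q)$, $c_T(T,s)=(\bm\Theta\nabla T,\nabla s)$, $b(p,\mathbf v)=(\nabla p,\mathbf v)$. The weak thermo-poroelasticity problem is: for $t\in(0,t_f]$ find $(\mathbf u,p,T)\in\mathbf V\times Q\times W$ such that for all $(\mathbf v,q,s)\in\mathbf V\times Q\times W$ $$a(\mathbf u,\mathbf v)+\alpha b(p,\mathbf v)+\beta b(T,\mathbf v)=(\bm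 f,\mathbf v),$$ $$c_0(p_t,q)-b_0(T_t,q)-\alpha b(q,\mathbf u_t)+c_p(p,q)=(g,q),$$ $$a_0(T_t,s)-b_0(p_t,s)-\beta b(s,\mathbf u_t)-(\mathbf K\nabla p\cdot\nabla T,s)+c_T(T,s)=(z,s),$$ with $\mathbf u(\cdot,0)=\mathbf u^0$, $p(\cdot,0)=p^0$, $T(\cdot,0)=T^0$. Assumption (A). (1) The tensors $\mathbf K=\mathbf K(\mathbf x)$, $\bm\Theta=\bm\Theta(\mathbf x)$ are constant in time, symmetric and positive definite, and there are constants $k_m,k_M,\theta_m,\theta_M>0$ with $k_m|\zeta|^2\le\zeta^{T}\mathbf K(\mathbf x)\zeta$, $|\mathbf K(\mathbf x)\zeta|\le k_M|\zeta|$, $\theta_m|\zeta|^2\le\zeta^{T}\bm\Theta(\mathbf x)\zeta$, $|\bm\Theta(\mathbf x)\zeta|\le\theta_M|\zeta|$ for all $\zeta\in\mathbb R^d$, $\mathbf x\in\Omega$. (2) $a_0,b_0,c_0,\alpha,\beta,\mu,\lambda$ are strictly positive constants. (3) $c_0-2b_0>0$ and $a_0-2b_0\ge0$. (4) $z,g\in L^2(0,t_f;L^2(\Omega))$, $\bm f\in H^1(0,t_f;L^2(\Omega))$ (vector-valued). (5) $p^0,T^0\in H_0^1(\Omega)$, $\mathbf u^0\in(H_0^1(\Omega))^d$. (6) For some $l>d$ and $k_i\ge1$ ($i=1,2,3$) the exact solution satisfies $\nabla p\in L^\infty(0,t_f;W^{1,l})$, $p\in L^\infty(0,t_f;W^{2,l}\cap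 H^{k_2+1})$, $T\in L^\infty(0,t_f;H^{k_3+1})$, $\mathbf u\in L^\infty(0,t_f;(H^{k_1+1})^d)$, $p_t,T_t\in L^\infty(0,t_f;W^{1,l})$, $\mathbf u_t\in L^\infty(0,t_f;(W^{2,l})^d)$, $p_{tt},T_{tt}\in L^2(0,t_f;L^l)$, $\mathbf u_{tt}\in L^2(0,t_f;(W^{1,l})^d)$, with the sum of all these norms bounded by a constant (all spaces over $\Omega$). Discretization. $\mathcal T_h$ is a regular triangulation of $\Omega$ with mesh size $h=\max_{K\in\mathcal T_h}h_K$, $h_K$ the diameter of $K$. For $k_1,k_2,k_3\ge1$: $\mathbf V_h=\{\mathbf v\in\mathbf V:\mathbf v|_K\in(P_{k_1}(K))^d\ \forall K\in\mathcal T_h\}$, $Q_h=\{q\in Q:q|_K\in P_{k_2}(K)\ \forall K\}$, $S_h=\{w\in W:w|_K\in P_{k_3}(K)\ \forall K\}$, where $P_k(K)$ denotes polynomials of degree at most $k$ on $K$. $\tau=t_f/N$ with $N$ a positive integer, $t_n=n\tau$; $\bm f^n=\bm f(t_n)$, $g^n=g(t_n)$, $z^n=z(t_n)$ are understood as elements of $L^2(\Omega)$; $\partial_\tau w^{n+1}=(w^{n+1}-w^n)/\tau$. Cut-off operator: for a (sufficiently large) constant $M>0$ and a vector field $\mathbf z$, $\mathcal M(\mathbf z)(x)=\mathbf z(x)$ if $|\mathbf z(x)|\le M$, and $\mathcal M(\mathbf z)(x)=M\mathbf z(x)/|\mathbf z(x)|$ if $|\mathbf z(x)|>M$. Projections: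 $R_u\mathbf u\in\mathbf V_h$, $R_pp\in Q_h$, $R_TT\in S_h$ are defined by $a(\mathbf u-R_u\mathbf u,\mathbf v_h)=0$ for all $\mathbf v_h\in\mathbf V_h$; $c_p(p-R_pp,q_h)=0$ for all $q_h\in Q_h$; $c_T(T-R_TT,s_h)-(\mathbf K\nabla p\cdot\nabla(T-R_TT),s_h)+\delta(T-R_TT,s_h)=0$ for all $s_h\in S_h$, where $\delta$ is a constant large enough that the last bilinear form is coercive. Sequential algorithm. Level $0$: $\mathbf u_h^0=R_u\mathbf u^0$, $p_h^0=R_pp^0$, $T_h^0=R_TT^0$. Level $1$: $(\mathbf u_h^1,p_h^1,T_h^1)\in\mathbf V_h\times Q_h\times S_h$ is obtained from the coupled linear scheme with $n=0$: for all $(\mathbf v_h,q_h,s_h)\in\mathbf V_h\times Q_h\times S_h$, $$a(\mathbf u_h^{n+1},\mathbf v_h)+\alpha b(p_h^{n+1},\mathbf v_h)+\beta b(T_h^{n+1},\mathbf v_h)=(\bm f^{n+1},\mathbf v_h),$$ $$c_0(\partial_\tau p_h^{n+1},q_h)-b_0(\partial_\tau T_h^{n+1},q_h)-\alpha b(q_h,\partial_\tau\mathbf u_h^{n+1})+c_p(p_h^{n+1},q_h)=(g^{n+1},q_h),$$ $$a_0(\partial_\tau T_h^{n+1},s_h)-b_0(\partial_\tau p_h^{n+1},s_h)-\beta b(s_h,\partial_\tau\mathbf u_h^{n+1})+c_T(T_h^{n+1},s_h)-(\mathcal M(\mathbf K\nabla p_h^n)\cdot\nabla T_h^{n+1},s_h)=(z^{n+1},s_h).$$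 For $n=1,\dots,N-1$, successively: Step 1: find $p_h^{n+1}\in Q_h$ with $c_0(\partial_\tau p_h^{n+1},q_h)-b_0(\partial_\tau T_h^{n},q_h)-\alpha b(q_h,\partial_\tau\mathbf u_h^{n})+c_p(p_h^{n+1},q_h)=(g^{n+1},q_h)$ for all $q_h\in Q_h$. Step 2: find $T_h^{n+1}\in S_h$ with $a_0(\partial_\tau T_h^{n+1},s_h)-b_0(\partial_\tau p_h^{n+1},s_h)-\beta b(s_h,\partial_\tau\mathbf u_h^{n})+c_T(T_h^{n+1},s_h)-(\mathcal M(\mathbf K\nabla p_h^{n})\cdot\nabla T_h^{n+1},s_h)=(z^{n+1},s_h)$ for all $s_h\in S_h$. Step 3: find $\mathbf u_h^{n+1}\in\mathbf V_h$ with $a(\mathbf u_h^{n+1},\mathbf v_h)+\alpha b(p_h^{n+1},\mathbf v_h)+\beta b(T_h^{n+1},\mathbf v_h)+\gamma(\partial_\tau\mathbf u_h^{n+1},\mathbf v_h)-\gamma(\partial_\tau\mathbf u_h^{n},\mathbf v_h)=(\bm f^{n+1},\mathbf v_h)$ for all $\mathbf v_h\in\mathbf V_h$. Here $\gamma>0$ is a stabilization parameter independent of $h$ and $\tau$, depending only on the material parameters. *)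

theory Defs
  imports "HOL-Analysis.Analysis"
begin

section \<open>Smooth functions, Lebesgue and Sobolev spaces\<close>

text \<open>
  The elements of all function spaces below are honest functions on the whole type; only their
  values on the domain matter, and two functions that agree almost everywhere on the domain
  represent the same element. A normed space of (representatives of) functions is a pair
  consisting of its carrier and its norm.
\<close>

type_synonym 'f nspace = "'f set \<times> ('f \<Rightarrow> real)"

definition dir_deriv :: "'a \<Rightarrow> ('a::euclidean_space \<Rightarrow> 'b::real_normed_vector) \<Rightarrow> 'a \<Rightarrow> 'b" where
  "dir_deriv b f x = frechet_derivative f (at x) b"

primrec Ck :: "nat \<Rightarrow> ('a::euclidean_space \<Rightarrow> 'b::real_normed_vector) \<Rightarrow> bool" where
  "Ck 0 f \<longleftrightarrow> continuous_on UNIV f"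
| "Ck (Suc k) f \<longleftrightarrow> (\<forall>x. f differentiable (at x)) \<and> (\<forall>b\<in>Basis. Ck k (dir_deriv b f))"

definition test_functions :: "'a::euclidean_space set \<Rightarrow> ('a \<Rightarrow> real) set" where
  "test_functions S = {\<phi>. (\<forall>k. Ck k \<phi>) \<and> (\<exists>C. compact C \<and> C \<subseteq> S \<and> (\<forall>x. x \<notin> C \<longrightarrow> \<phi> x = 0))}"

text \<open>
  Partial derivatives of higher order are indexed by lists of basis vectors instead of multi-indices,
  so the Sobolev norms below count a mixed derivative once for each ordering (as the norms of the
  tensors of higher derivatives do).
\<close>

definition iter_deriv :: "'a list \<Rightarrow> ('a::euclidean_space \<Rightarrow> real) \<Rightarrow> 'a \<Rightarrow> real" where
  "iter_deriv bs \<phi> = foldr dir_deriv bs \<phi>"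

definition locally_integrable ::
  "'a::euclidean_space set \<Rightarrow> ('a \<Rightarrow> 'b::euclidean_space) \<Rightarrow> bool" where
  "locally_integrable S f \<longleftrightarrow> (\<forall>C. compact C \<and> C \<subseteq> S \<longrightarrow> f absolutely_integrable_on C)"

definition has_weak_deriv ::
  "'a::euclidean_space set \<Rightarrow> 'a list \<Rightarrow> ('a \<Rightarrow> 'b::euclidean_space) \<Rightarrow> ('a \<Rightarrow> 'b) \<Rightarrow> bool" where
  "has_weak_deriv S bs f g \<longleftrightarrow>
     locally_integrable S f \<and> locally_integrable S g \<and>
     (\<forall>\<phi>\<in>test_functions S.
        (LINT x|lebesgue_on S. iter_deriv bs \<phi> x *\<^sub>R f x) =
        (-1) ^ length bs *\<^sub>R (LINT x|lebesgue_on S. \<phi> x *\<^sub>R g x))"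

text \<open>A representative of the weak derivative, which is unique almost everywhere if it exists.\<close>

definition weak_deriv ::
  "'a::euclidean_space set \<Rightarrow> 'a list \<Rightarrow> ('a \<Rightarrow> 'b::euclidean_space) \<Rightarrow> 'a \<Rightarrow> 'b" where
  "weak_deriv S bs f = (SOME g. has_weak_deriv S bs f g)"

definition Lp_norm :: "'a::euclidean_space set \<Rightarrow> real \<Rightarrow> ('a \<Rightarrow> 'b::euclidean_space) \<Rightarrow> real" where
  "Lp_norm S r f = (LINT x|lebesgue_on S. norm (f x) powr r) powr (1 / r)"

definition Lp :: "'a::euclidean_space set \<Rightarrow> real \<Rightarrow> ('a \<Rightarrow> 'b::euclidean_space) nspace" where
  "Lp S r =
     ({f. f \<in> borel_measurable (lebesgue_on S) \<and>
          integrable (lebesgue_on S) (\<lambda>x. norm (f x) powr r)},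
      Lp_norm S r)"

definition Wkp ::
  "'a::euclidean_space set \<Rightarrow> nat \<Rightarrow> real \<Rightarrow> ('a \<Rightarrow> 'b::euclidean_space) nspace" where
  "Wkp S k r =
     ({f \<in> fst (Lp S r). \<forall>bs. set bs \<subseteq> Basis \<and> length bs \<le> k \<longrightarrow>
          (\<exists>g\<in>fst (Lp S r). has_weak_deriv S bs f g)},
      \<lambda>f. (\<Sum>bs | set bs \<subseteq> Basis \<and> length bs \<le> k. Lp_norm S r (weak_deriv S bs f) powr r)
             powr (1 / r))"

abbreviation L2 :: "'a::euclidean_space set \<Rightarrow> ('a \<Rightarrow> 'b::euclidean_space) nspace" where
  "L2 S \<equiv> Lp S 2"

abbreviation Hk :: "'a::euclidean_space set \<Rightarrow> nat \<Rightarrow> ('a \<Rightarrow> 'b::euclidean_space) nspace" where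
  "Hk S k \<equiv> Wkp S k 2"

definition nspace_inter :: "('a \<Rightarrow> 'b) nspace \<Rightarrow> ('a \<Rightarrow> 'b) nspace \<Rightarrow> ('a \<Rightarrow> 'b) nspace" where
  "nspace_inter X Y = (fst X \<inter> fst Y, \<lambda>f. snd X f + snd Y f)"

definition H01 :: "'a::euclidean_space set \<Rightarrow> ('a \<Rightarrow> real) set" where
  "H01 S = {f \<in> fst (Hk S 1). \<exists>\<phi>. (\<forall>n::nat. \<phi> n \<in> test_functions S) \<and>
     (\<lambda>n. snd (Hk S 1) (\<lambda>x. f x - \<phi> n x)) \<longlonglongrightarrow> 0}"

definition H01_vec :: "(real ^ 'd) set \<Rightarrow> (real ^ 'd \<Rightarrow> real ^ 'd) set" where
  "H01_vec S = {v. \<forall>i. (\<lambda>x. v x $ i) \<in> H01 S}"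


section \<open>Bochner spaces\<close>

definition bochner_measurable :: "real \<Rightarrow> ('a \<Rightarrow> 'b::real_vector) nspace \<Rightarrow> (real \<Rightarrow> 'a \<Rightarrow> 'b) \<Rightarrow> bool" where
  "bochner_measurable t_end X w \<longleftrightarrow>
     (AE t in lebesgue_on {0<..<t_end}. w t \<in> fst X) \<and>
     (\<exists>s. (\<forall>n::nat. simple_function (lebesgue_on {0<..<t_end}) (s n) \<and> s n ` {0<..<t_end} \<subseteq> fst X) \<and>
          (AE t in lebesgue_on {0<..<t_end}. (\<lambda>n. snd X (\<lambda>x. s n t x - w t x)) \<longlonglongrightarrow> 0))"

definition has_bochner_int ::
  "real \<Rightarrow> ('a \<Rightarrow> 'b::real_vector) nspace \<Rightarrow> (real \<Rightarrow> 'a \<Rightarrow> 'b) \<Rightarrow> ('a \<Rightarrow> 'b) \<Rightarrow> bool" where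
  "has_bochner_int t_end X w B \<longleftrightarrow>
     bochner_measurable t_end X w \<and> B \<in> fst X \<and>
     (\<exists>s. (\<forall>n::nat. simple_function (lebesgue_on {0<..<t_end}) (s n) \<and> s n ` {0<..<t_end} \<subseteq> fst X) \<and>
          (\<lambda>n. \<integral>\<^sup>+ t. ennreal (snd X (\<lambda>x. s n t x - w t x)) \<partial>lebesgue_on {0<..<t_end}) \<longlonglongrightarrow> 0 \<and>
          (\<lambda>n. snd X (\<lambda>x. (\<Sum>v\<in>s n ` {0<..<t_end}.
                  measure lebesgue {t\<in>{0<..<t_end}. s n t = v} *\<^sub>R v x) - B x)) \<longlonglongrightarrow> 0)"

definition Linf_time :: "real \<Rightarrow> ('a \<Rightarrow> 'b::real_vector) nspace \<Rightarrow> (real \<Rightarrow> 'a \<Rightarrow> 'b) set" where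
  "Linf_time t_end X = {w. bochner_measurable t_end X w \<and>
     (\<exists>C. AE t in lebesgue_on {0<..<t_end}. snd X (w t) \<le> C)}"

definition L2_time :: "real \<Rightarrow> ('a \<Rightarrow> 'b::real_vector) nspace \<Rightarrow> (real \<Rightarrow> 'a \<Rightarrow> 'b) set" where
  "L2_time t_end X = {w. bochner_measurable t_end X w \<and>
     integrable (lebesgue_on {0<..<t_end}) (\<lambda>t. (snd X (w t))\<^sup>2)}"

text \<open>\<open>v\<close> is the distributional derivative of \<open>w\<close> on \<open>(0, t_end)\<close>, with values in \<open>X\<close>.\<close>

definition has_time_deriv ::
  "real \<Rightarrow> ('a \<Rightarrow> 'b::real_vector) nspace \<Rightarrow> (real \<Rightarrow> 'a \<Rightarrow> 'b) \<Rightarrow> (real \<Rightarrow> 'a \<Rightarrow> 'b) \<Rightarrow> bool" where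
  "has_time_deriv t_end X w v \<longleftrightarrow>
     (\<forall>\<phi>\<in>test_functions {0<..<t_end}. \<exists>B.
        has_bochner_int t_end X (\<lambda>t x. deriv \<phi> t *\<^sub>R w t x) B \<and>
        has_bochner_int t_end X (\<lambda>t x. \<phi> t *\<^sub>R v t x) (\<lambda>x. - B x))"

definition H1_time :: "real \<Rightarrow> ('a \<Rightarrow> 'b::real_vector) nspace \<Rightarrow> (real \<Rightarrow> 'a \<Rightarrow> 'b) set" where
  "H1_time t_end X = {w \<in> L2_time t_end X. \<exists>v\<in>L2_time t_end X. has_time_deriv t_end X w v}"

definition continuous_in :: "real \<Rightarrow> ('a \<Rightarrow> 'b::real_vector) nspace \<Rightarrow> (real \<Rightarrow> 'a \<Rightarrow> 'b) \<Rightarrow> bool" where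
  "continuous_in t_end X w \<longleftrightarrow>
     (\<forall>t\<in>{0..t_end}. w t \<in> fst X \<and>
        ((\<lambda>s. snd X (\<lambda>x. w s x - w t x)) \<longlongrightarrow> 0) (at t within {0..t_end}))"


section \<open>The thermo-poroelasticity problem\<close>

record ('d::finite) tpe_problem =
  Omega :: "(real ^ 'd) set"
  t_f :: real
  K_ten :: "real ^ 'd \<Rightarrow> real ^ 'd ^ 'd"
  \<Theta>_ten :: "real ^ 'd \<Rightarrow> real ^ 'd ^ 'd"
  a\<^sub>0 :: real
  b\<^sub>0 :: real
  c\<^sub>0 :: real
  \<alpha> :: real
  \<beta> :: real
  lame_mu :: real
  lame_lambda :: real
  f_src :: "real \<Rightarrow> real ^ 'd \<Rightarrow> real ^ 'd"
  g_src :: "real \<Rightarrow> real ^ 'd \<Rightarrow> real"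
  z_src :: "real \<Rightarrow> real ^ 'd \<Rightarrow> real"
  u_init :: "real ^ 'd \<Rightarrow> real ^ 'd"
  p_init :: "real ^ 'd \<Rightarrow> real"
  T_init :: "real ^ 'd \<Rightarrow> real"

text \<open>
  Bounded convex open sets have a Lipschitz boundary, so this need not be required separately.
\<close>

definition convex_polyhedral_domain :: "(real ^ 'd) set \<Rightarrow> bool" where
  "convex_polyhedral_domain S \<longleftrightarrow> open S \<and> convex S \<and> S \<noteq> {} \<and> polytope (closure S)"

definition L2_inner ::
  "(real ^ 'd) set \<Rightarrow> (real ^ 'd \<Rightarrow> 'b::euclidean_space) \<Rightarrow> (real ^ 'd \<Rightarrow> 'b) \<Rightarrow> real" where
  "L2_inner S f g = (LINT x|lebesgue_on S. f x \<bullet> g x)"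

definition grad :: "(real ^ 'd) set \<Rightarrow> (real ^ 'd \<Rightarrow> real) \<Rightarrow> real ^ 'd \<Rightarrow> real ^ 'd" where
  "grad S q x = (\<chi> j. weak_deriv S [axis j 1] q x)"

definition grad_vec :: "(real ^ 'd) set \<Rightarrow> (real ^ 'd \<Rightarrow> real ^ 'd) \<Rightarrow> real ^ 'd \<Rightarrow> real ^ 'd ^ 'd" where
  "grad_vec S v x = (\<chi> i. grad S (\<lambda>y. v y $ i) x)"

definition strain :: "(real ^ 'd) set \<Rightarrow> (real ^ 'd \<Rightarrow> real ^ 'd) \<Rightarrow> real ^ 'd \<Rightarrow> real ^ 'd ^ 'd" where
  "strain S v x = (1 / 2) *\<^sub>R (grad_vec S v x + transpose (grad_vec S v x))"

definition divergence :: "(real ^ 'd) set \<Rightarrow> (real ^ 'd \<Rightarrow> real ^ 'd) \<Rightarrow> real ^ 'd \<Rightarrow> real" where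
  "divergence S v x = (\<Sum>i\<in>UNIV. grad_vec S v x $ i $ i)"

definition a_form ::
  "('d::finite) tpe_problem \<Rightarrow> (real ^ 'd \<Rightarrow> real ^ 'd) \<Rightarrow> (real ^ 'd \<Rightarrow> real ^ 'd) \<Rightarrow> real" where
  "a_form P u v =
     2 * lame_mu P * L2_inner (Omega P) (strain (Omega P) u) (strain (Omega P) v) +
     lame_lambda P * L2_inner (Omega P) (divergence (Omega P) u) (divergence (Omega P) v)"

definition b_form ::
  "('d::finite) tpe_problem \<Rightarrow> (real ^ 'd \<Rightarrow> real) \<Rightarrow> (real ^ 'd \<Rightarrow> real ^ 'd) \<Rightarrow> real" where
  "b_form P q v = L2_inner (Omega P) (grad (Omega P) q) v"

definition cp_form ::
  "('d::finite) tpe_problem \<Rightarrow> (real ^ 'd \<Rightarrow> real) \<Rightarrow> (real ^ 'd \<Rightarrow> real) \<Rightarrow> real" where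
  "cp_form P p q = L2_inner (Omega P) (\<lambda>x. K_ten P x *v grad (Omega P) p x) (grad (Omega P) q)"

definition cT_form ::
  "('d::finite) tpe_problem \<Rightarrow> (real ^ 'd \<Rightarrow> real) \<Rightarrow> (real ^ 'd \<Rightarrow> real) \<Rightarrow> real" where
  "cT_form P T s = L2_inner (Omega P) (\<lambda>x. \<Theta>_ten P x *v grad (Omega P) T x) (grad (Omega P) s)"

definition darcy :: "('d::finite) tpe_problem \<Rightarrow> (real ^ 'd \<Rightarrow> real) \<Rightarrow> real ^ 'd \<Rightarrow> real ^ 'd" where
  "darcy P p x = K_ten P x *v grad (Omega P) p x"

definition convection :: "('d::finite) tpe_problem \<Rightarrow>
    (real ^ 'd \<Rightarrow> real ^ 'd) \<Rightarrow> (real ^ 'd \<Rightarrow> real) \<Rightarrow> (real ^ 'd \<Rightarrow> real) \<Rightarrow> real" where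
  "convection P w T s = L2_inner (Omega P) (\<lambda>x. w x \<bullet> grad (Omega P) T x) s"

text \<open>Measurability is implicit in the \<open>L\<^sup>2\<close> products containing the tensors.\<close>

definition admissible_tensor ::
  "(real ^ 'd) set \<Rightarrow> (real ^ 'd \<Rightarrow> real ^ 'd ^ 'd) \<Rightarrow> real \<Rightarrow> real \<Rightarrow> bool" where
  "admissible_tensor S A m M \<longleftrightarrow>
     A \<in> borel_measurable (lebesgue_on S) \<and> 0 < m \<and> 0 < M \<and>
     (\<forall>x\<in>S. transpose (A x) = A x \<and>
        (\<forall>\<zeta>. \<zeta> \<noteq> 0 \<longrightarrow> 0 < \<zeta> \<bullet> (A x *v \<zeta>)) \<and>
        (\<forall>\<zeta>. m * (norm \<zeta>)\<^sup>2 \<le> \<zeta> \<bullet> (A x *v \<zeta>) \<and> norm (A x *v \<zeta>) \<le> M * norm \<zeta>))"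

definition source_regularity :: "('d::finite) tpe_problem \<Rightarrow> bool" where
  "source_regularity P \<longleftrightarrow>
     z_src P \<in> L2_time (t_f P) (L2 (Omega P)) \<and>
     g_src P \<in> L2_time (t_f P) (L2 (Omega P)) \<and>
     f_src P \<in> H1_time (t_f P) (L2 (Omega P))"

definition initial_regularity :: "('d::finite) tpe_problem \<Rightarrow> bool" where
  "initial_regularity P \<longleftrightarrow>
     p_init P \<in> H01 (Omega P) \<and> T_init P \<in> H01 (Omega P) \<and> u_init P \<in> H01_vec (Omega P)"

text \<open>
  The initial values are attained by the representatives that are continuous in time with values
  in \<open>L\<^sup>2\<close>; since the time derivatives are only determined for almost every time, the
  variational equations are required for almost every time.
\<close>

definition weak_solution :: "('d::finite) tpe_problem \<Rightarrow>
    (real \<Rightarrow> real ^ 'd \<Rightarrow> real ^ 'd) \<Rightarrow> (real \<Rightarrow> real ^ 'd \<Rightarrow> real) \<Rightarrow> (real \<Rightarrow> real ^ 'd \<Rightarrow> real) \<Rightarrow>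
    (real \<Rightarrow> real ^ 'd \<Rightarrow> real ^ 'd) \<Rightarrow> (real \<Rightarrow> real ^ 'd \<Rightarrow> real) \<Rightarrow> (real \<Rightarrow> real ^ 'd \<Rightarrow> real) \<Rightarrow> bool"
where
  "weak_solution P u p T u_t p_t T_t \<longleftrightarrow>
     (\<forall>t\<in>{0<..t_f P}. u t \<in> H01_vec (Omega P) \<and> p t \<in> H01 (Omega P) \<and> T t \<in> H01 (Omega P)) \<and>
     continuous_in (t_f P) (L2 (Omega P)) u \<and>
     continuous_in (t_f P) (L2 (Omega P)) p \<and>
     continuous_in (t_f P) (L2 (Omega P)) T \<and>
     has_time_deriv (t_f P) (L2 (Omega P)) u u_t \<and>
     has_time_deriv (t_f P) (L2 (Omega P)) p p_t \<and>
     has_time_deriv (t_f P) (L2 (Omega P)) T T_t \<and>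
     (AE t in lebesgue_on {0<..<t_f P}.
        \<forall>v\<in>H01_vec (Omega P). \<forall>q\<in>H01 (Omega P). \<forall>s\<in>H01 (Omega P).
          a_form P (u t) v + \<alpha> P * b_form P (p t) v + \<beta> P * b_form P (T t) v
            = L2_inner (Omega P) (f_src P t) v \<and>
          c\<^sub>0 P * L2_inner (Omega P) (p_t t) q - b\<^sub>0 P * L2_inner (Omega P) (T_t t) q
            - \<alpha> P * b_form P q (u_t t) + cp_form P (p t) q
            = L2_inner (Omega P) (g_src P t) q \<and>
          a\<^sub>0 P * L2_inner (Omega P) (T_t t) s - b\<^sub>0 P * L2_inner (Omega P) (p_t t) s
            - \<beta> P * b_form P s (u_t t) - convection P (darcy P (p t)) (T t) s + cT_form P (T t) s
            = L2_inner (Omega P) (z_src P t) s) \<and>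
     (AE x in lebesgue_on (Omega P). u 0 x = u_init P x) \<and>
     (AE x in lebesgue_on (Omega P). p 0 x = p_init P x) \<and>
     (AE x in lebesgue_on (Omega P). T 0 x = T_init P x)"

definition solution_regularity :: "('d::finite) tpe_problem \<Rightarrow> real \<Rightarrow> nat \<Rightarrow> nat \<Rightarrow> nat \<Rightarrow>
    (real \<Rightarrow> real ^ 'd \<Rightarrow> real ^ 'd) \<Rightarrow> (real \<Rightarrow> real ^ 'd \<Rightarrow> real) \<Rightarrow> (real \<Rightarrow> real ^ 'd \<Rightarrow> real) \<Rightarrow>
    (real \<Rightarrow> real ^ 'd \<Rightarrow> real ^ 'd) \<Rightarrow> (real \<Rightarrow> real ^ 'd \<Rightarrow> real) \<Rightarrow> (real \<Rightarrow> real ^ 'd \<Rightarrow> real) \<Rightarrow> bool"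
where
  "solution_regularity P l k\<^sub>1 k\<^sub>2 k\<^sub>3 u p T u_t p_t T_t \<longleftrightarrow>
     (\<lambda>t. grad (Omega P) (p t)) \<in> Linf_time (t_f P) (Wkp (Omega P) 1 l) \<and>
     p \<in> Linf_time (t_f P) (nspace_inter (Wkp (Omega P) 2 l) (Hk (Omega P) (k\<^sub>2 + 1))) \<and>
     T \<in> Linf_time (t_f P) (Hk (Omega P) (k\<^sub>3 + 1)) \<and>
     u \<in> Linf_time (t_f P) (Hk (Omega P) (k\<^sub>1 + 1)) \<and>
     p_t \<in> Linf_time (t_f P) (Wkp (Omega P) 1 l) \<and>
     T_t \<in> Linf_time (t_f P) (Wkp (Omega P) 1 l) \<and>
     u_t \<in> Linf_time (t_f P) (Wkp (Omega P) 2 l) \<and>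
     (\<exists>p_tt T_tt u_tt.
        has_time_deriv (t_f P) (L2 (Omega P)) p_t p_tt \<and>
        has_time_deriv (t_f P) (L2 (Omega P)) T_t T_tt \<and>
        has_time_deriv (t_f P) (L2 (Omega P)) u_t u_tt \<and>
        p_tt \<in> L2_time (t_f P) (Lp (Omega P) l) \<and>
        T_tt \<in> L2_time (t_f P) (Lp (Omega P) l) \<and>
        u_tt \<in> L2_time (t_f P) (Wkp (Omega P) 1 l))"


section \<open>Finite element spaces and the sequential algorithm\<close>

record ('d::finite) discretization =
  mesh :: "(real ^ 'd) set set"
  deg_u :: nat
  deg_p :: nat
  deg_T :: nat
  N_steps :: nat
  cut_M :: real
  stab_\<gamma> :: real
  shift_\<delta> :: real

text \<open>A conforming simplicial mesh with shape-regularity constant \<open>\<sigma>\<close>.\<close>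

definition regular_triangulation :: "(real ^ 'd) set \<Rightarrow> real \<Rightarrow> (real ^ 'd) set set \<Rightarrow> bool" where
  "regular_triangulation S \<sigma> \<T> \<longleftrightarrow>
     triangulation \<T> \<and> (\<forall>K\<in>\<T>. int CARD('d) simplex K) \<and> \<Union>\<T> = closure S \<and>
     (\<forall>K\<in>\<T>. diameter K \<le> \<sigma> * Sup {2 * r | r x. 0 < r \<and> cball x r \<subseteq> K})"

definition polynomials :: "nat \<Rightarrow> (real ^ 'd \<Rightarrow> real) set" where
  "polynomials k = {q. \<exists>c :: ('d \<Rightarrow> nat) \<Rightarrow> real. \<forall>x.
     q x = (\<Sum>e | (\<Sum>i\<in>UNIV. e i) \<le> k. c e * (\<Prod>i\<in>UNIV. (x $ i) ^ e i))}"

definition piecewise_poly :: "(real ^ 'd) set set \<Rightarrow> nat \<Rightarrow> (real ^ 'd \<Rightarrow> real) set" where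
  "piecewise_poly \<T> k = {w. \<forall>K\<in>\<T>. \<exists>q\<in>polynomials k. AE x in lebesgue_on K. w x = q x}"

definition V_h :: "('d::finite) tpe_problem \<Rightarrow> 'd discretization \<Rightarrow> (real ^ 'd \<Rightarrow> real ^ 'd) set" where
  "V_h P D = {v \<in> H01_vec (Omega P). \<forall>i. (\<lambda>x. v x $ i) \<in> piecewise_poly (mesh D) (deg_u D)}"

definition Q_h :: "('d::finite) tpe_problem \<Rightarrow> 'd discretization \<Rightarrow> (real ^ 'd \<Rightarrow> real) set" where
  "Q_h P D = H01 (Omega P) \<inter> piecewise_poly (mesh D) (deg_p D)"

definition S_h :: "('d::finite) tpe_problem \<Rightarrow> 'd discretization \<Rightarrow> (real ^ 'd \<Rightarrow> real) set" where
  "S_h P D = H01 (Omega P) \<inter> piecewise_poly (mesh D) (deg_T D)"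

definition tau :: "('d::finite) tpe_problem \<Rightarrow> 'd discretization \<Rightarrow> real" where
  "tau P D = t_f P / real (N_steps D)"

definition t_lev :: "('d::finite) tpe_problem \<Rightarrow> 'd discretization \<Rightarrow> nat \<Rightarrow> real" where
  "t_lev P D n = real n * tau P D"

text \<open>The backward difference quotient; it is only used at levels \<open>n \<ge> 1\<close>.\<close>

definition bdiff :: "('d::finite) tpe_problem \<Rightarrow> 'd discretization \<Rightarrow>
    (nat \<Rightarrow> real ^ 'd \<Rightarrow> 'b::real_vector) \<Rightarrow> nat \<Rightarrow> real ^ 'd \<Rightarrow> 'b" where
  "bdiff P D w n x = (w n x - w (n - 1) x) /\<^sub>R tau P D"

definition cutoff :: "real \<Rightarrow> ('a \<Rightarrow> 'b::real_normed_vector) \<Rightarrow> 'a \<Rightarrow> 'b" where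
  "cutoff M z x = (if norm (z x) \<le> M then z x else (M / norm (z x)) *\<^sub>R z x)"

definition RT_form :: "('d::finite) tpe_problem \<Rightarrow> real \<Rightarrow>
    (real ^ 'd \<Rightarrow> real) \<Rightarrow> (real ^ 'd \<Rightarrow> real) \<Rightarrow> (real ^ 'd \<Rightarrow> real) \<Rightarrow> real" where
  "RT_form P \<delta> p w s = cT_form P w s - convection P (darcy P p) w s + \<delta> * L2_inner (Omega P) w s"

definition RT_coercive :: "('d::finite) tpe_problem \<Rightarrow> real \<Rightarrow> (real ^ 'd \<Rightarrow> real) \<Rightarrow> bool" where
  "RT_coercive P \<delta> p \<longleftrightarrow>
     (\<exists>c>0. \<forall>w\<in>H01 (Omega P). c * (snd (Hk (Omega P) 1) w)\<^sup>2 \<le> RT_form P \<delta> p w w)"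

definition is_Ru :: "('d::finite) tpe_problem \<Rightarrow> 'd discretization \<Rightarrow>
    (real ^ 'd \<Rightarrow> real ^ 'd) \<Rightarrow> (real ^ 'd \<Rightarrow> real ^ 'd) \<Rightarrow> bool" where
  "is_Ru P D u r \<longleftrightarrow> r \<in> V_h P D \<and> (\<forall>v\<in>V_h P D. a_form P (\<lambda>x. u x - r x) v = 0)"

definition is_Rp :: "('d::finite) tpe_problem \<Rightarrow> 'd discretization \<Rightarrow>
    (real ^ 'd \<Rightarrow> real) \<Rightarrow> (real ^ 'd \<Rightarrow> real) \<Rightarrow> bool" where
  "is_Rp P D p r \<longleftrightarrow> r \<in> Q_h P D \<and> (\<forall>q\<in>Q_h P D. cp_form P (\<lambda>x. p x - r x) q = 0)"

definition is_RT :: "('d::finite) tpe_problem \<Rightarrow> 'd discretization \<Rightarrow>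
    (real ^ 'd \<Rightarrow> real) \<Rightarrow> (real ^ 'd \<Rightarrow> real) \<Rightarrow> (real ^ 'd \<Rightarrow> real) \<Rightarrow> bool" where
  "is_RT P D p T r \<longleftrightarrow> r \<in> S_h P D \<and>
     (\<forall>s\<in>S_h P D. RT_form P (shift_\<delta> D) p (\<lambda>x. T x - r x) s = 0)"

definition coupled_step :: "('d::finite) tpe_problem \<Rightarrow> 'd discretization \<Rightarrow> nat \<Rightarrow>
    (nat \<Rightarrow> real ^ 'd \<Rightarrow> real ^ 'd) \<Rightarrow> (nat \<Rightarrow> real ^ 'd \<Rightarrow> real) \<Rightarrow> (nat \<Rightarrow> real ^ 'd \<Rightarrow> real) \<Rightarrow> bool" where
  "coupled_step P D n u p T \<longleftrightarrow>
     (\<forall>v\<in>V_h P D. \<forall>q\<in>Q_h P D. \<forall>s\<in>S_h P D.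
        a_form P (u (n + 1)) v + \<alpha> P * b_form P (p (n + 1)) v + \<beta> P * b_form P (T (n + 1)) v
          = L2_inner (Omega P) (f_src P (t_lev P D (n + 1))) v \<and>
        c\<^sub>0 P * L2_inner (Omega P) (bdiff P D p (n + 1)) q
          - b\<^sub>0 P * L2_inner (Omega P) (bdiff P D T (n + 1)) q
          - \<alpha> P * b_form P q (bdiff P D u (n + 1)) + cp_form P (p (n + 1)) q
          = L2_inner (Omega P) (g_src P (t_lev P D (n + 1))) q \<and>
        a\<^sub>0 P * L2_inner (Omega P) (bdiff P D T (n + 1)) s
          - b\<^sub>0 P * L2_inner (Omega P) (bdiff P D p (n + 1)) s
          - \<beta> P * b_form P s (bdiff P D u (n + 1)) + cT_form P (T (n + 1)) s
          - convection P (cutoff (cut_M D) (darcy P (p n))) (T (n + 1)) s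
          = L2_inner (Omega P) (z_src P (t_lev P D (n + 1))) s)"

definition sequential_step :: "('d::finite) tpe_problem \<Rightarrow> 'd discretization \<Rightarrow> nat \<Rightarrow>
    (nat \<Rightarrow> real ^ 'd \<Rightarrow> real ^ 'd) \<Rightarrow> (nat \<Rightarrow> real ^ 'd \<Rightarrow> real) \<Rightarrow> (nat \<Rightarrow> real ^ 'd \<Rightarrow> real) \<Rightarrow> bool" where
  "sequential_step P D n u p T \<longleftrightarrow>
     (\<forall>q\<in>Q_h P D.
        c\<^sub>0 P * L2_inner (Omega P) (bdiff P D p (n + 1)) q
          - b\<^sub>0 P * L2_inner (Omega P) (bdiff P D T n) q
          - \<alpha> P * b_form P q (bdiff P D u n) + cp_form P (p (n + 1)) q
          = L2_inner (Omega P) (g_src P (t_lev P D (n + 1))) q) \<and>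
     (\<forall>s\<in>S_h P D.
        a\<^sub>0 P * L2_inner (Omega P) (bdiff P D T (n + 1)) s
          - b\<^sub>0 P * L2_inner (Omega P) (bdiff P D p (n + 1)) s
          - \<beta> P * b_form P s (bdiff P D u n) + cT_form P (T (n + 1)) s
          - convection P (cutoff (cut_M D) (darcy P (p n))) (T (n + 1)) s
          = L2_inner (Omega P) (z_src P (t_lev P D (n + 1))) s) \<and>
     (\<forall>v\<in>V_h P D.
        a_form P (u (n + 1)) v + \<alpha> P * b_form P (p (n + 1)) v + \<beta> P * b_form P (T (n + 1)) v
          + stab_\<gamma> D * L2_inner (Omega P) (bdiff P D u (n + 1)) v
          - stab_\<gamma> D * L2_inner (Omega P) (bdiff P D u n) v
          = L2_inner (Omega P) (f_src P (t_lev P D (n + 1))) v)"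

text \<open>\<open>(u n, p n, T n)\<close>, for \<open>n = 0, \<dots>, m\<close>, are iterates of the sequential algorithm;
  the projection of the initial temperature is taken at the initial pressure.\<close>

definition sequential_solution :: "('d::finite) tpe_problem \<Rightarrow> 'd discretization \<Rightarrow> nat \<Rightarrow>
    (nat \<Rightarrow> real ^ 'd \<Rightarrow> real ^ 'd) \<Rightarrow> (nat \<Rightarrow> real ^ 'd \<Rightarrow> real) \<Rightarrow> (nat \<Rightarrow> real ^ 'd \<Rightarrow> real) \<Rightarrow> bool" where
  "sequential_solution P D m u p T \<longleftrightarrow>
     (\<forall>n\<le>m. u n \<in> V_h P D \<and> p n \<in> Q_h P D \<and> T n \<in> S_h P D) \<and>
     is_Ru P D (u_init P) (u 0) \<and>
     is_Rp P D (p_init P) (p 0) \<and>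
     is_RT P D (p_init P) (T_init P) (T 0) \<and>
     (1 \<le> m \<longrightarrow> coupled_step P D 0 u p T) \<and>
     (\<forall>n. 1 \<le> n \<and> n < m \<longrightarrow> sequential_step P D n u p T)"

end

theory Submission
  imports Defs "HOL-Computational_Algebra.Polynomial"
begin

text \<open>
  Every step of the algorithm is a square linear system on a space of finite dimension modulo
  equality almost everywhere, so it suffices that its form \<open>B\<close> is definite: \<open>B w w \<le> 0\<close> forces
  \<open>w = 0\<close>. For the pressure and displacement steps this is immediate. In the temperature step
  Young's inequality bounds \<open>(\<M>(K \<nabla>p) \<cdot> \<nabla>T, T)\<close> by \<open>\<theta>\<^sub>m \<parallel>\<nabla>T\<parallel>\<^sup>2 + M\<^sup>2 / (4 \<theta>\<^sub>m) \<parallel>T\<parallel>\<^sup>2\<close>, and the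
  restriction on \<open>\<tau>\<close> makes the last term at most \<open>a\<^sub>0 / (2 \<tau>) \<parallel>T\<parallel>\<^sup>2\<close>. In the coupled first step the
  coupling terms cancel when the equations are tested with the solution, and
  \<open>2 b\<^sub>0 (p, T) \<le> 2 b\<^sub>0 \<parallel>p\<parallel>\<^sup>2 + b\<^sub>0 / 2 \<parallel>T\<parallel>\<^sup>2\<close> leaves \<open>(c\<^sub>0 - 2 b\<^sub>0) \<parallel>p\<parallel>\<^sup>2 + (a\<^sub>0 - b\<^sub>0) / 2 \<parallel>T\<parallel>\<^sup>2\<close>.

  Linearity of the gradient rests on the almost everywhere uniqueness of weak derivatives, and
  definiteness of the projections on a Poincare inequality for one directional derivative.
\<close>

section \<open>Finite-dimensional variational problems\<close>

text \<open>The spaces consist of functions, not of classes, so even \<open>V_h\<close> contains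
  every modification on a null set and has no finite basis. Instead of forming a quotient, finite
  dimension is expressed by finitely many linear functionals whose common zeros vanish almost
  everywhere, and solvability is proved by induction on their number. Hence every form must be shown
  to respect equality almost everywhere, and uniqueness of one step must be proved for data that
  agree only almost everywhere, because the levels before it are known only in that sense. The
  uneven Young weights of the coupled step are dictated by the sign conditions: convection has
  already consumed half of \<open>a\<^sub>0\<close>, and an even split would leave the mass
  coefficient \<open>a\<^sub>0 / 2 - b\<^sub>0\<close> for the temperature, which vanishes when
  \<open>a\<^sub>0 = 2 b\<^sub>0\<close>. Moving weight to the pressure is affordable because
  \<open>c\<^sub>0 - 2 b\<^sub>0\<close> is strictly positive.\<close>

definition lin_closed :: "('a \<Rightarrow> 'b::real_vector) set \<Rightarrow> bool" where
  "lin_closed X \<longleftrightarrow> (\<lambda>x. 0) \<in> X \<and> (\<forall>f\<in>X. \<forall>g\<in>X. \<forall>c. (\<lambda>x. f x + c *\<^sub>R g x) \<in> X)"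

definition linear_form :: "('a \<Rightarrow> 'b::real_vector) set \<Rightarrow> (('a \<Rightarrow> 'b) \<Rightarrow> real) \<Rightarrow> bool" where
  "linear_form X F \<longleftrightarrow> (\<forall>f\<in>X. \<forall>g\<in>X. \<forall>c. F (\<lambda>x. f x + c *\<^sub>R g x) = F f + c * F g)"

lemma lin_closedD:
  assumes "lin_closed X"
  shows "(\<lambda>x. 0) \<in> X" "f \<in> X \<Longrightarrow> g \<in> X \<Longrightarrow> (\<lambda>x. f x + c *\<^sub>R g x) \<in> X"
  using assms by (auto simp: lin_closed_def)

lemma linear_formD:
  "linear_form X F \<Longrightarrow> f \<in> X \<Longrightarrow> g \<in> X \<Longrightarrow> F (\<lambda>x. f x + c *\<^sub>R g x) = F f + c * F g"
  by (auto simp: linear_form_def)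

lemma linear_form_zero: "linear_form X F \<Longrightarrow> (\<lambda>x. 0) \<in> X \<Longrightarrow> F (\<lambda>x. 0) = 0"
  using linear_formD[of X F "\<lambda>x. 0" "\<lambda>x. 0" 1] by simp

lemma linear_form_subset: "linear_form X F \<Longrightarrow> Y \<subseteq> X \<Longrightarrow> linear_form Y F"
  unfolding linear_form_def by blast

lemma linear_form_add:
  "linear_form X F \<Longrightarrow> linear_form X G \<Longrightarrow> linear_form X (\<lambda>w. F w + G w)"
  by (auto simp: linear_form_def algebra_simps)

lemma linear_form_diff:
  "linear_form X F \<Longrightarrow> linear_form X G \<Longrightarrow> linear_form X (\<lambda>w. F w - G w)"
  by (auto simp: linear_form_def algebra_simps)

lemma linear_form_cmult: "linear_form X F \<Longrightarrow> linear_form X (\<lambda>w. c * F w)"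
  by (auto simp: linear_form_def algebra_simps)

text \<open>Gram-Schmidt without symmetry. \<open>L\<close> separates \<open>X\<close> up to the
  null elements \<open>N\<close>; one functional \<open>l\<close> is removed by solving on its
  kernel and then correcting along a single direction that pairs to zero with the kernel. With
  \<open>L\<close> empty every element is null, so \<open>F\<close> vanishes and the zero function
  is a solution.\<close>

theorem finite_dim_variational_solution:
  assumes "finite L" "lin_closed X" "\<forall>l\<in>L. linear_form X l"
    and "\<forall>w\<in>X. (\<forall>l\<in>L. l w = 0) \<longrightarrow> N w"
    and "\<forall>v\<in>X. linear_form X (\<lambda>u. B u v)" "\<forall>u\<in>X. linear_form X (B u)"
    and "\<forall>w\<in>X. B w w = 0 \<longrightarrow> N w"
    and "\<forall>w\<in>X. N w \<longrightarrow> (\<forall>u\<in>X. B u w = 0)"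
    and "linear_form X F" "\<forall>w\<in>X. N w \<longrightarrow> F w = 0"
  shows "\<exists>w\<in>X. \<forall>v\<in>X. B w v = F v"
  using assms
proof (induction L arbitrary: X F rule: finite_induct)
  case empty
  have z: "(\<lambda>x. 0) \<in> X" using empty.prems(1) by (rule lin_closedD)
  moreover have "B (\<lambda>x. 0) v = F v" if "v \<in> X" for v
    using that z empty.prems(3,4,9) linear_form_zero[of X "\<lambda>u. B u v"] by simp
  ultimately show ?case by blast
next
  case (insert l L)
  note X = insert.prems(1) and B1 = insert.prems(4) and B2 = insert.prems(5)
  have l: "linear_form X l" using insert.prems(2) by blast
  \<comment> \<open>On the kernel of \<open>l\<close> the remaining functionals already separate, so
    the induction hypothesis applies to \<open>Y\<close>.\<close>
  define Y where "Y = {w\<in>X. l w = 0}"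
  have YX: "Y \<subseteq> X" by (auto simp: Y_def)
  have Y: "lin_closed Y"
    using lin_closedD[OF X] linear_form_zero[OF l] linear_formD[OF l]
    unfolding lin_closed_def Y_def by simp
  \<comment> \<open>Kept general in the right-hand side: it is used for \<open>F\<close> and again
    for \<open>B \<phi>\<close>.\<close>
  have IH: "\<exists>w\<in>Y. \<forall>v\<in>Y. B w v = G v"
    if "linear_form Y G" "\<forall>w\<in>Y. N w \<longrightarrow> G w = 0" for G
  proof (rule insert.IH[OF Y])
    show "\<forall>l'\<in>L. linear_form Y l'"
      using insert.prems(2) linear_form_subset[OF _ YX] by blast
    show "\<forall>w\<in>Y. (\<forall>l\<in>L. l w = 0) \<longrightarrow> N w"
      using insert.prems(3) by (auto simp: Y_def)
    show "\<forall>v\<in>Y. linear_form Y (\<lambda>u. B u v)" "\<forall>u\<in>Y. linear_form Y (B u)"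
      using insert.prems(4,5) YX linear_form_subset[OF _ YX] by blast+
    show "\<forall>w\<in>Y. B w w = 0 \<longrightarrow> N w" "\<forall>w\<in>Y. N w \<longrightarrow> (\<forall>u\<in>Y. B u w = 0)"
      using insert.prems(6,7) YX by blast+
    show "linear_form Y G" "\<forall>w\<in>Y. N w \<longrightarrow> G w = 0" by fact+
  qed
  obtain w0 where w0: "w0 \<in> Y" "\<forall>v\<in>Y. B w0 v = F v"
    using IH[of F] insert.prems(8,9) linear_form_subset[OF _ YX] YX by blast
  show ?case
  proof (cases "\<exists>\<phi>\<in>X. l \<phi> \<noteq> 0")
    case False
    then have "Y = X" by (auto simp: Y_def)
    then show ?thesis using w0 by blast
  next
    case True
    then obtain \<phi> where \<phi>: "\<phi> \<in> X" "l \<phi> \<noteq> 0" by blast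
    \<comment> \<open>\<open>\<psi>\<close> is the Galerkin approximation of \<open>\<phi>\<close>
      in \<open>Y\<close>. The error \<open>e = \<phi> - \<psi>\<close> therefore satisfies
      \<open>B e v = 0\<close> on \<open>Y\<close>, while \<open>l e = l \<phi>\<close> is nonzero,
      so \<open>e\<close> spans \<open>X\<close> modulo \<open>Y\<close>.\<close>
    obtain \<psi> where \<psi>: "\<psi> \<in> Y" "\<forall>v\<in>Y. B \<psi> v = B \<phi> v"
      using IH[of "B \<phi>"] B2 \<phi> insert.prems(7) linear_form_subset[OF _ YX] YX by blast
    have mem: "\<psi> \<in> X" "w0 \<in> X" using \<psi> w0 YX by blast+
    define e where "e = (\<lambda>x. \<phi> x + (-1) *\<^sub>R \<psi> x)"
    have e: "e \<in> X" unfolding e_def using X \<phi>(1) mem(1) by (intro lin_closedD)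
    have eY: "B e v = 0" if "v \<in> Y" for v
      using linear_formD[of X "\<lambda>u. B u v" \<phi> \<psi> "-1"] B1 YX \<phi>(1) mem(1) \<psi>(2)[rule_format, OF that] subsetD[OF YX that]
      unfolding e_def by simp
    have le: "l e = l \<phi>"
      using linear_formD[OF l \<phi>(1) mem(1), of "-1"] \<psi>(1) by (simp add: e_def Y_def)
    \<comment> \<open>A vanishing \<open>B e e\<close> is no obstruction: \<open>e\<close> is then
      null, so \<open>F e\<close> and \<open>B w0 e\<close> vanish as well and any \<open>t\<close>
      serves.\<close>
    have sol: "\<exists>t. B w0 e + t * B e e = F e"
    proof (cases "B e e = 0")
      case True
      then have "N e" using insert.prems(6) e by blast
      then have "F e = 0" "B w0 e = 0" using insert.prems(7,9) e mem(2) by blast+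
      then show ?thesis using True by simp
    next
      case False
      then show ?thesis by (intro exI[of _ "(F e - B w0 e) / B e e"]) simp
    qed
    then obtain t where t: "B w0 e + t * B e e = F e" by blast
    define w where "w = (\<lambda>x. w0 x + t *\<^sub>R e x)"
    have w: "w \<in> X" unfolding w_def using X mem(2) e by (intro lin_closedD)
    have Bw: "B w v = B w0 v + t * B e v" if "v \<in> X" for v
      using linear_formD[of X "\<lambda>u. B u v" w0 e t] B1 that mem(2) e unfolding w_def by blast
    have "B w v = F v" if v: "v \<in> X" for v
    proof -
      \<comment> \<open>The coefficient for which \<open>v - c e\<close> lies in the kernel of
        \<open>l\<close>.\<close>
      define c where "c = l v / l e"
      define y where "y = (\<lambda>x. v x + (- c) *\<^sub>R e x)"
      have yX: "y \<in> X" unfolding y_def using X v e by (intro lin_closedD)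
      have y: "y \<in> Y" using linear_formD[OF l v e, of "-c"] \<phi>(2) yX
        by (simp add: Y_def y_def c_def le)
      have v_eq: "v = (\<lambda>x. y x + c *\<^sub>R e x)" by (auto simp: y_def)
      have "B w v = B w y + c * B w e"
        by (subst v_eq, rule linear_formD[of X "B w"]) (use B2 w yX e in auto)
      also have "B w y = F y" using Bw[OF yX] eY[OF y] w0(2) y by simp
      also have "B w e = F e" using Bw[OF e] t by simp
      also have "F y + c * F e = F v"
        by (subst v_eq, rule linear_formD[symmetric]) (use insert.prems(8) yX e in auto)
      finally show ?thesis .
    qed
    then show ?thesis using w by blast
  qed
qed

section \<open>Smooth functions\<close>

lemma dir_deriv_eqI: "(f has_derivative f') (at x) \<Longrightarrow> dir_deriv b f x = f' b"
  by (simp add: dir_deriv_def frechet_derivative_at[symmetric])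

text \<open>A coinduction principle for infinite differentiability: for a family stable under
  coordinate derivatives, no formula for the higher derivatives has to be found.\<close>

lemma Ck_family:
  assumes "\<And>f. f \<in> \<F> \<Longrightarrow> (\<forall>x. f differentiable (at x)) \<and> (\<forall>b\<in>Basis. dir_deriv b f \<in> \<F>)"
    and "f \<in> \<F>"
  shows "Ck k f"
  using assms(2)
proof (induction k arbitrary: f)
  case 0
  then show ?case using assms(1)
    by (auto intro!: continuous_at_imp_continuous_on differentiable_imp_continuous_within)
next
  case (Suc k)
  then show ?case using assms(1) by auto
qed

definition smooth :: "('a::euclidean_space \<Rightarrow> real) \<Rightarrow> bool" where
  "smooth f \<longleftrightarrow> (\<forall>k. Ck k f)"

lemma smooth_differentiable: "smooth f \<Longrightarrow> f differentiable (at x)"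
  unfolding smooth_def using Ck.simps(2) by blast

lemma smooth_dir_deriv: "smooth f \<Longrightarrow> b \<in> Basis \<Longrightarrow> smooth (dir_deriv b f)"
  unfolding smooth_def using Ck.simps(2) by blast

lemma smooth_continuous: "smooth f \<Longrightarrow> continuous_on UNIV f"
  unfolding smooth_def using Ck.simps(1) by blast

lemma dir_deriv_add:
  assumes "f differentiable (at x)" "g differentiable (at x)"
  shows "dir_deriv b (\<lambda>x. f x + g x) x = dir_deriv b f x + dir_deriv b g x"
  using has_derivative_add[OF assms[unfolded frechet_derivative_works]]
  by (simp add: dir_deriv_eqI) (simp add: dir_deriv_def)

lemma dir_deriv_mult:
  fixes f g :: "'a::euclidean_space \<Rightarrow> real"
  assumes "f differentiable (at x)" "g differentiable (at x)"
  shows "dir_deriv b (\<lambda>x. f x * g x) x = f x * dir_deriv b g x + dir_deriv b f x * g x"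
  using has_derivative_mult[OF assms[unfolded frechet_derivative_works]]
  by (simp add: dir_deriv_eqI) (simp add: dir_deriv_def)

text \<open>The product rule turns a product into a sum of products; closing under both operations
  at once makes the set stable under differentiation, as \<open>Ck_family\<close> requires.\<close>

inductive_set smooth_closure :: "('a::euclidean_space \<Rightarrow> real) set" where
  base: "smooth f \<Longrightarrow> f \<in> smooth_closure"
| add: "f \<in> smooth_closure \<Longrightarrow> g \<in> smooth_closure \<Longrightarrow> (\<lambda>x. f x + g x) \<in> smooth_closure"
| mult: "f \<in> smooth_closure \<Longrightarrow> g \<in> smooth_closure \<Longrightarrow> (\<lambda>x. f x * g x) \<in> smooth_closure"

lemma smooth_closure_smooth:
  assumes "f \<in> smooth_closure" shows "smooth f"
proof -
  have "(\<forall>x. f differentiable (at x)) \<and> (\<forall>b\<in>Basis. dir_deriv b f \<in> smooth_closure)"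
    if "f \<in> smooth_closure" for f :: "'a \<Rightarrow> real"
    using that
  proof induction
    case (base f)
    then show ?case
      by (auto intro: smooth_closure.base smooth_dir_deriv smooth_differentiable)
  next
    case (add f g)
    then have "dir_deriv b (\<lambda>x. f x + g x) = (\<lambda>x. dir_deriv b f x + dir_deriv b g x)" for b
      by (intro ext dir_deriv_add) auto
    then show ?case using add by (auto intro: smooth_closure.add)
  next
    case (mult f g)
    then have "dir_deriv b (\<lambda>x. f x * g x) = (\<lambda>x. f x * dir_deriv b g x + dir_deriv b f x * g x)" for b
      by (intro ext dir_deriv_mult) auto
    then show ?case using mult
      by (auto intro!: smooth_closure.add[of "\<lambda>x. f x * _ x"] smooth_closure.mult)
  qed
  then show ?thesis unfolding smooth_def using Ck_family[of smooth_closure f] assms by blast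
qed

lemma smooth_add: "smooth f \<Longrightarrow> smooth g \<Longrightarrow> smooth (\<lambda>x. f x + g x)"
  by (rule smooth_closure_smooth, rule smooth_closure.add; rule smooth_closure.base)

lemma smooth_mult: "smooth f \<Longrightarrow> smooth g \<Longrightarrow> smooth (\<lambda>x. f x * g x)"
  by (rule smooth_closure_smooth, rule smooth_closure.mult; rule smooth_closure.base)

lemma smooth_const: "smooth (\<lambda>x. c)"
proof -
  have "dir_deriv b (\<lambda>x::'a. c) = (\<lambda>x. 0)" for b and c :: real
    by (rule ext, subst dir_deriv_eqI[OF has_derivative_const]) simp
  then show ?thesis unfolding smooth_def
    by (intro allI Ck_family[of "range (\<lambda>c x. c)" "\<lambda>x. c"]) auto
qed

lemma smooth_prod: "finite I \<Longrightarrow> (\<And>i. i \<in> I \<Longrightarrow> smooth (f i)) \<Longrightarrow> smooth (\<lambda>x. \<Prod>i\<in>I. f i x)"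
  by (induction I rule: finite_induct) (auto intro: smooth_const smooth_mult)

text \<open>\<open>D\<close> lists the successive derivatives of one real function. The free factor
  \<open>a\<close> in the family absorbs the powers of \<open>b \<bullet> v\<close> produced by the
  chain rule.\<close>

lemma smooth_compose_affine:
  fixes D :: "nat \<Rightarrow> real \<Rightarrow> real" and v :: "'a::euclidean_space"
  assumes D: "\<And>n t. (D n has_real_derivative D (Suc n) t) (at t)"
  shows "smooth (\<lambda>x. D n (x \<bullet> v - c))"
proof -
  have d: "((\<lambda>x. a * D n (x \<bullet> v - c)) has_derivative (\<lambda>h. a * (D (Suc n) (x \<bullet> v - c) * (h \<bullet> v)))) (at x)"
    for a n and x :: 'a
    by (intro has_derivative_mult_right has_derivative_compose[OF _ D[unfolded has_field_derivative_def],
        of "\<lambda>x. x \<bullet> v - c" "\<lambda>h. h \<bullet> v" x UNIV n, unfolded mult.assoc])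
       (auto intro!: derivative_eq_intros)
  have "Ck k (\<lambda>x. 1 * D n (x \<bullet> v - c))" for k
  proof (rule Ck_family[of "{\<lambda>x. a * D n (x \<bullet> v - c) |a n. True}"], safe)
    fix a n and x :: 'a
    show "(\<lambda>x. a * D n (x \<bullet> v - c)) differentiable (at x)"
      using d unfolding differentiable_def by blast
  next
    fix a n and b :: 'a
    have "dir_deriv b (\<lambda>x. a * D n (x \<bullet> v - c)) = (\<lambda>x. (a * (b \<bullet> v)) * D (Suc n) (x \<bullet> v - c))"
      by (rule ext) (simp add: dir_deriv_eqI[OF d])
    then show "\<exists>a' n'. dir_deriv b (\<lambda>x. a * D n (x \<bullet> v - c)) = (\<lambda>x. a' * D n' (x \<bullet> v - c)) \<and> True"
      by blast
  qed blast
  then show ?thesis by (simp add: smooth_def)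
qed

lemma smooth_inner: "smooth (\<lambda>x. x \<bullet> v)"
proof -
  define D :: "nat \<Rightarrow> real \<Rightarrow> real" where "D n t = (if n = 0 then t else if n = 1 then 1 else 0)" for n t
  have "(D n has_real_derivative D (Suc n) t) (at t)" for n t
    unfolding D_def by (cases "n = 0"; cases "n = 1") (auto intro!: derivative_eq_intros)
  from smooth_compose_affine[of D 0 v 0, OF this] show ?thesis by (simp add: D_def)
qed

text \<open>The classical \<open>exp (- 1 / t)\<close>, continued by zero, with a polynomial in
  \<open>1 / t\<close> in front: the class is then closed under differentiation, which the bare
  exponential is not.\<close>

definition flat_exp :: "real poly \<Rightarrow> real \<Rightarrow> real" where
  "flat_exp p t = (if t > 0 then poly p (1 / t) * exp (- (1 / t)) else 0)"

lemma poly_exp_decay: "((\<lambda>s::real. poly p s * exp (- s)) \<longlongrightarrow> 0) at_top"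
proof -
  have "((\<lambda>s::real. \<Sum>i\<le>degree p. coeff p i * (s ^ i / exp s)) \<longlongrightarrow> (\<Sum>i\<le>degree p. coeff p i * 0)) at_top"
    by (intro tendsto_sum tendsto_mult tendsto_const tendsto_power_div_exp_0)
  then show ?thesis
    by (simp add: poly_altdef sum_distrib_right exp_minus divide_inverse mult.assoc)
qed

text \<open>With \<open>s = 1 / t\<close> the chain rule gives
  \<open>s^2 * (p(s) - p'(s)) * exp (- s)\<close>, which explains the factor
  \<open>[:0, 0, 1:]\<close>. At zero the right difference quotient is
  \<open>s * p(s) * exp (- s)\<close>, and exponential decay sends it to zero.\<close>

lemma flat_exp_derivative:
  "(flat_exp p has_real_derivative flat_exp ([:0, 0, 1:] * (p - pderiv p)) t) (at t)"
proof (cases t "0::real" rule: linorder_cases)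
  case less
  have "((\<lambda>t. 0) has_real_derivative 0) (at t)" by simp
  then have "(flat_exp p has_real_derivative 0) (at t)"
    by (rule has_field_derivative_transform_within_open[of _ _ _ "{..<0}"])
       (use less in \<open>auto simp: flat_exp_def\<close>)
  then show ?thesis using less by (simp add: flat_exp_def)
next
  case greater
  have "((\<lambda>t. poly p (1 / t) * exp (- (1 / t))) has_real_derivative
      (poly (pderiv p) (1/t) * (- 1 / t^2)) * exp (- (1 / t)) + poly p (1/t) * (exp (- (1/t)) * (1/t^2))) (at t)"
    using greater by (auto intro!: derivative_eq_intros DERIV_chain2[OF poly_DERIV] simp: power2_eq_square divide_simps)
  then have "(flat_exp p has_real_derivative
      (poly (pderiv p) (1/t) * (- 1 / t^2)) * exp (- (1 / t)) + poly p (1/t) * (exp (- (1/t)) * (1/t^2))) (at t)"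
    by (rule has_field_derivative_transform_within_open[of _ _ _ "{0<..}"])
       (use greater in \<open>auto simp: flat_exp_def\<close>)
  then show ?thesis using greater
    by (simp add: flat_exp_def algebra_simps power2_eq_square)
next
  case equal
  have "((\<lambda>s. poly ([:0, 1:] * p) s * exp (- s)) \<longlongrightarrow> 0) at_top" by (rule poly_exp_decay)
  then have "((\<lambda>h. poly ([:0, 1:] * p) (inverse h) * exp (- inverse h)) \<longlongrightarrow> 0) (at_right 0)"
    by (rule filterlim_compose[OF _ filterlim_inverse_at_top_right])
  moreover have "\<forall>\<^sub>F h in at_right 0. poly ([:0, 1:] * p) (inverse h) * exp (- inverse h) = flat_exp p h / h"
    unfolding eventually_at_right_field
    by (intro exI[of _ 1]) (auto simp: flat_exp_def divide_inverse)
  ultimately have "((\<lambda>h. flat_exp p h / h) \<longlongrightarrow> 0) (at_right 0)"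
    by (rule Lim_transform_eventually)
  moreover have "((\<lambda>h. flat_exp p h / h) \<longlongrightarrow> 0) (at_left 0)"
    by (rule Lim_transform_eventually[OF tendsto_const], unfold eventually_at_left_field)
       (auto simp: flat_exp_def intro: exI[of _ "-1"])
  ultimately have "((\<lambda>h. flat_exp p h / h) \<longlongrightarrow> 0) (at 0)"
    by (simp add: filterlim_split_at)
  then show ?thesis using equal
    by (simp add: has_field_derivative_iff flat_exp_def)
qed

lemma smooth_flat_exp: "smooth (\<lambda>x. flat_exp 1 (x \<bullet> v - c))"
  using smooth_compose_affine[of "\<lambda>n. flat_exp (((\<lambda>p. [:0, 0, 1:] * (p - pderiv p)) ^^ n) 1)" 0 v c]
    flat_exp_derivative by simp

section \<open>Test functions\<close>

lemma test_functions_iff: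
  "\<phi> \<in> test_functions S \<longleftrightarrow> smooth \<phi> \<and> (\<exists>C. compact C \<and> C \<subseteq> S \<and> (\<forall>x. x \<notin> C \<longrightarrow> \<phi> x = 0))"
  by (auto simp: test_functions_def smooth_def)

lemma test_functionsE:
  assumes "\<phi> \<in> test_functions S"
  obtains C where "smooth \<phi>" "compact C" "C \<subseteq> S" "\<And>x. x \<notin> C \<Longrightarrow> \<phi> x = 0"
  using assms by (auto simp: test_functions_iff)

lemma test_functions_smooth_mult:
  "\<phi> \<in> test_functions S \<Longrightarrow> smooth g \<Longrightarrow> (\<lambda>x. g x * \<phi> x) \<in> test_functions S"
  unfolding test_functions_iff by (metis smooth_mult mult_zero_right)

lemma test_functions_mult:
  "\<phi> \<in> test_functions S \<Longrightarrow> \<psi> \<in> test_functions S \<Longrightarrow> (\<lambda>x. \<phi> x * \<psi> x) \<in> test_functions S"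
  by (rule test_functions_smooth_mult) (auto simp: test_functions_iff)

lemma lin_closed_test_functions: "lin_closed (test_functions S)"
  unfolding lin_closed_def
proof (intro conjI ballI allI)
  show "(\<lambda>x. 0) \<in> test_functions S"
    unfolding test_functions_iff by (auto intro!: smooth_const exI[of _ "{}"])
  fix \<phi> \<psi> :: "'a \<Rightarrow> real" and c :: real
  assume *: "\<phi> \<in> test_functions S" "\<psi> \<in> test_functions S"
  obtain C where C: "smooth \<phi>" "compact C" "C \<subseteq> S" "\<And>x. x \<notin> C \<Longrightarrow> \<phi> x = 0"
    using *(1) by (rule test_functionsE) blast
  obtain D where D: "smooth \<psi>" "compact D" "D \<subseteq> S" "\<And>x. x \<notin> D \<Longrightarrow> \<psi> x = 0"
    using *(2) by (rule test_functionsE) blast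
  have "smooth (\<lambda>x. \<phi> x + c * \<psi> x)"
    by (rule smooth_add[OF C(1) smooth_mult[OF smooth_const D(1)]])
  then show "(\<lambda>x. \<phi> x + c *\<^sub>R \<psi> x) \<in> test_functions S"
    unfolding test_functions_iff using compact_Un[OF C(2) D(2)] C(3,4) D(3,4)
    unfolding real_scaleR_def
    by (intro conjI exI[of _ "C \<union> D"]) simp_all
qed

lemma test_functions_dir_deriv:
  assumes "\<phi> \<in> test_functions S" "b \<in> Basis"
  shows "dir_deriv b \<phi> \<in> test_functions S"
proof -
  obtain C where C: "smooth \<phi>" "compact C" "C \<subseteq> S" "\<And>x. x \<notin> C \<Longrightarrow> \<phi> x = 0"
    using assms(1) by (rule test_functionsE) blast
  have "dir_deriv b \<phi> x = 0" if "x \<notin> C" for x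
  proof -
    have "(\<phi> has_derivative (\<lambda>h. 0)) (at x)"
      by (rule has_derivative_transform_within_open[of "\<lambda>x. 0" _ _ _ "- C"])
         (use C that in \<open>auto intro: open_Compl compact_imp_closed\<close>)
    then show ?thesis by (rule dir_deriv_eqI)
  qed
  then show ?thesis using C smooth_dir_deriv[OF C(1) assms(2)] unfolding test_functions_iff by blast
qed

lemma test_functions_iter_deriv:
  "\<phi> \<in> test_functions S \<Longrightarrow> set bs \<subseteq> Basis \<Longrightarrow> iter_deriv bs \<phi> \<in> test_functions S"
  by (induction bs) (auto simp: iter_deriv_def intro: test_functions_dir_deriv)

lemma test_functions_borel: "\<phi> \<in> test_functions S \<Longrightarrow> \<phi> \<in> borel_measurable borel"
  by (auto simp: test_functions_iff intro: borel_measurable_continuous_onI smooth_continuous)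

lemma test_functions_bounded:
  assumes "\<phi> \<in> test_functions S"
  obtains B where "\<And>x. \<bar>\<phi> x\<bar> \<le> B"
proof -
  obtain C where C: "smooth \<phi>" "compact C" "C \<subseteq> S" "\<And>x. x \<notin> C \<Longrightarrow> \<phi> x = 0"
    using assms by (rule test_functionsE) blast
  have "compact (\<phi> ` C)"
    by (rule compact_continuous_image[OF continuous_on_subset[OF smooth_continuous[OF C(1)]] C(2)]) simp
  then obtain B where B: "\<And>y. y \<in> \<phi> ` C \<Longrightarrow> norm y \<le> B"
    unfolding bounded_iff by (meson bounded_iff compact_imp_bounded)
  have "\<bar>\<phi> x\<bar> \<le> max B 0" for x
    using B[of "\<phi> x"] C(4)[of x] by (cases "x \<in> C") auto
  then show ?thesis by (rule that)
qed

lemma integral_lebesgue_on_eq: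
  fixes f :: "'a::euclidean_space \<Rightarrow> real"
  assumes "S \<in> sets lebesgue" "\<And>x. x \<notin> S \<Longrightarrow> f x = 0"
  shows "(LINT x|lebesgue_on S. f x) = (LINT x|lebesgue. f x)"
    and "integrable (lebesgue_on S) f \<longleftrightarrow> integrable lebesgue f"
proof -
  have "(\<lambda>x. indicator S x *\<^sub>R f x) = f"
    using assms(2) unfolding indicator_def by (intro ext) force
  then show "(LINT x|lebesgue_on S. f x) = (LINT x|lebesgue. f x)"
    and "integrable (lebesgue_on S) f \<longleftrightarrow> integrable lebesgue f"
    using assms(1) by (simp_all add: integral_restrict_space integrable_restrict_space set_integrable_def)
qed

text \<open>\<open>\<phi>\<close> is bounded and vanishes off a compact set on which
  \<open>f\<close> is integrable, so the product may be written with the indicator of that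
  set.\<close>

lemma integrable_test_mult:
  fixes f :: "'a::euclidean_space \<Rightarrow> real"
  assumes "\<phi> \<in> test_functions S" "locally_integrable S f" "S \<in> sets lebesgue"
  shows "integrable (lebesgue_on S) (\<lambda>x. \<phi> x * f x)"
proof -
  obtain C where C: "smooth \<phi>" "compact C" "C \<subseteq> S" "\<And>x. x \<notin> C \<Longrightarrow> \<phi> x = 0"
    using assms(1) by (rule test_functionsE) blast
  obtain B where B: "\<And>x. \<bar>\<phi> x\<bar> \<le> B" using test_functions_bounded[OF assms(1)] by blast
  have int: "integrable lebesgue (\<lambda>x. indicator C x *\<^sub>R f x)"
    using assms(2) C by (auto simp: locally_integrable_def set_integrable_def)
  have "integrable lebesgue (\<lambda>x. \<phi> x * (indicator C x *\<^sub>R f x))"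
  proof (rule Bochner_Integration.integrable_bound)
    show "integrable lebesgue (\<lambda>x. B * (indicator C x *\<^sub>R f x))"
      using int by (rule integrable_mult_right)
    show "(\<lambda>x. \<phi> x * (indicator C x *\<^sub>R f x)) \<in> borel_measurable lebesgue"
      by (rule borel_measurable_times[OF measurable_completion borel_measurable_integrable[OF int]])
         (use test_functions_borel[OF assms(1)] in simp)
    show "AE x in lebesgue. norm (\<phi> x * (indicator C x *\<^sub>R f x)) \<le> norm (B * (indicator C x *\<^sub>R f x))"
    proof (intro AE_I2)
      fix x
      have "\<bar>\<phi> x\<bar> \<le> \<bar>B\<bar>" using B[of x] by linarith
      then show "norm (\<phi> x * (indicator C x *\<^sub>R f x)) \<le> norm (B * (indicator C x *\<^sub>R f x))"
        by (simp add: abs_mult mult_right_mono)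
    qed
  qed
  moreover have "(\<lambda>x. \<phi> x * (indicator C x *\<^sub>R f x)) = (\<lambda>x. \<phi> x * f x)"
    using C(4) by (force simp: indicator_def)
  ultimately have "integrable lebesgue (\<lambda>x. \<phi> x * f x)" by simp
  then show ?thesis
    by (subst integral_lebesgue_on_eq(2)) (use assms(3) C in auto)
qed

lemma locally_integrable_continuous:
  fixes f :: "'a::euclidean_space \<Rightarrow> real"
  shows "continuous_on UNIV f \<Longrightarrow> locally_integrable S f"
  unfolding locally_integrable_def set_integrable_def
proof (intro allI impI)
  fix C assume "continuous_on UNIV f" "compact C \<and> C \<subseteq> S"
  then have "integrable lborel (\<lambda>x. indicator C x *\<^sub>R f x)"
    by (intro borel_integrable_compact) (auto elim: continuous_on_subset)
  then show "integrable lebesgue (\<lambda>x. indicator C x *\<^sub>R f x)"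
    by (subst integrable_completion[OF borel_measurable_integrable]) simp_all
qed

section \<open>Integration by parts against test functions\<close>

lemma smooth_line_derivative:
  assumes "smooth \<phi>"
  shows "((\<lambda>t. \<phi> (x + t *\<^sub>R b)) has_real_derivative dir_deriv b \<phi> (x + t *\<^sub>R b)) (at t)"
proof -
  have "(\<phi> has_derivative frechet_derivative \<phi> (at (x + t *\<^sub>R b))) (at (x + t *\<^sub>R b))" (is "(_ has_derivative ?D) _")
    using smooth_differentiable[OF assms] by (simp add: frechet_derivative_works)
  moreover have "((\<lambda>t. x + t *\<^sub>R b) has_derivative (\<lambda>h. h *\<^sub>R b)) (at t)"
    by (auto intro!: derivative_eq_intros)
  ultimately have "((\<lambda>t. \<phi> (x + t *\<^sub>R b)) has_derivative (\<lambda>h. ?D (h *\<^sub>R b))) (at t)"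
    by (rule has_derivative_compose[rotated])
  moreover have "?D (h *\<^sub>R b) = dir_deriv b \<phi> (x + t *\<^sub>R b) * h" for h
    using linear_cmul[OF linear_frechet_derivative[OF smooth_differentiable[OF assms]]]
    by (simp add: dir_deriv_def mult.commute)
  ultimately show ?thesis by (simp add: has_field_derivative_def)
qed

text \<open>Differentiate the translation invariant integral of \<open>\<phi>\<close> under the integral sign.\<close>

lemma integral_dir_deriv_eq_0:
  fixes \<phi> :: "'a::euclidean_space \<Rightarrow> real"
  assumes "\<phi> \<in> test_functions S" "b \<in> Basis" "S \<in> sets lebesgue"
  shows "(LINT x|lebesgue_on S. dir_deriv b \<phi> x) = 0"
proof -
  obtain C where C: "smooth \<phi>" "compact C" "C \<subseteq> S" "\<And>x. x \<notin> C \<Longrightarrow> \<phi> x = 0"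
    using assms(1) by (rule test_functionsE) blast
  have d: "dir_deriv b \<phi> \<in> test_functions S" by (rule test_functions_dir_deriv[OF assms(1,2)])
  then obtain B where B: "\<And>x. \<bar>dir_deriv b \<phi> x\<bar> \<le> B" by (rule test_functions_bounded) blast
  obtain R where R: "C \<subseteq> cball 0 R"
    using compact_imp_bounded[OF C(2)] unfolding bounded_iff by (auto simp: subset_iff)
  have mp: "\<phi> \<in> borel_measurable borel" by (rule test_functions_borel[OF assms(1)])
  have md: "dir_deriv b \<phi> \<in> borel_measurable borel" by (rule test_functions_borel[OF d])
  have intp: "integrable lborel \<phi>"
  proof -
    have "(\<lambda>x. indicator C x *\<^sub>R \<phi> x) = \<phi>" using C(4) by (force simp: indicator_def)
    then show ?thesis
      using borel_integrable_compact[OF C(2) continuous_on_subset[OF smooth_continuous[OF C(1)]]]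
      by simp
  qed
  have dist: "distr lborel borel (\<lambda>x. c + x) = (lborel :: 'a measure)" for c
    using lborel_distr_plus[of c] by simp
  have intt: "integrable lborel (\<lambda>x. \<phi> (c + x))" and eqt: "(\<integral>x. \<phi> (c + x) \<partial>lborel) = (\<integral>x. \<phi> x \<partial>lborel)" for c
  proof -
    have "integrable (distr lborel borel (\<lambda>x. c + x)) \<phi>" using intp by (simp add: dist)
    then show "integrable lborel (\<lambda>x. \<phi> (c + x))"
      by (subst (asm) integrable_distr_eq) (use mp in auto)
    have "(\<integral>x. \<phi> x \<partial>distr lborel borel (\<lambda>x. c + x)) = (\<integral>x. \<phi> (c + x) \<partial>lborel)"
      by (subst integral_distr) (use mp in auto)
    then show "(\<integral>x. \<phi> (c + x) \<partial>lborel) = (\<integral>x. \<phi> x \<partial>lborel)" by (simp add: dist)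
  qed
  \<comment> \<open>Steps of length at most 1 keep every difference quotient supported in the ball
    of radius \<open>R + 1\<close>, which yields one integrable majorant for all
    \<open>n\<close>.\<close>
  define h where "h n = inverse (real (Suc n))" for n
  have h: "0 < h n" "h n \<le> 1" for n by (simp_all add: h_def field_simps)
  define s where "s n x = (\<phi> (h n *\<^sub>R b + x) - \<phi> x) / h n" for n x
  have s0: "(\<integral>x. s n x \<partial>lborel) = 0" for n
    unfolding s_def using intt[of "h n *\<^sub>R b"] eqt[of "h n *\<^sub>R b"] intp by simp
  have sm: "s n \<in> borel_measurable lborel" for n
    unfolding s_def using mp by (intro borel_measurable_divide borel_measurable_diff) auto
  have lim: "(\<lambda>n. s n x) \<longlonglongrightarrow> dir_deriv b \<phi> x" for x
  proof -
    have "((\<lambda>k. (\<phi> (x + (0 + k) *\<^sub>R b) - \<phi> (x + 0 *\<^sub>R b)) / k) \<longlongrightarrow> dir_deriv b \<phi> (x + 0 *\<^sub>R b)) (at 0)"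
      using smooth_line_derivative[OF C(1), of x b 0] by (simp add: DERIV_def)
    moreover have "filterlim h (at 0) sequentially"
      unfolding filterlim_at h_def using LIMSEQ_inverse_real_of_nat by (auto simp: h_def)
    ultimately have "(\<lambda>n. (\<phi> (x + (0 + h n) *\<^sub>R b) - \<phi> (x + 0 *\<^sub>R b)) / h n) \<longlonglongrightarrow> dir_deriv b \<phi> (x + 0 *\<^sub>R b)"
      by (rule filterlim_compose)
    then show ?thesis by (simp add: s_def add.commute)
  qed
  \<comment> \<open>Inside the ball the mean value theorem turns the quotient into a value of the
    derivative; outside, both \<open>x\<close> and its shift miss the support.\<close>
  have bound: "norm (s n x) \<le> B * indicator (cball 0 (R + 1)) x" for n x
  proof (cases "x \<in> cball 0 (R + 1)")
    case True
    obtain z where "\<phi> (x + h n *\<^sub>R b) - \<phi> (x + 0 *\<^sub>R b) = (h n - 0) * dir_deriv b \<phi> (x + z *\<^sub>R b)"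
      using MVT2[of 0 "h n" "\<lambda>t. \<phi> (x + t *\<^sub>R b)" "\<lambda>t. dir_deriv b \<phi> (x + t *\<^sub>R b)"]
        smooth_line_derivative[OF C(1)] h(1)[of n] by blast
    then have "s n x = dir_deriv b \<phi> (x + z *\<^sub>R b)"
      using h(1)[of n] by (simp add: s_def add.commute)
    then show ?thesis using B True by simp
  next
    case False
    have "norm x \<le> norm (h n *\<^sub>R b + x) + norm (h n *\<^sub>R b)"
      using norm_triangle_ineq4[of "h n *\<^sub>R b + x" "h n *\<^sub>R b"] by simp
    then have "norm (h n *\<^sub>R b + x) > R" using False h[of n] assms(2) by simp
    then have "\<phi> (h n *\<^sub>R b + x) = 0" "\<phi> x = 0"
      using C(4) subsetD[OF R] False by force+
    then show ?thesis using False by (simp add: s_def)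
  qed
  have "(\<lambda>n. \<integral>x. s n x \<partial>lborel) \<longlonglongrightarrow> (\<integral>x. dir_deriv b \<phi> x \<partial>lborel)"
  proof (rule integral_dominated_convergence)
    show "integrable lborel (\<lambda>x. B * indicator (cball (0::'a) (R + 1)) x)"
      using borel_integrable_compact[of "cball (0::'a) (R + 1)" "\<lambda>x. B"] by (simp add: mult.commute)
  qed (use sm md lim bound in auto)
  then have "(\<integral>x. dir_deriv b \<phi> x \<partial>lborel) = 0"
    using s0 by (simp add: LIMSEQ_const_iff)
  moreover have "(LINT x|lebesgue_on S. dir_deriv b \<phi> x) = (LINT x|lebesgue. dir_deriv b \<phi> x)"
    by (rule integral_lebesgue_on_eq(1)[OF assms(3)]) (use d in \<open>auto elim!: test_functionsE\<close>)
  ultimately show ?thesis using md by (simp add: integral_completion)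
qed

text \<open>The product has compact support although \<open>\<phi>\<close> need not, so its
  derivative has zero integral and the product rule splits it. The unbounded choice
  \<open>\<phi> x = x \<bullet> b\<close> is what the Poincare inequality uses.\<close>

lemma integration_by_parts_test:
  fixes \<phi> \<psi> :: "'a::euclidean_space \<Rightarrow> real"
  assumes "smooth \<phi>" "\<psi> \<in> test_functions S" "b \<in> Basis" "S \<in> sets lebesgue"
  shows "(LINT x|lebesgue_on S. dir_deriv b \<psi> x * \<phi> x) = - (LINT x|lebesgue_on S. \<psi> x * dir_deriv b \<phi> x)"
proof -
  have sm: "smooth \<psi>" using assms(2) by (simp add: test_functions_iff)
  have "(LINT x|lebesgue_on S. dir_deriv b (\<lambda>x. \<phi> x * \<psi> x) x) = 0"
    using assms by (intro integral_dir_deriv_eq_0 test_functions_smooth_mult)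
  moreover have "dir_deriv b (\<lambda>x. \<phi> x * \<psi> x) = (\<lambda>x. \<psi> x * dir_deriv b \<phi> x + dir_deriv b \<psi> x * \<phi> x)"
    using assms(1) sm by (intro ext) (simp add: dir_deriv_mult smooth_differentiable algebra_simps)
  moreover have "integrable (lebesgue_on S) (\<lambda>x. \<psi> x * dir_deriv b \<phi> x)"
    using assms by (intro integrable_test_mult locally_integrable_continuous smooth_continuous smooth_dir_deriv)
  moreover have "integrable (lebesgue_on S) (\<lambda>x. dir_deriv b \<psi> x * \<phi> x)"
    using assms by (intro integrable_test_mult locally_integrable_continuous smooth_continuous test_functions_dir_deriv)
  ultimately show ?thesis by simp
qed

section \<open>The fundamental lemma of the calculus of variations\<close>

text \<open>The argument of each factor is the signed distance to a face of the box, stretched by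
  \<open>n + 1\<close>: inside the box \<open>exp (- 1 / ((n + 1) * t))\<close> increases to 1,
  while the support stays in the closed box.\<close>

definition box_bump :: "nat \<Rightarrow> 'a::euclidean_space \<Rightarrow> 'a \<Rightarrow> 'a \<Rightarrow> real" where
  "box_bump n a b x =
     (\<Prod>i\<in>Basis. flat_exp 1 (real (Suc n) * (x \<bullet> i - a \<bullet> i)) * flat_exp 1 (real (Suc n) * (b \<bullet> i - x \<bullet> i)))"

lemma flat_exp_1_bounds: "0 \<le> flat_exp 1 t" "flat_exp 1 t \<le> 1"
  by (auto simp: flat_exp_def)

lemma box_bump_bounds: "0 \<le> box_bump n a b x" "box_bump n a b x \<le> 1"
  unfolding box_bump_def
  by (auto intro!: prod_nonneg prod_le_1 mult_le_one simp: flat_exp_1_bounds)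

lemma box_bump_outside:
  assumes "x \<notin> box a b"
  shows "box_bump n a b x = 0"
proof -
  obtain i where i: "i \<in> Basis" "\<not> (a \<bullet> i < x \<bullet> i \<and> x \<bullet> i < b \<bullet> i)"
    using assms by (auto simp: mem_box)
  then have "\<not> 0 < real (Suc n) * (x \<bullet> i - a \<bullet> i) \<or> \<not> 0 < real (Suc n) * (b \<bullet> i - x \<bullet> i)"
    by (simp add: zero_less_mult_iff)
  then have "flat_exp 1 (real (Suc n) * (x \<bullet> i - a \<bullet> i)) * flat_exp 1 (real (Suc n) * (b \<bullet> i - x \<bullet> i)) = 0"
    by (auto simp: flat_exp_def)
  then show ?thesis
    unfolding box_bump_def using i(1) by (intro prod_zero) auto
qed

lemma box_bump_test_function:
  assumes "cbox a b \<subseteq> S"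
  shows "box_bump n a b \<in> test_functions S"
proof -
  have "smooth (\<lambda>x. \<Prod>i\<in>Basis. flat_exp 1 (x \<bullet> (real (Suc n) *\<^sub>R i) - real (Suc n) * (a \<bullet> i)) *
      flat_exp 1 (x \<bullet> ((- real (Suc n)) *\<^sub>R i) - (- real (Suc n) * (b \<bullet> i))))"
    by (intro smooth_prod smooth_mult smooth_flat_exp finite_Basis)
  moreover have "box_bump n a b = (\<lambda>x. \<Prod>i\<in>Basis. flat_exp 1 (x \<bullet> (real (Suc n) *\<^sub>R i) - real (Suc n) * (a \<bullet> i)) *
      flat_exp 1 (x \<bullet> ((- real (Suc n)) *\<^sub>R i) - (- real (Suc n) * (b \<bullet> i))))"
    by (rule ext) (simp add: box_bump_def algebra_simps)
  ultimately have "smooth (box_bump n a b)" by (simp only:)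
  then show ?thesis
    unfolding test_functions_iff
    using assms box_bump_outside[of _ a b n] subsetD[OF box_subset_cbox[of a b]]
    by (intro conjI exI[of _ "cbox a b"]) (simp, rule compact_cbox, simp, meson)
qed

lemma box_bump_tendsto: "(\<lambda>n. box_bump n a b x) \<longlonglongrightarrow> indicator (box a b) x"
proof (cases "x \<in> box a b")
  case True
  have lim: "(\<lambda>n. flat_exp 1 (real (Suc n) * t)) \<longlonglongrightarrow> 1" if "t > 0" for t
  proof -
    have "(\<lambda>n. exp (- (inverse (real (Suc n)) * inverse t))) \<longlonglongrightarrow> exp (- (0 * inverse t))"
      by (intro tendsto_exp tendsto_minus tendsto_mult_right LIMSEQ_inverse_real_of_nat)
    moreover have "flat_exp 1 (real (Suc n) * t) = exp (- (inverse (real (Suc n)) * inverse t))" for n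
      using that by (simp add: flat_exp_def divide_inverse mult.commute)
    ultimately show ?thesis by simp
  qed
  have "(\<lambda>n. box_bump n a b x) \<longlonglongrightarrow> (\<Prod>i\<in>(Basis::'a set). 1 * 1)"
    unfolding box_bump_def using True
    by (intro tendsto_prod tendsto_mult lim) (auto simp: mem_box)
  then show ?thesis using True by simp
next
  case False
  then show ?thesis by (simp add: box_bump_outside)
qed

lemma sets_lebesgueE:
  fixes A :: "'a::euclidean_space set"
  assumes "A \<in> sets lebesgue"
  obtains A' where "A' \<in> sets borel" "AE x in lebesgue. x \<in> A \<longleftrightarrow> x \<in> A'"
proof -
  obtain A' N N' where *: "A = A' \<union> N" "N \<subseteq> N'" "N' \<in> null_sets lborel" "A' \<in> sets lborel"
    using sets_completionE[OF assms] by metis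
  have "AE x in lebesgue. x \<notin> N'"
    using *(3) by (intro AE_completion AE_not_in)
  then have "AE x in lebesgue. x \<in> A \<longleftrightarrow> x \<in> A'"
    by eventually_elim (use * in auto)
  then show ?thesis using that *(4) by auto
qed

text \<open>Boxes are stable under intersection and generate the Borel sets, so Dynkin's theorem
  extends the vanishing of the integrals to all Borel sets; \<open>total\<close> pays for the
  complements. Lebesgue sets differ from Borel sets by null sets, and the claim is then uniqueness
  of densities.\<close>

lemma AE_zero_if_box_integrals_zero:
  fixes f :: "'a::euclidean_space \<Rightarrow> real"
  assumes f: "integrable lebesgue f"
    and box0: "\<And>c d. (LINT x|lebesgue. indicator (box c d) x * f x) = 0"
    and total: "(LINT x|lebesgue. f x) = 0"
  shows "AE x in lebesgue. f x = 0"
proof (rule density_unique_real[OF f integrable_zero])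
  have si: "set_integrable lebesgue A f" if "A \<in> sets borel" for A
    unfolding set_integrable_def using f that by (intro integrable_mult_indicator) auto
  have borel0: "set_lebesgue_integral lebesgue A f = 0" if "A \<in> sets borel" for A
  proof -
    have "Int_stable (range (\<lambda>(a, b). box a b :: 'a set))"
      by (auto simp: Int_stable_def box_Int_box)
    moreover have "range (\<lambda>(a, b). box a b :: 'a set) \<subseteq> Pow UNIV" by simp
    moreover have "A \<in> sigma_sets UNIV (range (\<lambda>(a, b). box a b :: 'a set))"
      using that by (simp add: borel_eq_box)
    ultimately show ?thesis
    proof (induction rule: sigma_sets_induct_disjoint)
      case (basic A)
      then show ?case using box0 by (auto simp: set_lebesgue_integral_def)
    next
      case (compl A)
      then have A: "A \<in> sets borel" by (simp add: borel_eq_box)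
      have "set_lebesgue_integral lebesgue (UNIV - A) f = (LINT x|lebesgue. f x - indicator A x *\<^sub>R f x)"
        unfolding set_lebesgue_integral_def
        by (intro Bochner_Integration.integral_cong) (auto simp: indicator_def)
      also have "\<dots> = 0"
        using f si[OF A] compl(2) total
        by (simp add: set_integrable_def set_lebesgue_integral_def)
      finally show ?case .
    next
      case (union A)
      then have A: "A i \<in> sets borel" for i by (auto simp: borel_eq_box)
      have "(\<Union>i. A i) \<in> sets borel" using A by blast
      then have "set_lebesgue_integral lebesgue (\<Union>i. A i) f = (\<Sum>i. set_lebesgue_integral lebesgue (A i) f)"
        using A union(1) by (intro lebesgue_integral_countable_add si) (auto simp: disjoint_family_on_def)
      then show ?case using union by simp
    qed (auto simp: set_lebesgue_integral_def)
  qed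
  fix A :: "'a set" assume "A \<in> sets lebesgue"
  then obtain A' where A': "A' \<in> sets borel" "AE x in lebesgue. x \<in> A \<longleftrightarrow> x \<in> A'"
    by (rule sets_lebesgueE)
  have "set_lebesgue_integral lebesgue A f = set_lebesgue_integral lebesgue A' f"
    unfolding set_lebesgue_integral_def
  proof (rule integral_cong_AE)
    show "(\<lambda>x. indicat_real A x *\<^sub>R f x) \<in> borel_measurable lebesgue"
      "(\<lambda>x. indicat_real A' x *\<^sub>R f x) \<in> borel_measurable lebesgue"
      using f \<open>A \<in> sets lebesgue\<close> sets_completionI_sets[of A' lborel] A'(1)
      by (auto intro!: borel_measurable_times borel_measurable_indicator)
    show "AE x in lebesgue. indicat_real A x *\<^sub>R f x = indicat_real A' x *\<^sub>R f x"
      using A'(2) by eventually_elim (auto simp: indicator_def)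
  qed
  then show "set_lebesgue_integral lebesgue A f = (LINT x:A|lebesgue. 0)"
    using borel0[OF A'(1)] by (simp add: set_lebesgue_integral_def)
qed

text \<open>Bumps converge boundedly to indicators of boxes, so the integral of \<open>g\<close>
  over every box with closure in \<open>S\<close> vanishes, and \<open>g\<close> is zero almost
  everywhere on each such box. Countably many closed boxes exhaust \<open>S\<close>, which makes the
  local statement global.\<close>

lemma fundamental_lemma_calculus_of_variations:
  fixes g :: "'a::euclidean_space \<Rightarrow> real"
  assumes S: "open S" and g: "locally_integrable S g"
    and test: "\<And>\<phi>. \<phi> \<in> test_functions S \<Longrightarrow> (LINT x|lebesgue_on S. \<phi> x * g x) = 0"
  shows "AE x in lebesgue_on S. g x = 0"
proof -
  have Sm: "S \<in> sets lebesgue" using S by auto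
  have box_AE: "AE x in lebesgue. x \<in> box a b \<longrightarrow> g x = 0" if ab: "cbox a b \<subseteq> S" for a b
  proof -
    have int: "integrable lebesgue (\<lambda>x. indicator (cbox a b) x *\<^sub>R g x)"
      using g ab by (auto simp: locally_integrable_def set_integrable_def)
    \<comment> \<open>Restricting to boxes inside \<open>cbox a b\<close> makes \<open>g\<close> on
      that compact box an integrable majorant; on \<open>S\<close> itself \<open>g\<close> is only
      locally integrable.\<close>
    have box0: "(LINT x|lebesgue. indicator (box c d) x * g x) = 0" if cd: "cbox c d \<subseteq> cbox a b" for c d
    proof -
      have "(\<lambda>n. LINT x|lebesgue. box_bump n c d x * (indicator (cbox a b) x *\<^sub>R g x))
          \<longlonglongrightarrow> (LINT x|lebesgue. indicator (box c d) x * (indicator (cbox a b) x *\<^sub>R g x))"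
      proof (rule integral_dominated_convergence)
        show "integrable lebesgue (\<lambda>x. norm (indicator (cbox a b) x *\<^sub>R g x))"
          using int by (rule integrable_norm)
        show "(\<lambda>x. indicator (box c d) x * (indicator (cbox a b) x *\<^sub>R g x)) \<in> borel_measurable lebesgue"
          by (intro borel_measurable_times borel_measurable_indicator borel_measurable_integrable[OF int]) auto
        show "(\<lambda>x. box_bump n c d x * (indicator (cbox a b) x *\<^sub>R g x)) \<in> borel_measurable lebesgue" for n
          by (rule borel_measurable_times[OF measurable_completion borel_measurable_integrable[OF int]])
             (use test_functions_borel[OF box_bump_test_function[OF order_refl]] in simp)
        show "AE x in lebesgue. (\<lambda>n. box_bump n c d x * (indicator (cbox a b) x *\<^sub>R g x))
            \<longlonglongrightarrow> indicator (box c d) x * (indicator (cbox a b) x *\<^sub>R g x)"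
          by (intro AE_I2 tendsto_mult_right box_bump_tendsto)
        show "AE x in lebesgue. norm (box_bump n c d x * (indicator (cbox a b) x *\<^sub>R g x))
            \<le> norm (indicator (cbox a b) x *\<^sub>R g x)" for n
          using box_bump_bounds[of n c d]
          by (intro AE_I2) (simp add: abs_mult mult_left_le_one_le)
      qed
      moreover have "(LINT x|lebesgue. box_bump n c d x * (indicator (cbox a b) x *\<^sub>R g x)) = 0" for n
      proof -
        have t: "box_bump n c d \<in> test_functions S"
          using ab cd by (intro box_bump_test_function) auto
        have "(\<lambda>x. box_bump n c d x * (indicator (cbox a b) x *\<^sub>R g x)) = (\<lambda>x. box_bump n c d x * g x)"
          using cd box_subset_cbox[of c d] box_bump_outside[of _ c d n]
          by (intro ext) (auto simp: indicator_def subset_iff)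
        moreover have "(LINT x|lebesgue. box_bump n c d x * g x) = (LINT x|lebesgue_on S. box_bump n c d x * g x)"
          by (rule integral_lebesgue_on_eq(1)[symmetric, OF Sm])
             (use t in \<open>auto elim!: test_functionsE\<close>)
        ultimately show ?thesis using test[OF t] by simp
      qed
      moreover have "(\<lambda>x. indicator (box c d) x * (indicator (cbox a b) x *\<^sub>R g x)) = (\<lambda>x. indicator (box c d) x * g x)"
        using cd box_subset_cbox[of c d] by (intro ext) (auto simp: indicator_def subset_iff)
      ultimately show ?thesis by (simp add: LIMSEQ_const_iff)
    qed
    have eq: "(\<lambda>x. indicator (box c d) x * (indicator (box a b) x * g x)) = (\<lambda>x. indicator (box c d \<inter> box a b) x * g x)"
      for c d by (auto simp: indicator_def)
    have "AE x in lebesgue. indicator (box a b) x * g x = 0"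
    proof (rule AE_zero_if_box_integrals_zero)
      have "integrable lebesgue (\<lambda>x. indicator (box a b) x *\<^sub>R (indicator (cbox a b) x *\<^sub>R g x))"
        by (intro integrable_mult_indicator int) auto
      moreover have "(\<lambda>x. indicator (box a b) x *\<^sub>R (indicator (cbox a b) x *\<^sub>R g x)) = (\<lambda>x. indicator (box a b) x * g x)"
        using box_subset_cbox[of a b] by (intro ext) (auto simp: indicator_def subset_iff)
      ultimately show "integrable lebesgue (\<lambda>x. indicator (box a b) x * g x)" by simp
      show "(LINT x|lebesgue. indicator (box a b) x * g x) = 0" by (rule box0) simp
      fix c d
      obtain c' d' where cd': "box c d \<inter> box a b = box c' d'" using box_Int_box by blast
      show "(LINT x|lebesgue. indicator (box c d) x * (indicator (box a b) x * g x)) = 0"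
      \<comment> \<open>An empty open box says nothing about the position of
        \<open>cbox c' d'\<close>; a nonempty one has it as its closure, hence inside
        \<open>cbox a b\<close>.\<close>
      proof (cases "box c' d' = {}")
        case True
        then show ?thesis by (simp add: eq cd')
      next
        case False
        then have "cbox c' d' = closure (box c' d')" by (simp add: closure_box)
        also have "\<dots> \<subseteq> cbox a b"
          using cd' box_subset_cbox[of a b] by (intro closure_minimal) auto
        finally show ?thesis using box0 by (simp add: eq cd')
      qed
    qed
    then show ?thesis by eventually_elim (auto simp: indicator_def)
  qed
  obtain \<D> where \<D>: "countable \<D>" "\<D> \<subseteq> Pow S" "\<And>X. X \<in> \<D> \<Longrightarrow> \<exists>a b. X = cbox a b" "\<Union>\<D> = S"
    using open_countable_Union_open_cbox[OF S] by metis
  have "AE x in lebesgue. x \<in> X \<longrightarrow> g x = 0" if X: "X \<in> \<D>" for X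
  proof -
    obtain a b where ab: "X = cbox a b" using \<D>(3)[OF X] by blast
    \<comment> \<open>The cover consists of closed boxes while the local result speaks of open ones;
      the faces in between are null.\<close>
    have "negligible (cbox a b - box a b)" by (rule negligible_frontier_interval)
    then have "AE x in lebesgue. x \<notin> cbox a b - box a b"
      by (intro AE_not_in) (simp only: negligible_iff_null_sets[symmetric])
    moreover have "AE x in lebesgue. x \<in> box a b \<longrightarrow> g x = 0"
      using box_AE \<D>(2) X ab by auto
    ultimately show ?thesis unfolding ab by eventually_elim auto
  qed
  then have "AE x in lebesgue. \<forall>X\<in>\<D>. x \<in> X \<longrightarrow> g x = 0"
    by (subst AE_ball_countable[OF \<D>(1)]) blast
  then have "AE x in lebesgue. x \<in> S \<longrightarrow> g x = 0"
    by eventually_elim (use \<D>(4) in auto)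
  then show ?thesis using Sm by (simp add: AE_restrict_space_iff)
qed

section \<open>Square integrable functions\<close>

text \<open>Completeness of Lebesgue measure, after extension by zero outside \<open>S\<close>. It
  is what makes membership in \<open>L2\<close> independent of the representative.\<close>

lemma borel_measurable_lebesgue_on_AE:
  fixes f g :: "'a::euclidean_space \<Rightarrow> 'b::euclidean_space"
  assumes S: "S \<in> sets lebesgue" and f: "f \<in> borel_measurable (lebesgue_on S)"
    and ae: "AE x in lebesgue_on S. f x = g x"
  shows "g \<in> borel_measurable (lebesgue_on S)"
proof -
  have "(\<lambda>x. if x \<in> S then f x else 0) \<in> borel_measurable lebesgue"
    using f S by (simp add: borel_measurable_if)
  moreover have "AE x in lebesgue. (if x \<in> S then f x else 0) = (if x \<in> S then g x else 0)"
    using ae S by (simp add: AE_restrict_space_iff)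
  ultimately have "(\<lambda>x. if x \<in> S then g x else 0) \<in> borel_measurable lebesgue"
    by (rule borel_measurable_AE)
  then show ?thesis using S by (simp add: borel_measurable_if)
qed

lemma L2_iff:
  "f \<in> fst (L2 S) \<longleftrightarrow> f \<in> borel_measurable (lebesgue_on S) \<and> integrable (lebesgue_on S) (\<lambda>x. (norm (f x))\<^sup>2)"
  by (simp add: Lp_def)

lemma L2_measurable: "f \<in> fst (L2 S) \<Longrightarrow> f \<in> borel_measurable (lebesgue_on S)"
  by (simp add: L2_iff)

lemma L2_square_integrable: "f \<in> fst (L2 S) \<Longrightarrow> integrable (lebesgue_on S) (\<lambda>x. (norm (f x))\<^sup>2)"
  by (simp add: L2_iff)

lemma L2_dominated:
  assumes g: "g \<in> fst (L2 S)" and f: "f \<in> borel_measurable (lebesgue_on S)"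
    and le: "AE x in lebesgue_on S. norm (f x) \<le> C * norm (g x)"
  shows "f \<in> fst (L2 S)"
  unfolding L2_iff
proof
  show "integrable (lebesgue_on S) (\<lambda>x. (norm (f x))\<^sup>2)"
  proof (rule Bochner_Integration.integrable_bound)
    show "integrable (lebesgue_on S) (\<lambda>x. C\<^sup>2 * (norm (g x))\<^sup>2)"
      using L2_square_integrable[OF g] by simp
    show "(\<lambda>x. (norm (f x))\<^sup>2) \<in> borel_measurable (lebesgue_on S)"
      using f by measurable
    show "AE x in lebesgue_on S. norm ((norm (f x))\<^sup>2) \<le> norm (C\<^sup>2 * (norm (g x))\<^sup>2)"
      using le by eventually_elim (metis abs_of_nonneg norm_ge_zero power_mono power_mult_distrib real_norm_def zero_le_power2)
  qed
qed (rule f)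

lemma L2_AE:
  fixes f g :: "'a::euclidean_space \<Rightarrow> 'b::euclidean_space"
  assumes "S \<in> sets lebesgue" "f \<in> fst (L2 S)" "AE x in lebesgue_on S. f x = g x"
  shows "g \<in> fst (L2 S)"
  by (rule L2_dominated[OF assms(2) borel_measurable_lebesgue_on_AE[OF assms(1) L2_measurable[OF assms(2)] assms(3)], of 1])
     (use assms(3) in \<open>eventually_elim, simp\<close>)

lemma L2_prod_integrable:
  fixes f g :: "'a::euclidean_space \<Rightarrow> 'b::euclidean_space"
  assumes "f \<in> fst (L2 S)" "g \<in> fst (L2 S)"
  shows "integrable (lebesgue_on S) (\<lambda>x. f x \<bullet> g x)"
proof (rule Bochner_Integration.integrable_bound)
  show "integrable (lebesgue_on S) (\<lambda>x. (norm (f x))\<^sup>2 + (norm (g x))\<^sup>2)"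
    using assms by (auto intro: L2_square_integrable)
  show "(\<lambda>x. f x \<bullet> g x) \<in> borel_measurable (lebesgue_on S)"
    using assms by (intro borel_measurable_inner L2_measurable)
  have "\<bar>f x \<bullet> g x\<bar> \<le> (norm (f x))\<^sup>2 + (norm (g x))\<^sup>2" for x
  proof -
    have "\<bar>f x \<bullet> g x\<bar> \<le> norm (f x) * norm (g x)" by (rule Cauchy_Schwarz_ineq2)
    moreover have "0 \<le> (norm (f x) - norm (g x))\<^sup>2" by simp
    moreover have "0 \<le> norm (f x) * norm (g x)" by simp
    ultimately show ?thesis by (simp add: power2_diff)
  qed
  then show "AE x in lebesgue_on S. norm (f x \<bullet> g x) \<le> norm ((norm (f x))\<^sup>2 + (norm (g x))\<^sup>2)"
    by (intro AE_I2) simp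
qed

text \<open>Takes the place of the triangle inequality once norms are squared.\<close>

lemma norm_add_scaleR_square_le:
  fixes a b :: "'b::real_normed_vector"
  shows "(norm (a + c *\<^sub>R b))\<^sup>2 \<le> 2 * (norm a)\<^sup>2 + 2 * c\<^sup>2 * (norm b)\<^sup>2"
proof -
  have "(norm (a + c *\<^sub>R b))\<^sup>2 \<le> (norm a + \<bar>c\<bar> * norm b)\<^sup>2"
    using norm_triangle_ineq[of a "c *\<^sub>R b"] by (intro power_mono) auto
  moreover have "0 \<le> (norm a - \<bar>c\<bar> * norm b)\<^sup>2" by simp
  ultimately show ?thesis by (simp add: power2_diff power2_sum power_mult_distrib)
qed

lemma lin_closed_L2: "lin_closed (fst (L2 S :: ('a::euclidean_space \<Rightarrow> 'b::euclidean_space) nspace))"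
  unfolding lin_closed_def
proof (intro conjI ballI allI)
  show "(\<lambda>x. 0) \<in> fst (L2 S :: ('a \<Rightarrow> 'b) nspace)" by (simp add: L2_iff)
  fix f g :: "'a \<Rightarrow> 'b" and c
  assume fg: "f \<in> fst (L2 S)" "g \<in> fst (L2 S)"
  have m: "(\<lambda>x. f x + c *\<^sub>R g x) \<in> borel_measurable (lebesgue_on S)"
    using fg by (intro borel_measurable_add borel_measurable_scaleR borel_measurable_const L2_measurable)
  have "integrable (lebesgue_on S) (\<lambda>x. (norm (f x + c *\<^sub>R g x))\<^sup>2)"
  proof (rule Bochner_Integration.integrable_bound)
    show "integrable (lebesgue_on S) (\<lambda>x. 2 * (norm (f x))\<^sup>2 + 2 * c\<^sup>2 * (norm (g x))\<^sup>2)"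
      using fg by (intro Bochner_Integration.integrable_add integrable_mult_right L2_square_integrable)
    show "(\<lambda>x. (norm (f x + c *\<^sub>R g x))\<^sup>2) \<in> borel_measurable (lebesgue_on S)"
      using m by measurable
    show "AE x in lebesgue_on S. norm ((norm (f x + c *\<^sub>R g x))\<^sup>2) \<le> norm (2 * (norm (f x))\<^sup>2 + 2 * c\<^sup>2 * (norm (g x))\<^sup>2)"
      using norm_add_scaleR_square_le[of "f _" c "g _"] by (intro AE_I2) (simp add: order_trans[OF _ abs_ge_self])
  qed
  then show "(\<lambda>x. f x + c *\<^sub>R g x) \<in> fst (L2 S)" using m by (simp add: L2_iff)
qed

lemma L2_bounded:
  fixes f :: "'a::euclidean_space \<Rightarrow> 'b::euclidean_space"
  assumes "S \<in> lmeasurable" "f \<in> borel_measurable (lebesgue_on S)" "AE x in lebesgue_on S. norm (f x) \<le> C"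
  shows "f \<in> fst (L2 S)"
proof -
  interpret finite_measure "lebesgue_on S" by (rule finite_measure_lebesgue_on) fact
  have "(\<lambda>x. 1::real) \<in> fst (L2 S)" by (simp add: L2_iff)
  then show ?thesis
    by (rule L2_dominated[OF _ assms(2), where C = C]) (use assms(3) in simp)
qed

text \<open>The square of the \<open>L2\<close> norm. The energy and limit arguments are all
  quadratic, and squaring removes the real powers from \<open>Lp_norm\<close> and
  \<open>Wkp\<close>.\<close>

definition sq_int :: "'a::euclidean_space set \<Rightarrow> ('a \<Rightarrow> 'b::euclidean_space) \<Rightarrow> real" where
  "sq_int S f = (LINT x|lebesgue_on S. (norm (f x))\<^sup>2)"

lemma sq_int_nonneg: "0 \<le> sq_int S f"
  by (simp add: sq_int_def)

lemma Lp_norm_2: "Lp_norm S 2 f powr 2 = sq_int S f"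
  using sq_int_nonneg[of S f] by (simp add: Lp_norm_def sq_int_def powr_powr)

lemma sq_int_eq_0:
  assumes "f \<in> fst (L2 S)" "sq_int S f \<le> 0"
  shows "AE x in lebesgue_on S. f x = 0"
proof -
  have "sq_int S f = 0" using sq_int_nonneg[of S f] assms(2) by simp
  then have "AE x in lebesgue_on S. (norm (f x))\<^sup>2 = 0"
    using integral_nonneg_eq_0_iff_AE[OF L2_square_integrable[OF assms(1)]] by (simp add: sq_int_def)
  then show ?thesis by simp
qed

lemma sq_int_cong_AE:
  assumes "f \<in> fst (L2 S)" "g \<in> fst (L2 S)" "AE x in lebesgue_on S. f x = g x"
  shows "sq_int S f = sq_int S g"
  unfolding sq_int_def
  by (rule integral_cong_AE) (use assms in \<open>auto dest: L2_square_integrable\<close>)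

lemma sq_int_add_le:
  assumes "f \<in> fst (L2 S)" "g \<in> fst (L2 S)"
  shows "sq_int S (\<lambda>x. f x + c *\<^sub>R g x) \<le> 2 * sq_int S f + 2 * c\<^sup>2 * sq_int S g"
proof -
  have "sq_int S (\<lambda>x. f x + c *\<^sub>R g x) \<le> (LINT x|lebesgue_on S. 2 * (norm (f x))\<^sup>2 + 2 * c\<^sup>2 * (norm (g x))\<^sup>2)"
    unfolding sq_int_def
    by (intro integral_mono norm_add_scaleR_square_le Bochner_Integration.integrable_add
        integrable_mult_right L2_square_integrable lin_closedD(2)[OF lin_closed_L2] assms)
  also have "\<dots> = 2 * sq_int S f + 2 * c\<^sup>2 * sq_int S g"
    using assms by (simp add: L2_square_integrable sq_int_def)
  finally show ?thesis .
qed

section \<open>Weak derivatives\<close>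

lemma locally_integrable_AE:
  fixes f g :: "'a::euclidean_space \<Rightarrow> 'b::euclidean_space"
  assumes "S \<in> sets lebesgue" "locally_integrable S f" "AE x in lebesgue_on S. f x = g x"
  shows "locally_integrable S g"
proof -
  have "AE x in lebesgue. x \<in> S \<longrightarrow> f x = g x"
    using assms(1,3) by (simp add: AE_restrict_space_iff)
  then obtain N where N: "N \<in> null_sets lebesgue" "{x. \<not> (x \<in> S \<longrightarrow> f x = g x)} \<subseteq> N"
    by (auto simp: eventually_ae_filter)
  then have "negligible N" by (simp add: negligible_iff_null_sets)
  show ?thesis
    unfolding locally_integrable_def
  proof (intro allI impI, elim conjE)
    fix C assume C: "compact C" "C \<subseteq> S"
    show "g absolutely_integrable_on C"
    proof (rule absolutely_integrable_spike)
      show "f absolutely_integrable_on C" using assms(2) C by (auto simp: locally_integrable_def)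
      show "g x = f x" if "x \<in> C - N" for x using that N(2) C(2) by auto
    qed fact
  qed
qed

text \<open>On a compact set the constant 1 is integrable, so
  \<open>norm (f x) \<le> (norm (f x))\<^sup>2 + 1\<close> provides an integrable majorant.\<close>

lemma L2_locally_integrable:
  fixes f :: "'a::euclidean_space \<Rightarrow> 'b::euclidean_space"
  assumes "S \<in> sets lebesgue" "f \<in> fst (L2 S)"
  shows "locally_integrable S f"
  unfolding locally_integrable_def
proof (intro allI impI, elim conjE)
  fix C assume C: "compact C" "C \<subseteq> S"
  have Cm: "C \<in> lmeasurable" using C(1) by (rule lmeasurable_compact)
  have "integrable lebesgue (\<lambda>x. indicator S x *\<^sub>R (norm (f x))\<^sup>2)"
    using L2_square_integrable[OF assms(2)] assms(1) by (simp add: integrable_restrict_space set_integrable_def)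
  moreover have "integrable lebesgue (indicator C :: 'a \<Rightarrow> real)"
    using Cm by (intro integrable_real_indicator) (auto simp: fmeasurable_def)
  ultimately have *: "integrable lebesgue (\<lambda>x. indicator S x *\<^sub>R (norm (f x))\<^sup>2 + indicator C x)"
    by (rule Bochner_Integration.integrable_add)
  show "f absolutely_integrable_on C"
    unfolding set_integrable_def
  proof (rule Bochner_Integration.integrable_bound[OF *])
    have "(\<lambda>x. if x \<in> S then f x else 0) \<in> borel_measurable lebesgue"
      using L2_measurable[OF assms(2)] assms(1) by (simp add: borel_measurable_if)
    then have "(\<lambda>x. indicator C x *\<^sub>R (if x \<in> S then f x else 0)) \<in> borel_measurable lebesgue"
      using Cm by (intro borel_measurable_scaleR borel_measurable_indicator) auto
    moreover have "(\<lambda>x. indicator C x *\<^sub>R (if x \<in> S then f x else 0)) = (\<lambda>x. indicator C x *\<^sub>R f x)"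
      using C(2) by (intro ext) (auto simp: indicator_def)
    ultimately show "(\<lambda>x. indicat_real C x *\<^sub>R f x) \<in> borel_measurable lebesgue" by simp
    have "norm (f x) \<le> (norm (f x))\<^sup>2 + 1" for x
      using zero_le_power2[of "norm (f x) - 1/2"] by (simp add: power2_diff) (simp add: power2_eq_square)
    then show "AE x in lebesgue. norm (indicat_real C x *\<^sub>R f x) \<le> norm (indicat_real S x *\<^sub>R (norm (f x))\<^sup>2 + indicat_real C x)"
      using C(2) by (intro AE_I2) (auto simp: indicator_def subset_iff)
  qed
qed

lemma locally_integrable_lin:
  fixes f g :: "'a::euclidean_space \<Rightarrow> 'b::euclidean_space"
  assumes "locally_integrable S f" "locally_integrable S g"
  shows "locally_integrable S (\<lambda>x. f x + c *\<^sub>R g x)"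
  using assms unfolding locally_integrable_def
  by (auto intro!: set_integral_add absolutely_integrable_scaleR_left)

lemma integral_test_cong:
  fixes f g :: "'a::euclidean_space \<Rightarrow> real"
  assumes S: "S \<in> sets lebesgue" and \<phi>: "\<phi> \<in> test_functions S"
    and f: "locally_integrable S f" and ae: "AE x in lebesgue_on S. f x = g x"
  shows "(LINT x|lebesgue_on S. \<phi> x * f x) = (LINT x|lebesgue_on S. \<phi> x * g x)"
proof (rule integral_cong_AE)
  show "(\<lambda>x. \<phi> x * f x) \<in> borel_measurable (lebesgue_on S)"
    "(\<lambda>x. \<phi> x * g x) \<in> borel_measurable (lebesgue_on S)"
    using integrable_test_mult[OF \<phi> f S] integrable_test_mult[OF \<phi> locally_integrable_AE[OF S f ae] S]
    by (auto dest: borel_measurable_integrable)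
  show "AE x in lebesgue_on S. \<phi> x * f x = \<phi> x * g x" using ae by eventually_elim simp
qed

lemma has_weak_deriv_cong:
  fixes f :: "'a::euclidean_space \<Rightarrow> real"
  assumes S: "S \<in> sets lebesgue" and bs: "set bs \<subseteq> Basis" and w: "has_weak_deriv S bs f g"
    and f: "AE x in lebesgue_on S. f x = f' x" and g: "AE x in lebesgue_on S. g x = g' x"
  shows "has_weak_deriv S bs f' g'"
  using w integral_test_cong[OF S _ _ f] integral_test_cong[OF S _ _ g]
    locally_integrable_AE[OF S _ f] locally_integrable_AE[OF S _ g] test_functions_iter_deriv[OF _ bs]
  unfolding has_weak_deriv_def by simp

lemma has_weak_deriv_lin:
  fixes f :: "'a::euclidean_space \<Rightarrow> real"
  assumes S: "S \<in> sets lebesgue" and bs: "set bs \<subseteq> Basis"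
    and f: "has_weak_deriv S bs f f'" and g: "has_weak_deriv S bs g g'"
  shows "has_weak_deriv S bs (\<lambda>x. f x + c *\<^sub>R g x) (\<lambda>x. f' x + c *\<^sub>R g' x)"
  unfolding has_weak_deriv_def
proof (intro conjI ballI)
  have loc: "locally_integrable S f" "locally_integrable S g" "locally_integrable S f'" "locally_integrable S g'"
    using f g by (auto simp: has_weak_deriv_def)
  then show "locally_integrable S (\<lambda>x. f x + c *\<^sub>R g x)" "locally_integrable S (\<lambda>x. f' x + c *\<^sub>R g' x)"
    by (blast intro: locally_integrable_lin)+
  fix \<phi> assume \<phi>: "\<phi> \<in> test_functions S"
  have split: "(LINT x|lebesgue_on S. \<psi> x *\<^sub>R (u x + c *\<^sub>R v x)) =
      (LINT x|lebesgue_on S. \<psi> x * u x) + c * (LINT x|lebesgue_on S. \<psi> x * v x)"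
    if "\<psi> \<in> test_functions S" "locally_integrable S u" "locally_integrable S v" for \<psi> and u v :: "'a \<Rightarrow> real"
    using integrable_test_mult[OF that(1,2) S] integrable_test_mult[OF that(1,3) S]
    by (simp add: distrib_left mult.left_commute)
  show "(LINT x|lebesgue_on S. iter_deriv bs \<phi> x *\<^sub>R (f x + c *\<^sub>R g x)) =
      (- 1) ^ length bs *\<^sub>R (LINT x|lebesgue_on S. \<phi> x *\<^sub>R (f' x + c *\<^sub>R g' x))"
    unfolding split[OF test_functions_iter_deriv[OF \<phi> bs] loc(1,2)] split[OF \<phi> loc(3,4)]
    using f g \<phi> by (simp add: has_weak_deriv_def algebra_simps)
qed

text \<open>The difference of two candidates is a weak derivative of \<open>f - f\<close>, so its
  integral against every test function vanishes and the fundamental lemma applies.\<close>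

lemma weak_deriv_unique:
  fixes f :: "'a::euclidean_space \<Rightarrow> real"
  assumes S: "open S" and bs: "set bs \<subseteq> Basis"
    and g: "has_weak_deriv S bs f g" and g': "has_weak_deriv S bs f g'"
  shows "AE x in lebesgue_on S. g x = g' x"
proof -
  have Sm: "S \<in> sets lebesgue" using S by auto
  have *: "has_weak_deriv S bs (\<lambda>x. f x + (-1) *\<^sub>R f x) (\<lambda>x. g x + (-1) *\<^sub>R g' x)"
    by (rule has_weak_deriv_lin[OF Sm bs g g'])
  have "AE x in lebesgue_on S. g x + (-1) *\<^sub>R g' x = 0"
  proof (rule fundamental_lemma_calculus_of_variations[OF S])
    show "locally_integrable S (\<lambda>x. g x + (-1) *\<^sub>R g' x)"
      using * by (simp add: has_weak_deriv_def)
    show "(LINT x|lebesgue_on S. \<phi> x * (g x + (-1) *\<^sub>R g' x)) = 0" if "\<phi> \<in> test_functions S" for \<phi>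
      using * that by (simp add: has_weak_deriv_def)
  qed
  then show ?thesis by eventually_elim simp
qed

lemma weak_deriv_works: "has_weak_deriv S bs f g \<Longrightarrow> has_weak_deriv S bs f (weak_deriv S bs f)"
  unfolding weak_deriv_def by (rule someI[of "has_weak_deriv S bs f"])

lemma weak_deriv_eq:
  fixes f :: "'a::euclidean_space \<Rightarrow> real"
  assumes "open S" "set bs \<subseteq> Basis" "has_weak_deriv S bs f g"
  shows "AE x in lebesgue_on S. weak_deriv S bs f x = g x"
  by (rule weak_deriv_unique[OF assms(1,2) weak_deriv_works[OF assms(3)] assms(3)])

text \<open>The conclusion is equality of functions, not only almost everywhere: the chosen
  representative depends on \<open>f\<close> only through the predicate
  \<open>has_weak_deriv S bs f\<close>, which is the same predicate for \<open>g\<close>.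
  Consequently two pressures that agree almost everywhere have literally the same gradient and the
  same cut-off field.\<close>

lemma weak_deriv_cong:
  fixes f :: "'a::euclidean_space \<Rightarrow> real"
  assumes "S \<in> sets lebesgue" "set bs \<subseteq> Basis" "AE x in lebesgue_on S. f x = g x"
  shows "weak_deriv S bs f = weak_deriv S bs g"
proof -
  have "AE x in lebesgue_on S. g x = f x" using assms(3) by eventually_elim simp
  then have "has_weak_deriv S bs f = has_weak_deriv S bs g"
    using has_weak_deriv_cong[OF assms(1,2) _ assms(3)] has_weak_deriv_cong[OF assms(1,2)]
    by (intro ext iffI) auto
  then show ?thesis by (simp add: weak_deriv_def)
qed

lemma has_weak_deriv_Nil:
  fixes f :: "'a::euclidean_space \<Rightarrow> real"
  shows "locally_integrable S f \<Longrightarrow> has_weak_deriv S [] f f"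
  by (simp add: has_weak_deriv_def iter_deriv_def)

lemma has_weak_deriv_smooth:
  fixes \<phi> :: "'a::euclidean_space \<Rightarrow> real"
  assumes "smooth \<phi>" "b \<in> Basis" "S \<in> sets lebesgue"
  shows "has_weak_deriv S [b] \<phi> (dir_deriv b \<phi>)"
  using assms integration_by_parts_test[OF assms(1) _ assms(2,3)]
  by (auto simp: has_weak_deriv_def iter_deriv_def
      intro!: locally_integrable_continuous smooth_continuous smooth_dir_deriv)

section \<open>Sobolev spaces\<close>

text \<open>The index set of the \<open>H1\<close> norm; the empty list stands for the function
  itself.\<close>

definition order1 :: "'a::euclidean_space list set" where
  "order1 = {bs. set bs \<subseteq> Basis \<and> length bs \<le> 1}"

lemma order1: "finite order1" "[] \<in> order1" "b \<in> Basis \<Longrightarrow> [b] \<in> order1"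
  "bs \<in> order1 \<Longrightarrow> set bs \<subseteq> Basis"
  by (auto simp: order1_def finite_lists_length_le)

lemma H1_norm_square:
  "(snd (Hk S 1) f)\<^sup>2 = (\<Sum>bs\<in>order1. sq_int S (weak_deriv S bs f))"
proof -
  let ?s = "\<Sum>bs\<in>order1. sq_int S (weak_deriv S bs f)"
  have "0 \<le> ?s" by (intro sum_nonneg sq_int_nonneg)
  moreover have "snd (Hk S 1) f = ?s powr (1 / 2)"
    by (simp add: Wkp_def Lp_norm_2 order1_def)
  ultimately show ?thesis by (simp add: powr_half_sqrt)
qed

lemma H1_iff:
  "f \<in> fst (Hk S 1) \<longleftrightarrow> f \<in> fst (L2 S) \<and> (\<forall>bs\<in>order1. \<exists>g\<in>fst (L2 S). has_weak_deriv S bs f g)"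
  by (simp add: Wkp_def order1_def Ball_def)

lemma H1_L2: "f \<in> fst (Hk S 1) \<Longrightarrow> f \<in> fst (L2 S)"
  unfolding H1_iff by blast

text \<open>Membership in the space only provides some square integrable derivative; uniqueness
  transfers the integrability to the representative that \<open>weak_deriv\<close> chooses.\<close>

lemma H1_weak_deriv:
  fixes f :: "'a::euclidean_space \<Rightarrow> real"
  assumes "open S" "f \<in> fst (Hk S 1)" "bs \<in> order1"
  shows "weak_deriv S bs f \<in> fst (L2 S)" "has_weak_deriv S bs f (weak_deriv S bs f)"
proof -
  obtain g where g: "g \<in> fst (L2 S)" "has_weak_deriv S bs f g"
    using assms unfolding H1_iff by blast
  have "AE x in lebesgue_on S. g x = weak_deriv S bs f x"
    using weak_deriv_eq[OF assms(1) order1(4)[OF assms(3)] g(2)] by eventually_elim simp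
  with g(1) assms(1) show "weak_deriv S bs f \<in> fst (L2 S)" by (auto intro: L2_AE)
  show "has_weak_deriv S bs f (weak_deriv S bs f)" by (rule weak_deriv_works[OF g(2)])
qed

lemma weak_deriv_lin:
  fixes f g :: "'a::euclidean_space \<Rightarrow> real"
  assumes "open S" "f \<in> fst (Hk S 1)" "g \<in> fst (Hk S 1)" "bs \<in> order1"
  shows "AE x in lebesgue_on S. weak_deriv S bs (\<lambda>x. f x + c *\<^sub>R g x) x =
    weak_deriv S bs f x + c *\<^sub>R weak_deriv S bs g x"
  using assms by (intro weak_deriv_eq has_weak_deriv_lin H1_weak_deriv order1(4)) auto

lemma lin_closed_H1:
  fixes S :: "'a::euclidean_space set"
  assumes "open S"
  shows "lin_closed (fst (Hk S 1 :: ('a \<Rightarrow> real) nspace))"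
  unfolding lin_closed_def
proof (intro conjI ballI allI)
  have Sm: "S \<in> sets lebesgue" using assms by auto
  have "has_weak_deriv S bs (\<lambda>x. 0) (\<lambda>x. 0)" for bs
    by (simp add: has_weak_deriv_def locally_integrable_def)
  moreover have z: "(\<lambda>x. 0) \<in> fst (L2 S :: ('a \<Rightarrow> real) nspace)"
    by (rule lin_closedD(1)[OF lin_closed_L2])
  ultimately show "(\<lambda>x. 0) \<in> fst (Hk S 1 :: ('a \<Rightarrow> real) nspace)"
    unfolding H1_iff by blast
  fix f g :: "'a \<Rightarrow> real" and c
  assume fg: "f \<in> fst (Hk S 1)" "g \<in> fst (Hk S 1)"
  show "(\<lambda>x. f x + c *\<^sub>R g x) \<in> fst (Hk S 1)"
    unfolding H1_iff
  proof (intro conjI ballI)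
    show "(\<lambda>x. f x + c *\<^sub>R g x) \<in> fst (L2 S)"
      using fg by (intro lin_closedD(2)[OF lin_closed_L2] H1_L2)
    fix bs :: "'a list" assume bs: "bs \<in> order1"
    show "\<exists>h\<in>fst (L2 S). has_weak_deriv S bs (\<lambda>x. f x + c *\<^sub>R g x) h"
      using fg bs assms Sm
      by (intro bexI[of _ "\<lambda>x. weak_deriv S bs f x + c *\<^sub>R weak_deriv S bs g x"] has_weak_deriv_lin
          lin_closedD(2)[OF lin_closed_L2] H1_weak_deriv order1(4))
  qed
qed

lemma test_function_L2:
  assumes "\<phi> \<in> test_functions S" "S \<in> lmeasurable"
  shows "\<phi> \<in> fst (L2 S)"
proof -
  obtain B where "\<And>x. \<bar>\<phi> x\<bar> \<le> B" using test_functions_bounded[OF assms(1)] by blast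
  moreover have "\<phi> \<in> borel_measurable (lebesgue_on S)"
    using test_functions_borel[OF assms(1)] by (intro measurable_restrict_space1 measurable_completion) simp
  ultimately show ?thesis by (intro L2_bounded[of S \<phi> B] assms(2)) auto
qed

lemma order1_cases: "bs \<in> order1 \<Longrightarrow> bs = [] \<or> (\<exists>b\<in>Basis. bs = [b])"
  by (cases bs) (auto simp: order1_def)

lemma test_function_H1:
  assumes "\<phi> \<in> test_functions S" "S \<in> lmeasurable"
  shows "\<phi> \<in> fst (Hk S 1)"
  unfolding H1_iff
proof (intro conjI ballI)
  have Sm: "S \<in> sets lebesgue" using assms(2) by auto
  have sm: "smooth \<phi>" using assms(1) by (simp add: test_functions_iff)
  show L: "\<phi> \<in> fst (L2 S)" by (rule test_function_L2[OF assms])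
  fix bs :: "'a list" assume "bs \<in> order1"
  then consider "bs = []" | b where "b \<in> Basis" "bs = [b]" using order1_cases by blast
  then show "\<exists>g\<in>fst (L2 S). has_weak_deriv S bs \<phi> g"
  proof cases
    case 1
    then show ?thesis using L has_weak_deriv_Nil L2_locally_integrable[OF Sm L] by blast
  next
    case 2
    then show ?thesis
      using has_weak_deriv_smooth[OF sm 2(1) Sm] test_function_L2[OF test_functions_dir_deriv[OF assms(1)] assms(2)]
      by blast
  qed
qed

text \<open>Squaring the norm is harmless for limits at zero and leaves a plain finite sum of
  \<open>sq_int\<close> terms.\<close>

lemma H01_iff:
  "f \<in> H01 S \<longleftrightarrow> f \<in> fst (Hk S 1) \<and> (\<exists>\<phi>. (\<forall>n::nat. \<phi> n \<in> test_functions S) \<and>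
     (\<lambda>n. \<Sum>bs\<in>order1. sq_int S (weak_deriv S bs (\<lambda>x. f x - \<phi> n x))) \<longlonglongrightarrow> 0)"
proof -
  have "(\<lambda>n. snd (Hk S 1) (h n)) \<longlonglongrightarrow> 0 \<longleftrightarrow> (\<lambda>n. (snd (Hk S 1) (h n))\<^sup>2) \<longlonglongrightarrow> 0" for h :: "nat \<Rightarrow> 'a \<Rightarrow> real"
  proof
    assume "(\<lambda>n. (snd (Hk S 1) (h n))\<^sup>2) \<longlonglongrightarrow> 0"
    then have "(\<lambda>n. sqrt ((snd (Hk S 1) (h n))\<^sup>2)) \<longlonglongrightarrow> sqrt 0"
      by (rule tendsto_real_sqrt)
    then show "(\<lambda>n. snd (Hk S 1) (h n)) \<longlonglongrightarrow> 0"
      by (simp add: tendsto_rabs_zero_iff)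
  qed (use tendsto_power[of _ 0 _ 2] in fastforce)
  then show ?thesis unfolding H01_def H1_norm_square mem_Collect_eq by simp
qed

lemma H01_H1: "f \<in> H01 S \<Longrightarrow> f \<in> fst (Hk S 1)"
  by (simp add: H01_def)

text \<open>The same linear combination of the approximating test functions approximates the
  combination of their limits; the errors are combined by \<open>sq_int_add_le\<close>, separately
  for each derivative.\<close>

lemma lin_closed_H01:
  fixes S :: "'a::euclidean_space set"
  assumes "open S" "bounded S"
  shows "lin_closed (H01 S)"
  unfolding lin_closed_def
proof (intro conjI ballI allI)
  have Sl: "S \<in> lmeasurable" using assms by (simp add: lmeasurable_open)
  have wd0: "AE x in lebesgue_on S. weak_deriv S bs (\<lambda>x. 0) x = (0::real)" if "bs \<in> order1" for bs
    using that assms(1)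
    by (intro weak_deriv_eq order1(4)) (auto simp: has_weak_deriv_def locally_integrable_def)
  have "sq_int S (weak_deriv S bs (\<lambda>x. 0 :: real)) = 0" if "bs \<in> order1" for bs
  proof -
    have "sq_int S (weak_deriv S bs (\<lambda>x. 0 :: real)) = sq_int S (\<lambda>x. 0 :: real)"
      by (rule sq_int_cong_AE[OF H1_weak_deriv(1)[OF assms(1) lin_closedD(1)[OF lin_closed_H1[OF assms(1)]] that]
            lin_closedD(1)[OF lin_closed_L2] wd0[OF that]])
    then show ?thesis by (simp add: sq_int_def)
  qed
  then show "(\<lambda>x. 0) \<in> H01 S"
    unfolding H01_iff using lin_closedD(1)[OF lin_closed_H1[OF assms(1)]] lin_closedD(1)[OF lin_closed_test_functions]
    by (intro conjI exI[of _ "\<lambda>n x. 0"]) auto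
  fix f g :: "'a \<Rightarrow> real" and c
  assume fg: "f \<in> H01 S" "g \<in> H01 S"
  obtain \<phi> where \<phi>: "\<And>n::nat. \<phi> n \<in> test_functions S"
    "(\<lambda>n. \<Sum>bs\<in>order1. sq_int S (weak_deriv S bs (\<lambda>x. f x - \<phi> n x))) \<longlonglongrightarrow> 0"
    using fg(1) by (auto simp: H01_iff)
  obtain \<psi> where \<psi>: "\<And>n::nat. \<psi> n \<in> test_functions S"
    "(\<lambda>n. \<Sum>bs\<in>order1. sq_int S (weak_deriv S bs (\<lambda>x. g x - \<psi> n x))) \<longlonglongrightarrow> 0"
    using fg(2) by (auto simp: H01_iff)
  note H1 = lin_closedD(2)[OF lin_closed_H1[OF assms(1)]]
  define u where "u n x = f x - \<phi> n x" for n x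
  define v where "v n x = g x - \<psi> n x" for n x
  have uv: "u n \<in> fst (Hk S 1)" "v n \<in> fst (Hk S 1)" for n
    using H1[OF H01_H1[OF fg(1)] test_function_H1[OF \<phi>(1) Sl], of "-1"]
      H1[OF H01_H1[OF fg(2)] test_function_H1[OF \<psi>(1) Sl], of "-1"]
    by (simp_all add: u_def[abs_def] v_def[abs_def])
  have le: "sq_int S (weak_deriv S bs (\<lambda>x. u n x + c *\<^sub>R v n x)) \<le>
      2 * sq_int S (weak_deriv S bs (u n)) + 2 * c\<^sup>2 * sq_int S (weak_deriv S bs (v n))"
    if bs: "bs \<in> order1" for bs n
  proof -
    note w = H1_weak_deriv(1)[OF assms(1) uv(1) bs] H1_weak_deriv(1)[OF assms(1) uv(2) bs]
    have "sq_int S (weak_deriv S bs (\<lambda>x. u n x + c *\<^sub>R v n x)) =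
        sq_int S (\<lambda>x. weak_deriv S bs (u n) x + c *\<^sub>R weak_deriv S bs (v n) x)"
      by (rule sq_int_cong_AE[OF H1_weak_deriv(1)[OF assms(1) H1[OF uv] bs]
            lin_closedD(2)[OF lin_closed_L2 w] weak_deriv_lin[OF assms(1) uv bs]])
    also have "\<dots> \<le> 2 * sq_int S (weak_deriv S bs (u n)) + 2 * c\<^sup>2 * sq_int S (weak_deriv S bs (v n))"
      by (rule sq_int_add_le[OF w])
    finally show ?thesis .
  qed
  let ?s = "\<lambda>w. \<Sum>bs\<in>order1. sq_int S (weak_deriv S bs w)"
  have "(\<lambda>n. ?s (\<lambda>x. u n x + c *\<^sub>R v n x)) \<longlonglongrightarrow> 0"
  proof (rule tendsto_sandwich)
    show "\<forall>\<^sub>F n in sequentially. 0 \<le> ?s (\<lambda>x. u n x + c *\<^sub>R v n x)"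
      by (intro always_eventually allI sum_nonneg sq_int_nonneg)
    show "\<forall>\<^sub>F n in sequentially. ?s (\<lambda>x. u n x + c *\<^sub>R v n x) \<le> 2 * ?s (u n) + 2 * c\<^sup>2 * ?s (v n)"
      unfolding sum_distrib_left sum.distrib[symmetric]
      by (intro always_eventually allI sum_mono le)
    have "(\<lambda>n. 2 * ?s (u n) + 2 * c\<^sup>2 * ?s (v n)) \<longlonglongrightarrow> 2 * 0 + 2 * c\<^sup>2 * 0"
      using \<phi>(2) \<psi>(2) unfolding u_def v_def by (intro tendsto_intros)
    then show "(\<lambda>n. 2 * ?s (u n) + 2 * c\<^sup>2 * ?s (v n)) \<longlonglongrightarrow> 0" by simp
  qed simp
  moreover have "(\<lambda>x. u n x + c *\<^sub>R v n x) = (\<lambda>x. (f x + c *\<^sub>R g x) - (\<phi> n x + c *\<^sub>R \<psi> n x))" for n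
    by (simp add: u_def v_def algebra_simps)
  moreover have "(\<lambda>x. \<phi> n x + c *\<^sub>R \<psi> n x) \<in> test_functions S" for n
    by (rule lin_closedD(2)[OF lin_closed_test_functions \<phi>(1) \<psi>(1)])
  ultimately show "(\<lambda>x. f x + c *\<^sub>R g x) \<in> H01 S"
    unfolding H01_iff using H1[OF H01_H1[OF fg(1)] H01_H1[OF fg(2)]]
    by (intro conjI exI[of _ "\<lambda>n x. \<phi> n x + c *\<^sub>R \<psi> n x"]) auto
qed

text \<open>Since \<open>x \<bullet> b\<close> has derivative 1 in direction \<open>b\<close>,
  integration by parts expresses the integral of \<open>\<phi>\<^sup>2\<close> through
  \<open>- 2 * \<phi> x * (x \<bullet> b)\<close> times the derivative of \<open>\<phi>\<close>.
  Young's inequality with \<open>\<bar>x \<bullet> b\<bar> \<le> R\<close> gives back half of the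
  left-hand side and leaves \<open>2 * R\<^sup>2\<close>, hence the constant 4.\<close>

lemma Poincare_test_function:
  assumes \<phi>: "\<phi> \<in> test_functions S" and b: "b \<in> Basis" and S: "S \<in> lmeasurable" "S \<subseteq> cball 0 R"
  shows "sq_int S \<phi> \<le> 4 * R\<^sup>2 * sq_int S (dir_deriv b \<phi>)"
proof -
  have Sm: "S \<in> sets lebesgue" using S(1) by auto
  have sm: "smooth \<phi>" using \<phi> by (simp add: test_functions_iff)
  have d: "dir_deriv b \<phi> \<in> test_functions S" by (rule test_functions_dir_deriv[OF \<phi> b])
  have b1: "dir_deriv b (\<lambda>x. x \<bullet> b) = (\<lambda>x. 1)"
    using b by (intro ext, subst dir_deriv_eqI[of _ "\<lambda>h. h \<bullet> b"]) (auto intro!: derivative_eq_intros)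
  have prod: "dir_deriv b (\<lambda>x. \<phi> x * \<phi> x) = (\<lambda>x. 2 * \<phi> x * dir_deriv b \<phi> x)"
    using sm by (intro ext) (simp add: dir_deriv_mult smooth_differentiable)
  note L = L2_square_integrable[OF test_function_L2[OF \<phi> S(1)]] L2_square_integrable[OF test_function_L2[OF d S(1)]]
  have "(LINT x|lebesgue_on S. dir_deriv b (\<lambda>x. \<phi> x * \<phi> x) x * (x \<bullet> b)) =
      - (LINT x|lebesgue_on S. \<phi> x * \<phi> x * dir_deriv b (\<lambda>x. x \<bullet> b) x)"
    by (rule integration_by_parts_test[OF smooth_inner test_functions_mult[OF \<phi> \<phi>] b Sm])
  then have "sq_int S \<phi> = - (LINT x|lebesgue_on S. 2 * \<phi> x * dir_deriv b \<phi> x * (x \<bullet> b))"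
    unfolding b1 prod sq_int_def by (simp add: power2_eq_square)
  also have "\<dots> = (LINT x|lebesgue_on S. - (2 * \<phi> x * dir_deriv b \<phi> x * (x \<bullet> b)))"
    by simp
  also have "\<dots> \<le> (LINT x|lebesgue_on S. (1/2) * (norm (\<phi> x))\<^sup>2 + 2 * R\<^sup>2 * (norm (dir_deriv b \<phi> x))\<^sup>2)"
  proof (rule integral_mono)
    have "integrable (lebesgue_on S) (\<lambda>x. (dir_deriv b (\<lambda>x. \<phi> x * \<phi> x)) x * (x \<bullet> b))"
      by (rule integrable_test_mult[OF test_functions_dir_deriv[OF test_functions_mult[OF \<phi> \<phi>] b]
          locally_integrable_continuous[OF smooth_continuous[OF smooth_inner]] Sm])
    then show "integrable (lebesgue_on S) (\<lambda>x. - (2 * \<phi> x * dir_deriv b \<phi> x * (x \<bullet> b)))"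
      unfolding prod by simp
    show "integrable (lebesgue_on S) (\<lambda>x. (1/2) * (norm (\<phi> x))\<^sup>2 + 2 * R\<^sup>2 * (norm (dir_deriv b \<phi> x))\<^sup>2)"
      by (intro Bochner_Integration.integrable_add integrable_mult_right L)
    fix x assume "x \<in> space (lebesgue_on S)"
    then have "norm x \<le> R" using S(2) by auto
    then have "\<bar>x \<bullet> b\<bar> \<le> R" using Basis_le_norm[OF b, of x] by linarith
    then have "(x \<bullet> b)\<^sup>2 \<le> R\<^sup>2" by (rule abs_le_square_iff[THEN iffD1, OF order_trans[OF _ abs_ge_self]])
    then have "2 * (x \<bullet> b)\<^sup>2 * (dir_deriv b \<phi> x)\<^sup>2 \<le> 2 * R\<^sup>2 * (dir_deriv b \<phi> x)\<^sup>2"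
      by (intro mult_right_mono) auto
    \<comment> \<open>With \<open>d\<close> for the derivative, this square expands to
      \<open>\<phi>^2 / 2 + 2 * (x \<bullet> b) * \<phi> * d + 2 * (x \<bullet> b)^2 * d^2\<close>,
      whose middle term is the one to be bounded.\<close>
    moreover have "0 \<le> (\<phi> x + 2 * (x \<bullet> b) * dir_deriv b \<phi> x)\<^sup>2 / 2" by simp
    ultimately show "- (2 * \<phi> x * dir_deriv b \<phi> x * (x \<bullet> b)) \<le> (1/2) * (norm (\<phi> x))\<^sup>2 + 2 * R\<^sup>2 * (norm (dir_deriv b \<phi> x))\<^sup>2"
      by (simp add: power2_sum power_mult_distrib algebra_simps)
  qed
  also have "\<dots> = (1/2) * sq_int S \<phi> + 2 * R\<^sup>2 * sq_int S (dir_deriv b \<phi>)"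
    using L by (simp add: sq_int_def)
  finally show ?thesis by simp
qed

text \<open>As \<open>f\<close> has zero derivative in direction \<open>b\<close>, the derivatives
  of the approximating test functions in this direction tend to zero; by the Poincare inequality the
  test functions do so too, and their limit is \<open>f\<close>.\<close>

lemma H01_weak_deriv_zero:
  fixes f :: "'a::euclidean_space \<Rightarrow> real"
  assumes S: "open S" "bounded S" and f: "f \<in> H01 S" and b: "b \<in> Basis"
    and zero: "AE x in lebesgue_on S. weak_deriv S [b] f x = 0"
  shows "AE x in lebesgue_on S. f x = 0"
proof -
  have Sl: "S \<in> lmeasurable" using S by (simp add: lmeasurable_open)
  have Sm: "S \<in> sets lebesgue" using S by auto
  obtain R where R: "S \<subseteq> cball 0 R"
    using S(2) unfolding bounded_iff by (auto simp: subset_iff)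
  obtain \<phi> where \<phi>: "\<And>n::nat. \<phi> n \<in> test_functions S"
    "(\<lambda>n. \<Sum>bs\<in>order1. sq_int S (weak_deriv S bs (\<lambda>x. f x - \<phi> n x))) \<longlonglongrightarrow> 0"
    using f by (auto simp: H01_iff)
  define u where "u n = (\<lambda>x. f x + (-1) *\<^sub>R \<phi> n x)" for n
  define a where "a n = (\<Sum>bs\<in>order1. sq_int S (weak_deriv S bs (u n)))" for n
  have a: "a \<longlonglongrightarrow> 0" using \<phi>(2) by (simp add: a_def[abs_def] u_def)
  note fH = H01_H1[OF f] and \<phi>H = test_function_H1[OF \<phi>(1) Sl]
  have uH: "u n \<in> fst (Hk S 1)" for n
    unfolding u_def by (rule lin_closedD(2)[OF lin_closed_H1[OF S(1)] fH \<phi>H])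
  have le_a: "sq_int S (weak_deriv S bs (u n)) \<le> a n" if "bs \<in> order1" for bs n
    unfolding a_def by (rule member_le_sum[OF that _ order1(1)]) (rule sq_int_nonneg)
  have u_le: "sq_int S (u n) \<le> a n" for n
  proof -
    have "AE x in lebesgue_on S. weak_deriv S [] (u n) x = u n x"
      by (rule weak_deriv_eq[OF S(1) _ has_weak_deriv_Nil[OF L2_locally_integrable[OF Sm H1_L2[OF uH]]]]) simp
    then have "sq_int S (weak_deriv S [] (u n)) = sq_int S (u n)"
      by (rule sq_int_cong_AE[OF H1_weak_deriv(1)[OF S(1) uH order1(2)] H1_L2[OF uH]])
    then show ?thesis using le_a[OF order1(2), of n] by simp
  qed
  have d_le: "sq_int S (dir_deriv b (\<phi> n)) \<le> a n" for n
  proof -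
    have "AE x in lebesgue_on S. weak_deriv S [b] (\<phi> n) x = dir_deriv b (\<phi> n) x"
      using \<phi>(1) b Sm S(1) by (intro weak_deriv_eq has_weak_deriv_smooth) (auto simp: test_functions_iff)
    moreover have "AE x in lebesgue_on S. weak_deriv S [b] (u n) x = weak_deriv S [b] f x + (-1) *\<^sub>R weak_deriv S [b] (\<phi> n) x"
      unfolding u_def by (rule weak_deriv_lin[OF S(1) fH \<phi>H order1(3)[OF b]])
    ultimately have ae: "AE x in lebesgue_on S. weak_deriv S [b] (u n) x = - dir_deriv b (\<phi> n) x"
      using zero by eventually_elim simp
    note w = H1_weak_deriv(1)[OF S(1) uH order1(3)[OF b]]
    have "sq_int S (weak_deriv S [b] (u n)) = sq_int S (\<lambda>x. - dir_deriv b (\<phi> n) x)"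
      by (rule sq_int_cong_AE[OF w L2_AE[OF Sm w ae] ae])
    then show ?thesis using le_a[OF order1(3)[OF b], of n] by (simp add: sq_int_def)
  qed
  \<comment> \<open>From \<open>f = u n + \<phi> n\<close>: the splitting costs a factor 2 on each
    part, and the second part carries the Poincare constant \<open>4 * R\<^sup>2\<close>.\<close>
  have "sq_int S f \<le> (2 + 8 * R\<^sup>2) * a n" for n
  proof -
    have "sq_int S (\<lambda>x. u n x + 1 *\<^sub>R \<phi> n x) \<le> 2 * sq_int S (u n) + 2 * 1\<^sup>2 * sq_int S (\<phi> n)"
      by (rule sq_int_add_le[OF H1_L2[OF uH] H1_L2[OF \<phi>H]])
    also have "sq_int S (\<phi> n) \<le> 4 * R\<^sup>2 * a n"
      using Poincare_test_function[OF \<phi>(1) b Sl R, of n] mult_left_mono[OF d_le, of "4 * R\<^sup>2" n] by simp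
    finally show ?thesis using u_le[of n] by (simp add: u_def algebra_simps)
  qed
  moreover have "(\<lambda>n. (2 + 8 * R\<^sup>2) * a n) \<longlonglongrightarrow> (2 + 8 * R\<^sup>2) * 0"
    by (intro tendsto_mult_left a)
  ultimately have "sq_int S f \<le> 0"
    by (intro LIMSEQ_le_const[of "\<lambda>n. (2 + 8 * R\<^sup>2) * a n"]) auto
  then show ?thesis by (rule sq_int_eq_0[OF H1_L2[OF fH]])
qed

section \<open>Linear maps into \<open>L\<^sup>2\<close> and forms on function spaces\<close>

abbreviation ae_eq :: "'a::euclidean_space set \<Rightarrow> ('a \<Rightarrow> 'b) \<Rightarrow> ('a \<Rightarrow> 'b) \<Rightarrow> bool" where
  "ae_eq S f g \<equiv> (AE x in lebesgue_on S. f x = g x)"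

text \<open>The gradient is assembled from chosen representatives, so it is linear only almost
  everywhere. The third clause says that the map acts on classes.\<close>

definition L2_linear ::
  "'a::euclidean_space set \<Rightarrow> ('a \<Rightarrow> 'b::real_vector) set \<Rightarrow> (('a \<Rightarrow> 'b) \<Rightarrow> 'a \<Rightarrow> 'c::euclidean_space) \<Rightarrow> bool"
where
  "L2_linear S X G \<longleftrightarrow> (\<forall>f\<in>X. G f \<in> fst (L2 S)) \<and>
     (\<forall>f\<in>X. \<forall>g\<in>X. \<forall>c. ae_eq S (G (\<lambda>x. f x + c *\<^sub>R g x)) (\<lambda>x. G f x + c *\<^sub>R G g x)) \<and>
     (\<forall>f\<in>X. \<forall>g\<in>X. ae_eq S f g \<longrightarrow> ae_eq S (G f) (G g))"

text \<open>These are the forms that descend to linear forms modulo null functions.\<close>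

definition ae_form :: "'a::euclidean_space set \<Rightarrow> ('a \<Rightarrow> 'b::real_vector) set \<Rightarrow> (('a \<Rightarrow> 'b) \<Rightarrow> real) \<Rightarrow> bool" where
  "ae_form S X F \<longleftrightarrow> linear_form X F \<and> (\<forall>f\<in>X. \<forall>g\<in>X. ae_eq S f g \<longrightarrow> F f = F g)"

lemma L2_linearD:
  assumes "L2_linear S X G"
  shows "f \<in> X \<Longrightarrow> G f \<in> fst (L2 S)"
    and "f \<in> X \<Longrightarrow> g \<in> X \<Longrightarrow> ae_eq S (G (\<lambda>x. f x + c *\<^sub>R g x)) (\<lambda>x. G f x + c *\<^sub>R G g x)"
    and "f \<in> X \<Longrightarrow> g \<in> X \<Longrightarrow> ae_eq S f g \<Longrightarrow> ae_eq S (G f) (G g)"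
  using assms unfolding L2_linear_def by blast+

lemma ae_formD:
  assumes "ae_form S X F"
  shows "linear_form X F" "f \<in> X \<Longrightarrow> g \<in> X \<Longrightarrow> ae_eq S f g \<Longrightarrow> F f = F g"
  using assms unfolding ae_form_def by blast+

lemma ae_form_lin: "ae_form S X F \<Longrightarrow> f \<in> X \<Longrightarrow> g \<in> X \<Longrightarrow> F (\<lambda>x. f x + c *\<^sub>R g x) = F f + c * F g"
  by (rule linear_formD[OF ae_formD(1)])

lemma ae_form_subset: "ae_form S X F \<Longrightarrow> Y \<subseteq> X \<Longrightarrow> ae_form S Y F"
  unfolding ae_form_def by (meson linear_form_subset subsetD)

lemma ae_form_add: "ae_form S X F \<Longrightarrow> ae_form S X G \<Longrightarrow> ae_form S X (\<lambda>w. F w + G w)"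
  unfolding ae_form_def using linear_form_add[of X F G] by metis

lemma ae_form_diff: "ae_form S X F \<Longrightarrow> ae_form S X G \<Longrightarrow> ae_form S X (\<lambda>w. F w - G w)"
  unfolding ae_form_def using linear_form_diff[of X F G] by metis

lemma ae_form_cmult: "ae_form S X F \<Longrightarrow> ae_form S X (\<lambda>w. c * F w)"
  unfolding ae_form_def using linear_form_cmult[of X F] by metis

lemmas ae_form_intros = ae_form_add ae_form_diff ae_form_cmult

text \<open>Pulls a form back along a pointwise linear map. With \<open>\<pi>\<close> a component
  map, forms on single fields become forms on the triples of the coupled step.\<close>

lemma ae_form_compose:
  assumes F: "ae_form S X F" and \<pi>: "linear \<pi>" and Y: "\<And>w. w \<in> Y \<Longrightarrow> (\<lambda>x. \<pi> (w x)) \<in> X"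
  shows "ae_form S Y (\<lambda>w. F (\<lambda>x. \<pi> (w x)))"
  unfolding ae_form_def linear_form_def
proof (intro conjI ballI allI impI)
  fix f g c assume fg: "f \<in> Y" "g \<in> Y"
  show "F (\<lambda>x. \<pi> (f x + c *\<^sub>R g x)) = F (\<lambda>x. \<pi> (f x)) + c * F (\<lambda>x. \<pi> (g x))"
    using ae_form_lin[OF F Y[OF fg(1)] Y[OF fg(2)]] by (simp add: linear_add[OF \<pi>] linear_cmul[OF \<pi>])
  assume "ae_eq S f g"
  then have "ae_eq S (\<lambda>x. \<pi> (f x)) (\<lambda>x. \<pi> (g x))" by eventually_elim simp
  then show "F (\<lambda>x. \<pi> (f x)) = F (\<lambda>x. \<pi> (g x))"
    by (rule ae_formD(2)[OF F Y[OF fg(1)] Y[OF fg(2)]])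
qed

lemma L2_linear_compose:
  assumes G: "L2_linear S X G" and \<pi>: "linear \<pi>" and Y: "\<And>w. w \<in> Y \<Longrightarrow> (\<lambda>x. \<pi> (w x)) \<in> X"
  shows "L2_linear S Y (\<lambda>w. G (\<lambda>x. \<pi> (w x)))"
  unfolding L2_linear_def
proof (intro conjI ballI allI impI)
  fix f g c assume f: "f \<in> Y"
  show "G (\<lambda>x. \<pi> (f x)) \<in> fst (L2 S)" by (rule L2_linearD(1)[OF G Y[OF f]])
  assume g: "g \<in> Y"
  show "ae_eq S (G (\<lambda>x. \<pi> (f x + c *\<^sub>R g x))) (\<lambda>x. G (\<lambda>x. \<pi> (f x)) x + c *\<^sub>R G (\<lambda>x. \<pi> (g x)) x)"
    using L2_linearD(2)[OF G Y[OF f] Y[OF g]] by (simp add: linear_add[OF \<pi>] linear_cmul[OF \<pi>])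
  assume "ae_eq S f g"
  then have "ae_eq S (\<lambda>x. \<pi> (f x)) (\<lambda>x. \<pi> (g x))" by eventually_elim simp
  then show "ae_eq S (G (\<lambda>x. \<pi> (f x))) (G (\<lambda>x. \<pi> (g x)))"
    by (rule L2_linearD(3)[OF G Y[OF f] Y[OF g]])
qed

text \<open>Covers constant linear maps, multiplication by a bounded tensor, and multiplication of a
  scalar by a bounded vector field. The map varies with \<open>x\<close>, so preservation of
  measurability is a hypothesis of its own.\<close>

lemma L2_linear_pointwise:
  assumes G: "L2_linear S X G" and lin: "\<And>x. x \<in> S \<Longrightarrow> linear (A x)"
    and bound: "\<And>x y. x \<in> S \<Longrightarrow> norm (A x y) \<le> C * norm y"
    and meas: "\<And>g. g \<in> borel_measurable (lebesgue_on S) \<Longrightarrow> (\<lambda>x. A x (g x)) \<in> borel_measurable (lebesgue_on S)"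
  shows "L2_linear S X (\<lambda>f x. A x (G f x))"
  unfolding L2_linear_def
proof (intro conjI ballI allI impI)
  fix f g c assume f: "f \<in> X"
  show "(\<lambda>x. A x (G f x)) \<in> fst (L2 S)"
    by (rule L2_dominated[OF L2_linearD(1)[OF G f] meas[OF L2_measurable[OF L2_linearD(1)[OF G f]]], of C])
       (rule AE_I2, simp add: bound)
  assume g: "g \<in> X"
  have sp: "AE x in lebesgue_on S. x \<in> S" by (rule AE_I2) simp
  show "ae_eq S (\<lambda>x. A x (G (\<lambda>x. f x + c *\<^sub>R g x) x)) (\<lambda>x. A x (G f x) + c *\<^sub>R A x (G g x))"
    using L2_linearD(2)[OF G f g, of c] sp
    by eventually_elim (simp add: linear_add[OF lin] linear_cmul[OF lin])
  assume "ae_eq S f g"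
  from L2_linearD(3)[OF G f g this]
  show "ae_eq S (\<lambda>x. A x (G f x)) (\<lambda>x. A x (G g x))" by eventually_elim simp
qed

lemma norm_square_vec: "(norm (x :: 'c::real_normed_vector ^ 'i))\<^sup>2 = (\<Sum>i\<in>UNIV. (norm (x $ i))\<^sup>2)"
  by (simp add: norm_vec_def L2_set_def sum_nonneg)

lemma borel_measurable_vec:
  fixes f :: "'a \<Rightarrow> 'c::euclidean_space ^ 'i"
  assumes "\<And>i. (\<lambda>x. f x $ i) \<in> borel_measurable M"
  shows "f \<in> borel_measurable M"
proof -
  have "(\<lambda>x. f x \<bullet> b) \<in> borel_measurable M" if "b \<in> Basis" for b
  proof -
    obtain i u where "b = axis i u" using \<open>b \<in> Basis\<close> unfolding Basis_vec_def by blast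
    then show ?thesis using assms[of i] by (simp add: inner_axis)
  qed
  then show ?thesis by (simp add: borel_measurable_euclidean_space[of f])
qed

lemma borel_measurable_vec_nth:
  fixes f :: "'a \<Rightarrow> 'c::euclidean_space ^ 'i"
  assumes "f \<in> borel_measurable M"
  shows "(\<lambda>x. f x $ i) \<in> borel_measurable M"
  by (rule borel_measurable_continuous_on[OF _ assms]) (intro continuous_intros)

lemma L2_vec:
  fixes f :: "'a::euclidean_space \<Rightarrow> 'c::euclidean_space ^ 'i"
  assumes "\<And>i. (\<lambda>x. f x $ i) \<in> fst (L2 S)"
  shows "f \<in> fst (L2 S)"
  unfolding L2_iff norm_square_vec
  by (intro conjI borel_measurable_vec Bochner_Integration.integrable_sum
      L2_measurable[OF assms] L2_square_integrable[OF assms])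

lemma L2_linear_vec:
  fixes G :: "'i::finite \<Rightarrow> ('a::euclidean_space \<Rightarrow> 'b::real_vector) \<Rightarrow> 'a \<Rightarrow> 'c::euclidean_space"
  assumes "\<And>i. L2_linear S X (G i)"
  shows "L2_linear S X (\<lambda>f x. \<chi> i. G i f x)"
  unfolding L2_linear_def
proof (intro conjI ballI allI impI)
  fix f g c assume f: "f \<in> X"
  show "(\<lambda>x. \<chi> i. G i f x) \<in> fst (L2 S)"
    by (rule L2_vec) (simp add: L2_linearD(1)[OF assms f])
  assume g: "g \<in> X"
  have "AE x in lebesgue_on S. \<forall>i. G i (\<lambda>x. f x + c *\<^sub>R g x) x = G i f x + c *\<^sub>R G i g x"
    by (rule eventually_all_finite) (rule L2_linearD(2)[OF assms f g])
  then show "ae_eq S (\<lambda>x. \<chi> i. G i (\<lambda>x. f x + c *\<^sub>R g x) x) (\<lambda>x. (\<chi> i. G i f x) + c *\<^sub>R (\<chi> i. G i g x))"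
    by eventually_elim (simp add: vec_eq_iff)
  assume "ae_eq S f g"
  then have "AE x in lebesgue_on S. \<forall>i. G i f x = G i g x"
    by (intro eventually_all_finite) (rule L2_linearD(3)[OF assms f g])
  then show "ae_eq S (\<lambda>x. \<chi> i. G i f x) (\<lambda>x. \<chi> i. G i g x)"
    by eventually_elim simp
qed

lemma L2_linear_id: "X \<subseteq> fst (L2 S) \<Longrightarrow> L2_linear S X (\<lambda>f. f)"
  by (auto simp: L2_linear_def)

lemma L2_inner_cong:
  assumes "f \<in> fst (L2 S)" "f' \<in> fst (L2 S)" "g \<in> fst (L2 S)" "g' \<in> fst (L2 S)"
    and "ae_eq S f f'" "ae_eq S g g'"
  shows "L2_inner S f g = L2_inner S f' g'"
  unfolding L2_inner_def
proof (rule integral_cong_AE)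
  show "(\<lambda>x. f x \<bullet> g x) \<in> borel_measurable (lebesgue_on S)" "(\<lambda>x. f' x \<bullet> g' x) \<in> borel_measurable (lebesgue_on S)"
    by (intro borel_measurable_inner L2_measurable assms)+
  show "AE x in lebesgue_on S. f x \<bullet> g x = f' x \<bullet> g' x"
    using assms(5,6) by eventually_elim simp
qed

lemma L2_inner_lin:
  assumes "f \<in> fst (L2 S)" "g \<in> fst (L2 S)" "h \<in> fst (L2 S)"
  shows "L2_inner S (\<lambda>x. f x + c *\<^sub>R g x) h = L2_inner S f h + c * L2_inner S g h"
  using L2_prod_integrable[OF assms(1,3)] L2_prod_integrable[OF assms(2,3)]
  by (simp add: L2_inner_def inner_add_left)

lemma L2_inner_commute: "L2_inner S f g = L2_inner S g f"
  by (simp add: L2_inner_def inner_commute)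

lemma ae_form_L2_inner:
  assumes G: "L2_linear S X G" and h: "h \<in> fst (L2 S)" and X: "lin_closed X"
  shows "ae_form S X (\<lambda>f. L2_inner S (G f) h)" "ae_form S X (\<lambda>f. L2_inner S h (G f))"
proof -
  show "ae_form S X (\<lambda>f. L2_inner S (G f) h)"
    unfolding ae_form_def linear_form_def
  proof (intro conjI ballI allI impI)
    fix f g c assume fg: "f \<in> X" "g \<in> X"
    note L = L2_linearD(1)[OF G]
    have "L2_inner S (G (\<lambda>x. f x + c *\<^sub>R g x)) h = L2_inner S (\<lambda>x. G f x + c *\<^sub>R G g x) h"
      using L[OF lin_closedD(2)[OF X fg]] lin_closedD(2)[OF lin_closed_L2 L[OF fg(1)] L[OF fg(2)]] h h
        L2_linearD(2)[OF G fg] by (rule L2_inner_cong) simp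
    then show "L2_inner S (G (\<lambda>x. f x + c *\<^sub>R g x)) h = L2_inner S (G f) h + c * L2_inner S (G g) h"
      by (simp add: L2_inner_lin[OF L[OF fg(1)] L[OF fg(2)] h])
    assume "ae_eq S f g"
    then show "L2_inner S (G f) h = L2_inner S (G g) h"
      by (intro L2_inner_cong L fg h L2_linearD(3)[OF G fg]) auto
  qed
  then show "ae_form S X (\<lambda>f. L2_inner S h (G f))" by (simp add: L2_inner_commute)
qed

lemma L2_inner_self: "L2_inner S f f = sq_int S f"
  by (simp add: L2_inner_def sq_int_def power2_norm_eq_inner)

lemma L2_inner_cong_left:
  "f \<in> fst (L2 S) \<Longrightarrow> f' \<in> fst (L2 S) \<Longrightarrow> g \<in> fst (L2 S) \<Longrightarrow> ae_eq S f f' \<Longrightarrow> L2_inner S f g = L2_inner S f' g"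
  by (rule L2_inner_cong) auto

text \<open>From \<open>(f / 2 - g)\<^sup>2 \<ge> 0\<close>. The slot with weight
  \<open>1 / 4\<close> is meant for the temperature, the other one for the pressure.\<close>

lemma L2_inner_le:
  fixes S :: "(real ^ 'd) set" and f g :: "real ^ 'd \<Rightarrow> real"
  assumes "f \<in> fst (L2 S)" "g \<in> fst (L2 S)"
  shows "L2_inner S f g \<le> sq_int S f / 4 + sq_int S g"
proof -
  have "L2_inner S f g \<le> (LINT x|lebesgue_on S. (1/4) * (norm (f x))\<^sup>2 + (norm (g x))\<^sup>2)"
    unfolding L2_inner_def
  proof (rule integral_mono)
    fix x
    have "0 \<le> (f x / 2 - g x)\<^sup>2" by simp
    then show "f x \<bullet> g x \<le> (1/4) * (norm (f x))\<^sup>2 + (norm (g x))\<^sup>2"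
      by (simp add: power2_diff power_divide)
  qed (intro L2_prod_integrable assms Bochner_Integration.integrable_add integrable_mult_right L2_square_integrable)+
  also have "\<dots> = sq_int S f / 4 + sq_int S g"
    using assms[THEN L2_square_integrable] by (simp add: sq_int_def)
  finally show ?thesis .
qed

section \<open>Finite dimension modulo null functions, and solvability\<close>

definition separated :: "'a::euclidean_space set \<Rightarrow> ('a \<Rightarrow> 'b::real_vector) set \<Rightarrow> bool" where
  "separated S X \<longleftrightarrow> (\<exists>L. finite L \<and> (\<forall>l\<in>L. linear_form X l) \<and>
     (\<forall>w\<in>X. (\<forall>l\<in>L. l w = 0) \<longrightarrow> ae_eq S w (\<lambda>x. 0)))"

lemma separated_subset: "separated S X \<Longrightarrow> Y \<subseteq> X \<Longrightarrow> separated S Y"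
  unfolding separated_def using linear_form_subset by (meson subsetD)

lemma linear_form_compose:
  assumes F: "linear_form X F" and \<pi>: "linear \<pi>" and Y: "\<And>w. w \<in> Y \<Longrightarrow> (\<lambda>x. \<pi> (w x)) \<in> X"
  shows "linear_form Y (\<lambda>w. F (\<lambda>x. \<pi> (w x)))"
  using linear_formD[OF F Y Y] unfolding linear_form_def
  by (simp add: linear_add[OF \<pi>] linear_cmul[OF \<pi>])

text \<open>The functionals of each \<open>X i\<close> are pulled back along \<open>\<pi> i\<close>;
  together they see every component, and the components determine the value. Applied to the
  components of a displacement and to the fields of the coupled system.\<close>

lemma separated_projections:
  fixes \<pi> :: "'i \<Rightarrow> 'b::real_vector \<Rightarrow> 'c::real_vector"
  assumes I: "finite I" and X: "\<And>i. i \<in> I \<Longrightarrow> separated S (X i)" and \<pi>: "\<And>i. i \<in> I \<Longrightarrow> linear (\<pi> i)"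
    and Y: "\<And>i w. i \<in> I \<Longrightarrow> w \<in> Y \<Longrightarrow> (\<lambda>x. \<pi> i (w x)) \<in> X i"
    and inj: "\<And>y. (\<And>i. i \<in> I \<Longrightarrow> \<pi> i y = 0) \<Longrightarrow> y = 0"
  shows "separated S Y"
proof -
  let ?P = "\<lambda>i L. finite L \<and> (\<forall>l\<in>L. linear_form (X i) l) \<and>
     (\<forall>w\<in>X i. (\<forall>l\<in>L. l w = 0) \<longrightarrow> ae_eq S w (\<lambda>x. 0))"
  define L where "L i = (SOME L. ?P i L)" for i
  have "?P i (L i)" if "i \<in> I" for i
    using X[OF that] unfolding separated_def L_def by (rule someI_ex)
  then have L: "\<And>i. i \<in> I \<Longrightarrow> finite (L i)" "\<And>i l. i \<in> I \<Longrightarrow> l \<in> L i \<Longrightarrow> linear_form (X i) l"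
    "\<And>i w. i \<in> I \<Longrightarrow> w \<in> X i \<Longrightarrow> (\<forall>l\<in>L i. l w = 0) \<Longrightarrow> ae_eq S w (\<lambda>x. 0)"
    by simp_all
  show ?thesis
    unfolding separated_def
  proof (intro exI conjI ballI impI)
    show "finite (\<Union>i\<in>I. (\<lambda>l w. l (\<lambda>x. \<pi> i (w x))) ` L i)" using I L(1) by blast
    show "linear_form Y l" if "l \<in> (\<Union>i\<in>I. (\<lambda>l w. l (\<lambda>x. \<pi> i (w x))) ` L i)" for l
      using that linear_form_compose[OF L(2) \<pi> Y] by auto
    fix w assume w: "w \<in> Y" and z: "\<forall>l\<in>(\<Union>i\<in>I. (\<lambda>l w. l (\<lambda>x. \<pi> i (w x))) ` L i). l w = 0"
    have "ae_eq S (\<lambda>x. \<pi> i (w x)) (\<lambda>x. 0)" if i: "i \<in> I" for i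
      by (rule L(3)[OF i Y[OF i w]]) (use z i in auto)
    then have "AE x in lebesgue_on S. \<forall>i\<in>I. \<pi> i (w x) = 0"
      by (intro eventually_ball_finite I ballI)
    then show "ae_eq S w (\<lambda>x. 0)"
      by (rule eventually_mono) (rule inj, simp)
  qed
qed

lemma ae_form_null: "ae_form S X F \<Longrightarrow> lin_closed X \<Longrightarrow> w \<in> X \<Longrightarrow> ae_eq S w (\<lambda>x. 0) \<Longrightarrow> F w = 0"
  using ae_formD(2)[of S X F w "\<lambda>x. 0"] linear_form_zero[OF ae_formD(1)[of S X F]] lin_closedD(1)[of X]
  by simp

text \<open>Definiteness is required from \<open>B w w \<le> 0\<close> because energy estimates
  deliver inequalities. Symmetry is not assumed, as convection destroys it.\<close>

theorem variational_solution_exists: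
  assumes X: "lin_closed X" "separated S X"
    and B1: "\<And>v. v \<in> X \<Longrightarrow> ae_form S X (\<lambda>u. B u v)" and B2: "\<And>u. u \<in> X \<Longrightarrow> ae_form S X (B u)"
    and def: "\<And>w. w \<in> X \<Longrightarrow> B w w \<le> 0 \<Longrightarrow> ae_eq S w (\<lambda>x. 0)"
    and F: "ae_form S X F"
  shows "\<exists>w\<in>X. \<forall>v\<in>X. B w v = F v"
proof -
  obtain L where L: "finite L" "\<forall>l\<in>L. linear_form X l" "\<forall>w\<in>X. (\<forall>l\<in>L. l w = 0) \<longrightarrow> ae_eq S w (\<lambda>x. 0)"
    using X(2) by (auto simp: separated_def)
  show ?thesis
  proof (rule finite_dim_variational_solution[OF L(1) X(1) L(2,3)])
    show "\<forall>v\<in>X. linear_form X (\<lambda>u. B u v)" "\<forall>u\<in>X. linear_form X (B u)" "linear_form X F"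
      using B1 B2 F ae_formD(1) by blast+
    show "\<forall>w\<in>X. B w w = 0 \<longrightarrow> ae_eq S w (\<lambda>x. 0)" using def by simp
    show "\<forall>w\<in>X. ae_eq S w (\<lambda>x. 0) \<longrightarrow> (\<forall>u\<in>X. B u w = 0)" "\<forall>w\<in>X. ae_eq S w (\<lambda>x. 0) \<longrightarrow> F w = 0"
      using ae_form_null[OF B2 X(1)] ae_form_null[OF F X(1)] by blast+
  qed
qed

theorem variational_solution_unique:
  assumes X: "lin_closed X"
    and B1: "\<And>v. v \<in> X \<Longrightarrow> ae_form S X (\<lambda>u. B u v)"
    and def: "\<And>w. w \<in> X \<Longrightarrow> B w w \<le> 0 \<Longrightarrow> ae_eq S w (\<lambda>x. 0)"
    and w: "w \<in> X" "w' \<in> X" "\<And>v. v \<in> X \<Longrightarrow> B w v = B w' v"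
  shows "ae_eq S w w'"
proof -
  let ?e = "\<lambda>x. w x + (-1) *\<^sub>R w' x"
  have e: "?e \<in> X" by (rule lin_closedD(2)[OF X w(1,2)])
  have "B ?e ?e = 0"
    using linear_formD[OF ae_formD(1)[OF B1[OF e]] w(1,2), of "-1"] w(3)[OF e] by simp
  then have "ae_eq S ?e (\<lambda>x. 0)" using def[OF e] by simp
  then show ?thesis by eventually_elim simp
qed

section \<open>Gradients\<close>

lemma axis_order1: "[axis j (1::real)] \<in> order1"
  by (rule order1(3)) simp

lemma L2_linear_grad:
  fixes S :: "(real ^ 'd) set"
  assumes "open S"
  shows "L2_linear S (H01 S) (grad S)"
proof -
  have Sm: "S \<in> sets lebesgue" using assms by auto
  have "L2_linear S (H01 S) (weak_deriv S [axis j 1])" for j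
    unfolding L2_linear_def
    using H1_weak_deriv(1)[OF assms H01_H1 axis_order1] weak_deriv_lin[OF assms H01_H1 H01_H1 axis_order1]
      weak_deriv_cong[OF Sm order1(4)[OF axis_order1]]
    by (intro conjI ballI allI impI) auto
  from L2_linear_vec[OF this] show ?thesis by (simp add: grad_def[abs_def])
qed

lemma grad_cong:
  fixes S :: "(real ^ 'd) set"
  assumes "open S" "ae_eq S f g"
  shows "grad S f = grad S g"
proof -
  have "S \<in> sets lebesgue" using assms by auto
  then have "weak_deriv S [axis j 1] f = weak_deriv S [axis j 1] g" for j
    by (rule weak_deriv_cong[OF _ order1(4)[OF axis_order1] assms(2)])
  then show ?thesis by (simp add: grad_def[abs_def])
qed

lemma H01_vec_component: "v \<in> H01_vec S \<Longrightarrow> (\<lambda>x. v x $ i) \<in> H01 S"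
  by (simp add: H01_vec_def)

lemma lin_closed_H01_vec:
  fixes S :: "(real ^ 'd) set"
  assumes "open S" "bounded S"
  shows "lin_closed (H01_vec S)"
  using lin_closedD[OF lin_closed_H01[OF assms]] unfolding lin_closed_def H01_vec_def by simp

lemma H01_subset_L2: "H01 S \<subseteq> fst (L2 S)"
  using H01_H1 H1_L2 by blast

lemma H01_vec_subset_L2: "H01_vec S \<subseteq> fst (L2 S)"
  using H01_subset_L2 by (auto intro!: L2_vec simp: H01_vec_def)

lemma L2_linear_grad_vec:
  fixes S :: "(real ^ 'd) set"
  assumes "open S"
  shows "L2_linear S (H01_vec S) (grad_vec S)"
proof -
  have "L2_linear S (H01_vec S) (\<lambda>v. grad S (\<lambda>x. v x $ i))" for i
    by (rule L2_linear_compose[OF L2_linear_grad[OF assms] _ H01_vec_component])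
       (rule bounded_linear.linear[OF bounded_linear_vec_nth])
  from L2_linear_vec[OF this] show ?thesis by (simp add: grad_vec_def[abs_def])
qed

lemma L2_linear_linear:
  fixes A :: "'c::euclidean_space \<Rightarrow> 'e::euclidean_space"
  assumes G: "L2_linear S X G" and A: "linear A"
  shows "L2_linear S X (\<lambda>f x. A (G f x))"
proof -
  have b: "bounded_linear A" using A by (rule linear_conv_bounded_linear[THEN iffD1])
  obtain C where "\<And>y. norm (A y) \<le> norm y * C" using bounded_linear.bounded[OF b] by blast
  then show ?thesis
    using A borel_measurable_continuous_on[OF linear_continuous_on[OF b]]
    by (intro L2_linear_pointwise[OF G, where C = C]) (auto simp: mult.commute)
qed

lemma L2_linear_strain:
  fixes S :: "(real ^ 'd) set"
  assumes "open S"
  shows "L2_linear S (H01_vec S) (strain S)"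
proof -
  have "linear (\<lambda>A :: real ^ 'd ^ 'd. (1 / 2) *\<^sub>R (A + transpose A))"
    by (rule linearI) (simp_all add: transpose_def vec_eq_iff algebra_simps)
  from L2_linear_linear[OF L2_linear_grad_vec[OF assms] this] show ?thesis
    by (simp add: strain_def[abs_def])
qed

lemma L2_linear_divergence:
  fixes S :: "(real ^ 'd) set"
  assumes "open S"
  shows "L2_linear S (H01_vec S) (divergence S)"
proof -
  have "linear (\<lambda>A :: real ^ 'd ^ 'd. \<Sum>i\<in>UNIV. A $ i $ i)"
    by (rule linearI) (simp_all add: sum.distrib sum_distrib_left)
  from L2_linear_linear[OF L2_linear_grad_vec[OF assms] this] show ?thesis
    by (simp add: divergence_def[abs_def])
qed

lemma H01_grad_zero:
  fixes S :: "(real ^ 'd) set"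
  assumes S: "open S" "bounded S" and q: "q \<in> H01 S" and z: "sq_int S (grad S q) \<le> 0"
  shows "ae_eq S q (\<lambda>x. 0)"
proof -
  \<comment> \<open>Index types are nonempty, and one coordinate direction suffices for
    \<open>H01_weak_deriv_zero\<close>.\<close>
  obtain j :: 'd where True by blast
  have "ae_eq S (grad S q) (\<lambda>x. 0)"
    by (rule sq_int_eq_0[OF L2_linearD(1)[OF L2_linear_grad[OF S(1)] q] z])
  then have "AE x in lebesgue_on S. weak_deriv S [axis j 1] q x = 0"
    by eventually_elim (simp add: grad_def vec_eq_iff)
  then show ?thesis by (intro H01_weak_deriv_zero[OF S q]) auto
qed

text \<open>The diagonal of the strain consists of the \<open>\<partial>\<^sub>i v\<^sub>i\<close>, and one directional derivative already
  controls a function in \<open>H\<^sup>1\<^sub>0\<close>, so Korn's inequality is not needed.\<close>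

lemma H01_vec_strain_zero:
  fixes S :: "(real ^ 'd) set"
  assumes S: "open S" "bounded S" and v: "v \<in> H01_vec S" and z: "sq_int S (strain S v) \<le> 0"
  shows "ae_eq S v (\<lambda>x. 0)"
proof -
  have str: "ae_eq S (strain S v) (\<lambda>x. 0)"
    by (rule sq_int_eq_0[OF L2_linearD(1)[OF L2_linear_strain[OF S(1)] v] z])
  have "AE x in lebesgue_on S. v x $ i = 0" for i
  proof (rule H01_weak_deriv_zero[OF S H01_vec_component[OF v]])
    show "axis i (1::real) \<in> Basis" by simp
    show "AE x in lebesgue_on S. weak_deriv S [axis i 1] (\<lambda>x. v x $ i) x = 0"
      using str
    proof eventually_elim
      fix x assume "strain S v x = 0"
      then have "strain S v x $ i $ i = 0" by simp
      then show "weak_deriv S [axis i 1] (\<lambda>x. v x $ i) x = 0"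
        by (simp add: strain_def grad_vec_def grad_def transpose_def)
    qed
  qed
  then have "AE x in lebesgue_on S. \<forall>i. v x $ i = 0" by (rule eventually_all_finite)
  then show ?thesis by eventually_elim (simp add: vec_eq_iff)
qed

section \<open>Piecewise polynomials\<close>

abbreviation exponents :: "nat \<Rightarrow> ('d::finite \<Rightarrow> nat) set" where
  "exponents k \<equiv> {e. (\<Sum>i\<in>UNIV. e i) \<le> k}"

definition monomial :: "('d::finite \<Rightarrow> nat) \<Rightarrow> real ^ 'd \<Rightarrow> real" where
  "monomial e x = (\<Prod>i\<in>UNIV. (x $ i) ^ e i)"

lemma finite_exponents: "finite (exponents k :: ('d::finite \<Rightarrow> nat) set)"
proof (rule finite_subset)
  show "exponents k \<subseteq> (UNIV :: 'd set) \<rightarrow>\<^sub>E {..k}"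
  proof
    fix e :: "'d \<Rightarrow> nat" assume "e \<in> exponents k"
    moreover have "e i \<le> (\<Sum>i\<in>UNIV. e i)" for i by (rule member_le_sum) auto
    ultimately show "e \<in> UNIV \<rightarrow>\<^sub>E {..k}" by (auto intro: order_trans)
  qed
  show "finite ((UNIV :: 'd set) \<rightarrow>\<^sub>E {..k})" by (intro finite_PiE) auto
qed

lemma continuous_monomial: "continuous_on A (monomial e)"
  unfolding monomial_def[abs_def] by (intro continuous_intros)

lemma polynomials_iff:
  "q \<in> polynomials k \<longleftrightarrow> (\<exists>c. \<forall>x. q x = (\<Sum>e\<in>exponents k. c e * monomial e x))"
  by (simp add: polynomials_def monomial_def)

lemma continuous_polynomial: "q \<in> polynomials k \<Longrightarrow> continuous_on A q"
proof -
  assume "q \<in> polynomials k"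
  then obtain c where "q = (\<lambda>x. \<Sum>e\<in>exponents k. c e * monomial e x)"
    by (auto simp: polynomials_iff)
  then show ?thesis by (auto intro!: continuous_intros continuous_monomial)
qed

lemma lin_closed_polynomials: "lin_closed (polynomials k :: (real ^ 'd \<Rightarrow> real) set)"
  unfolding lin_closed_def
proof (intro conjI ballI allI)
  show "(\<lambda>x. 0) \<in> (polynomials k :: (real ^ 'd \<Rightarrow> real) set)" unfolding polynomials_iff by (intro exI[of _ "\<lambda>_. 0"]) simp
  fix p q :: "real ^ 'd \<Rightarrow> real" and c assume "p \<in> polynomials k" "q \<in> polynomials k"
  then obtain a b where "\<And>x. p x = (\<Sum>e\<in>exponents k. a e * monomial e x)"
    "\<And>x. q x = (\<Sum>e\<in>exponents k. b e * monomial e x)" unfolding polynomials_iff by blast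
  then have "p x + c *\<^sub>R q x = (\<Sum>e\<in>exponents k. (a e + c * b e) * monomial e x)" for x
    by (simp add: sum.distrib sum_distrib_left algebra_simps)
  then show "(\<lambda>x. p x + c *\<^sub>R q x) \<in> polynomials k"
    unfolding polynomials_iff by (intro exI[of _ "\<lambda>e. a e + c * b e"] allI)
qed

lemma lin_closed_piecewise_poly: "lin_closed (piecewise_poly \<T> k)"
  unfolding lin_closed_def
proof (intro conjI ballI allI)
  show "(\<lambda>x. 0) \<in> piecewise_poly \<T> k"
    using lin_closedD(1)[OF lin_closed_polynomials] by (force simp: piecewise_poly_def)
  fix v w c assume vw: "v \<in> piecewise_poly \<T> k" "w \<in> piecewise_poly \<T> k"
  show "(\<lambda>x. v x + c *\<^sub>R w x) \<in> piecewise_poly \<T> k"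
    unfolding piecewise_poly_def
  proof (intro CollectI ballI)
    fix K assume "K \<in> \<T>"
    then obtain p q where pq: "p \<in> polynomials k" "q \<in> polynomials k" "ae_eq K v p" "ae_eq K w q"
      using vw unfolding piecewise_poly_def by blast
    have "ae_eq K (\<lambda>x. v x + c *\<^sub>R w x) (\<lambda>x. p x + c *\<^sub>R q x)"
      using pq(3,4) by eventually_elim simp
    then show "\<exists>q\<in>polynomials k. ae_eq K (\<lambda>x. v x + c *\<^sub>R w x) q"
      by (rule bexI[OF _ lin_closedD(2)[OF lin_closed_polynomials pq(1,2)]])
  qed
qed

lemma AE_cover:
  assumes "finite \<T>" "\<And>K. K \<in> \<T> \<Longrightarrow> K \<in> sets lebesgue" "S \<in> sets lebesgue" "S \<subseteq> \<Union>\<T>"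
    and "\<And>K. K \<in> \<T> \<Longrightarrow> AE x in lebesgue_on K. Q x"
  shows "AE x in lebesgue_on S. Q x"
proof -
  have "\<forall>K\<in>\<T>. AE x in lebesgue. x \<in> K \<longrightarrow> Q x"
    using assms(2,5) by (simp add: AE_restrict_space_iff)
  then have "AE x in lebesgue. \<forall>K\<in>\<T>. x \<in> K \<longrightarrow> Q x"
    by (rule eventually_ball_finite[OF assms(1)])
  then have "AE x in lebesgue. x \<in> S \<longrightarrow> Q x"
    by eventually_elim (use assms(4) in blast)
  then show ?thesis using assms(3) by (simp add: AE_restrict_space_iff)
qed

lemma continuous_integrable_lebesgue_on:
  fixes f :: "'a::euclidean_space \<Rightarrow> real"
  assumes "compact K" "continuous_on K f"
  shows "integrable (lebesgue_on K) f"
proof -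
  have "integrable lborel (\<lambda>x. indicator K x *\<^sub>R f x)"
    by (rule borel_integrable_compact[OF assms])
  then have "integrable lebesgue (\<lambda>x. indicator K x *\<^sub>R f x)"
    by (subst integrable_completion[OF borel_measurable_integrable]) simp_all
  then show ?thesis
    using assms(1) by (simp add: integrable_restrict_space set_integrable_def compact_imp_closed)
qed

text \<open>The functionals are the moments of \<open>w\<close> against monomials on each element.
  If they all vanish, \<open>w\<close> is orthogonal on \<open>K\<close> to its own polynomial
  \<open>q\<close>, so \<open>q\<close> squared has zero integral there. Neither nodal values nor a
  basis of the space are involved.\<close>

lemma separated_piecewise_poly:
  fixes S :: "(real ^ 'd) set"
  assumes T: "finite \<T>" "\<And>K. K \<in> \<T> \<Longrightarrow> compact K" and S: "S \<in> sets lebesgue" "S \<subseteq> \<Union>\<T>"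
  shows "separated S (piecewise_poly \<T> k)"
proof -
  have Km: "K \<in> sets lebesgue" if "K \<in> \<T>" for K
    using lmeasurable_compact[OF T(2)[OF that]] by auto
  define l where "l K e w = (LINT x|lebesgue_on K. w x * monomial e x)" for K e and w :: "real ^ 'd \<Rightarrow> real"
  \<comment> \<open>\<open>w\<close> agrees with a polynomial only almost everywhere on
    \<open>K\<close>, so integrability is taken over from \<open>q\<close>.\<close>
  have int: "integrable (lebesgue_on K) (\<lambda>x. w x * monomial e x)"
    if w: "w \<in> piecewise_poly \<T> k" and K: "K \<in> \<T>" for w e K
  proof -
    obtain q where q: "q \<in> polynomials k" "ae_eq K w q" using w K by (auto simp: piecewise_poly_def)
    have i: "integrable (lebesgue_on K) (\<lambda>x. q x * monomial e x)"
      by (intro continuous_integrable_lebesgue_on T(2) K continuous_intros continuous_polynomial[OF q(1)] continuous_monomial)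
    have ae: "AE x in lebesgue_on K. q x * monomial e x = w x * monomial e x"
      using q(2) by eventually_elim simp
    show ?thesis
      by (rule integrable_cong_AE_imp[OF i borel_measurable_lebesgue_on_AE[OF Km[OF K] borel_measurable_integrable[OF i] ae] ae])
  qed
  have lin: "linear_form (piecewise_poly \<T> k) (l K e)" if "K \<in> \<T>" for K e
    unfolding linear_form_def l_def using int[OF _ that]
    by (simp add: distrib_right mult.assoc)
  have null: "ae_eq S w (\<lambda>x. 0)"
    if w: "w \<in> piecewise_poly \<T> k" and z: "\<And>K e. K \<in> \<T> \<Longrightarrow> e \<in> exponents k \<Longrightarrow> l K e w = 0" for w
  proof (rule AE_cover[OF T(1) Km S])
    fix K assume K: "K \<in> \<T>"
    obtain q where q: "q \<in> polynomials k" "ae_eq K w q" using w K by (auto simp: piecewise_poly_def)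
    obtain c where c: "\<And>x. q x = (\<Sum>e\<in>exponents k. c e * monomial e x)"
      using q(1) unfolding polynomials_iff by blast
    have qq: "integrable (lebesgue_on K) (\<lambda>x. q x * q x)"
      by (intro continuous_integrable_lebesgue_on T(2) K continuous_intros continuous_polynomial[OF q(1)])
    have wq: "(\<lambda>x. w x * q x) = (\<lambda>x. \<Sum>e\<in>exponents k. c e * (w x * monomial e x))"
      by (simp add: c sum_distrib_left mult.left_commute)
    have wqi: "integrable (lebesgue_on K) (\<lambda>x. w x * q x)"
      unfolding wq by (intro Bochner_Integration.integrable_sum integrable_mult_right int w K)
    have "(LINT x|lebesgue_on K. q x * q x) = (LINT x|lebesgue_on K. w x * q x)"
      using borel_measurable_integrable[OF qq] borel_measurable_integrable[OF wqi] q(2)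
      by (intro integral_cong_AE) (auto elim: eventually_mono)
    also have "\<dots> = (\<Sum>e\<in>exponents k. c e * l K e w)"
      unfolding wq l_def
      by (subst Bochner_Integration.integral_sum) (auto intro!: integrable_mult_right int w K)
    also have "\<dots> = 0" using z[OF K] by simp
    finally have "AE x in lebesgue_on K. q x * q x = 0"
      using integral_nonneg_eq_0_iff_AE[OF qq] by simp
    then show "AE x in lebesgue_on K. w x = 0" using q(2) by eventually_elim simp
  qed
  show ?thesis
    unfolding separated_def
  proof (intro exI conjI ballI impI)
    show "finite ((\<lambda>(K, e). l K e) ` (\<T> \<times> exponents k))"
      using T(1) finite_exponents by blast
    show "linear_form (piecewise_poly \<T> k) l'" if "l' \<in> (\<lambda>(K, e). l K e) ` (\<T> \<times> exponents k)" for l'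
      using that lin by auto
    show "ae_eq S w (\<lambda>x. 0)" if "w \<in> piecewise_poly \<T> k" "\<forall>l'\<in>(\<lambda>(K, e). l K e) ` (\<T> \<times> exponents k). l' w = 0" for w
      using that by (intro null) auto
  qed
qed

text \<open>Polynomials are bounded on the compact elements, and there are finitely many of these.
  The bound makes the product of a discrete temperature with a merely square integrable velocity
  square integrable.\<close>

lemma piecewise_poly_bounded:
  fixes S :: "(real ^ 'd) set"
  assumes T: "finite \<T>" "\<And>K. K \<in> \<T> \<Longrightarrow> compact K" and S: "S \<in> sets lebesgue" "S \<subseteq> \<Union>\<T>"
    and w: "w \<in> piecewise_poly \<T> k"
  shows "\<exists>C. AE x in lebesgue_on S. \<bar>w x\<bar> \<le> C"
proof -
  have Km: "K \<in> sets lebesgue" if "K \<in> \<T>" for K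
    using lmeasurable_compact[OF T(2)[OF that]] by auto
  have "\<exists>C. AE x in lebesgue_on K. \<bar>w x\<bar> \<le> C" if K: "K \<in> \<T>" for K
  proof -
    obtain q where q: "q \<in> polynomials k" "ae_eq K w q" using w K by (auto simp: piecewise_poly_def)
    have "compact (q ` K)" by (rule compact_continuous_image[OF continuous_polynomial[OF q(1)] T(2)[OF K]])
    then obtain C where C: "\<And>x. x \<in> K \<Longrightarrow> \<bar>q x\<bar> \<le> C"
      by (metis bounded_iff compact_imp_bounded image_eqI real_norm_def)
    have "AE x in lebesgue_on K. x \<in> K" by (rule AE_I2) simp
    then have "AE x in lebesgue_on K. \<bar>w x\<bar> \<le> C" using q(2) by eventually_elim (simp add: C)
    then show ?thesis by blast
  qed
  then obtain C where C: "\<And>K. K \<in> \<T> \<Longrightarrow> AE x in lebesgue_on K. \<bar>w x\<bar> \<le> C K" by metis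
  have "AE x in lebesgue_on S. \<bar>w x\<bar> \<le> (\<Sum>K\<in>\<T>. \<bar>C K\<bar>)"
  proof (rule AE_cover[OF T(1) Km S])
    fix K assume K: "K \<in> \<T>"
    have "\<bar>C K\<bar> \<le> (\<Sum>K\<in>\<T>. \<bar>C K\<bar>)" by (rule member_le_sum[OF K _ T(1)]) simp
    then show "AE x in lebesgue_on K. \<bar>w x\<bar> \<le> (\<Sum>K\<in>\<T>. \<bar>C K\<bar>)"
      by (intro eventually_mono[OF C[OF K]]) linarith
  qed
  then show ?thesis by blast
qed

section \<open>The discrete problem\<close>

lemma admissible_L2_linear:
  fixes A :: "real ^ 'd \<Rightarrow> real ^ 'd ^ 'd"
  assumes A: "admissible_tensor S A m M" and G: "L2_linear S X G"
  shows "L2_linear S X (\<lambda>f x. A x *v G f x)"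
proof (rule L2_linear_pointwise[OF G])
  show "linear ((*v) (A x))" for x by (rule matrix_vector_mul_linear)
  show "norm (A x *v y) \<le> M * norm y" if "x \<in> S" for x y
    using A that by (simp add: admissible_tensor_def)
  fix g :: "real ^ 'd \<Rightarrow> real ^ 'd" assume g: "g \<in> borel_measurable (lebesgue_on S)"
  have "A \<in> borel_measurable (lebesgue_on S)" using A by (simp add: admissible_tensor_def)
  then have "(\<lambda>x. \<Sum>j\<in>UNIV. A x $ i $ j * g x $ j) \<in> borel_measurable (lebesgue_on S)" for i
    by (intro borel_measurable_sum borel_measurable_times borel_measurable_vec_nth g)
  then show "(\<lambda>x. A x *v g x) \<in> borel_measurable (lebesgue_on S)"
    by (intro borel_measurable_vec) (simp add: matrix_vector_mult_def)
qed

lemma admissible_coercive: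
  fixes A :: "real ^ 'd \<Rightarrow> real ^ 'd ^ 'd"
  assumes A: "admissible_tensor S A m M" and f: "f \<in> fst (L2 S)" and Af: "(\<lambda>x. A x *v f x) \<in> fst (L2 S)"
  shows "m * sq_int S f \<le> L2_inner S (\<lambda>x. A x *v f x) f"
proof -
  have "m * sq_int S f = (LINT x|lebesgue_on S. m * (norm (f x))\<^sup>2)" by (simp add: sq_int_def)
  also have "\<dots> \<le> (LINT x|lebesgue_on S. (A x *v f x) \<bullet> f x)"
    using A by (intro integral_mono integrable_mult_right L2_square_integrable f L2_prod_integrable Af)
      (simp add: admissible_tensor_def inner_commute)
  finally show ?thesis by (simp add: L2_inner_def)
qed

text \<open>Shifts the field onto the test function: linearity in \<open>T\<close> then rests on the
  gradient, linearity in \<open>s\<close> on multiplication by \<open>w\<close>.\<close>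

lemma convection_eq: "convection P w T s = L2_inner (Omega P) (grad (Omega P) T) (\<lambda>x. s x *\<^sub>R w x)"
  by (simp add: convection_def L2_inner_def inner_commute mult.commute)

lemma norm_cutoff_le: "0 < M \<Longrightarrow> norm (cutoff M z x) \<le> M"
  by (simp add: cutoff_def)

lemma borel_measurable_cutoff:
  fixes z :: "'a \<Rightarrow> 'b::euclidean_space"
  assumes [measurable]: "z \<in> borel_measurable N"
  shows "cutoff M z \<in> borel_measurable N"
  unfolding cutoff_def[abs_def] by measurable

lemma ae_form_minus: "ae_form S X F \<Longrightarrow> f \<in> X \<Longrightarrow> g \<in> X \<Longrightarrow> F (\<lambda>x. f x - g x) = F f - F g"
  using ae_form_lin[of S X F f g "-1"] by simp

text \<open>\<open>H\<close> contains the projected function, \<open>X\<close> is the discrete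
  space. The first slot must be a form on \<open>H\<close> to accept \<open>w - r\<close>, whereas
  the second slot is only ever used on \<open>X\<close>.\<close>

lemma galerkin_projection:
  fixes B :: "('a::euclidean_space \<Rightarrow> 'b::real_vector) \<Rightarrow> ('a \<Rightarrow> 'b) \<Rightarrow> real"
  assumes XH: "X \<subseteq> H" and X: "lin_closed X" "separated S X"
    and B1: "\<And>v. v \<in> X \<Longrightarrow> ae_form S H (\<lambda>u. B u v)" and B2: "\<And>u. u \<in> H \<Longrightarrow> ae_form S X (B u)"
    and def: "\<And>w. w \<in> X \<Longrightarrow> B w w \<le> 0 \<Longrightarrow> ae_eq S w (\<lambda>x. 0)"
    and w: "w \<in> H"
  shows "\<exists>r\<in>X. \<forall>v\<in>X. B (\<lambda>x. w x - r x) v = 0"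
    and "r \<in> X \<Longrightarrow> r' \<in> X \<Longrightarrow> \<forall>v\<in>X. B (\<lambda>x. w x - r x) v = 0 \<Longrightarrow>
      \<forall>v\<in>X. B (\<lambda>x. w x - r' x) v = 0 \<Longrightarrow> ae_eq S r r'"
proof -
  have eq: "B (\<lambda>x. w x - r x) v = B w v - B r v" if "r \<in> X" "v \<in> X" for r v
    by (rule ae_form_minus[OF B1[OF that(2)] w subsetD[OF XH that(1)]])
  have B1X: "ae_form S X (\<lambda>u. B u v)" if "v \<in> X" for v
    by (rule ae_form_subset[OF B1[OF that] XH])
  have "\<exists>r\<in>X. \<forall>v\<in>X. B r v = B w v"
    by (rule variational_solution_exists[OF X B1X B2[OF subsetD[OF XH]] def B2[OF w]])
  then show "\<exists>r\<in>X. \<forall>v\<in>X. B (\<lambda>x. w x - r x) v = 0" using eq by fastforce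
  assume r: "r \<in> X" "r' \<in> X" "\<forall>v\<in>X. B (\<lambda>x. w x - r x) v = 0" "\<forall>v\<in>X. B (\<lambda>x. w x - r' x) v = 0"
  have "B r v = B r' v" if "v \<in> X" for v
    using eq[OF r(1) that] eq[OF r(2) that] r(3,4) that by simp
  from variational_solution_unique[OF X(1) B1X def r(1,2) this] show "ae_eq S r r'" .
qed

text \<open>Collects the hypotheses in the form in which the discrete arguments consume them: the
  polyhedral domain as a bounded open set, the triangulation as a finite cover by compact
  elements.\<close>

locale discrete_problem =
  fixes P :: "('d::finite) tpe_problem" and D :: "'d discretization" and k_m k_M \<theta>_m \<theta>_M :: real
  assumes Om: "open (Omega P)" "bounded (Omega P)"
    and K: "admissible_tensor (Omega P) (K_ten P) k_m k_M"
    and Th: "admissible_tensor (Omega P) (\<Theta>_ten P) \<theta>_m \<theta>_M"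
    and mesh: "finite (mesh D)" "\<And>K. K \<in> mesh D \<Longrightarrow> compact K" "Omega P \<subseteq> \<Union>(mesh D)"
    and tau: "tau P D > 0" and cut: "cut_M D > 0" and stab: "stab_\<gamma> D > 0"
    and coeffs: "a\<^sub>0 P > 0" "b\<^sub>0 P > 0" "c\<^sub>0 P > 0" "lame_mu P > 0" "lame_lambda P > 0"
    and storage: "c\<^sub>0 P - 2 * b\<^sub>0 P > 0" "a\<^sub>0 P - 2 * b\<^sub>0 P \<ge> 0"
    and time_step: "tau P D \<le> 2 * \<theta>_m * a\<^sub>0 P / (cut_M D)\<^sup>2"
begin

abbreviation "\<Omega> \<equiv> Omega P"
abbreviation "\<tau> \<equiv> tau P D"

lemma Om_sets: "\<Omega> \<in> sets lebesgue" using Om by auto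

lemma spaces_subset: "V_h P D \<subseteq> H01_vec \<Omega>" "Q_h P D \<subseteq> H01 \<Omega>" "S_h P D \<subseteq> H01 \<Omega>"
  by (auto simp: V_h_def Q_h_def S_h_def)

lemma spaces_L2: "v \<in> V_h P D \<Longrightarrow> v \<in> fst (L2 \<Omega>)" "q \<in> Q_h P D \<Longrightarrow> q \<in> fst (L2 \<Omega>)"
  "s \<in> S_h P D \<Longrightarrow> s \<in> fst (L2 \<Omega>)"
  using spaces_subset H01_subset_L2 H01_vec_subset_L2 by blast+

lemma spaces_lin_closed: "lin_closed (V_h P D)" "lin_closed (Q_h P D)" "lin_closed (S_h P D)"
proof -
  note V = lin_closedD[OF lin_closed_H01_vec[OF Om]] and Q = lin_closedD[OF lin_closed_H01[OF Om]]
    and pp = lin_closedD[OF lin_closed_piecewise_poly[of "mesh D"]]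
  show "lin_closed (V_h P D)"
    unfolding lin_closed_def V_h_def using V pp by simp
  show "lin_closed (Q_h P D)" "lin_closed (S_h P D)"
    unfolding lin_closed_def Q_h_def S_h_def using Q pp by simp_all
qed

lemma spaces_separated: "separated \<Omega> (V_h P D)" "separated \<Omega> (Q_h P D)" "separated \<Omega> (S_h P D)"
proof -
  have pp: "separated \<Omega> (piecewise_poly (mesh D) k)" for k
    by (rule separated_piecewise_poly[OF mesh(1,2) Om_sets mesh(3)])
  then show "separated \<Omega> (Q_h P D)" "separated \<Omega> (S_h P D)"
    by (auto intro: separated_subset simp: Q_h_def S_h_def)
  show "separated \<Omega> (V_h P D)"
  proof (rule separated_projections[where I = UNIV and \<pi> = "\<lambda>i v. v $ i"])
    show "separated \<Omega> (piecewise_poly (mesh D) (deg_u D))" by (rule pp)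
    show "linear (\<lambda>v :: real ^ 'd. v $ i)" for i
      by (rule bounded_linear.linear[OF bounded_linear_vec_nth])
  qed (auto simp: V_h_def vec_eq_iff)
qed

section \<open>Linearity of the forms in each argument, and the energy estimate with
  convection\<close>

lemma grad_linear: "L2_linear \<Omega> (H01 \<Omega>) (grad \<Omega>)"
  by (rule L2_linear_grad[OF Om(1)])

lemma lc: "lin_closed (H01 \<Omega>)" "lin_closed (H01_vec \<Omega>)"
  by (rule lin_closed_H01[OF Om] lin_closed_H01_vec[OF Om])+

lemma a_form_ae:
  assumes "v \<in> H01_vec \<Omega>"
  shows "ae_form \<Omega> (H01_vec \<Omega>) (\<lambda>u. a_form P u v)" "ae_form \<Omega> (H01_vec \<Omega>) (a_form P v)"
proof -
  note st = L2_linear_strain[OF Om(1)] and dv = L2_linear_divergence[OF Om(1)]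
  show "ae_form \<Omega> (H01_vec \<Omega>) (\<lambda>u. a_form P u v)"
    unfolding a_form_def
    by (intro ae_form_intros ae_form_L2_inner(1) st dv lc L2_linearD(1)[OF st] L2_linearD(1)[OF dv] assms)
  show "ae_form \<Omega> (H01_vec \<Omega>) (a_form P v)"
    unfolding a_form_def[abs_def]
    by (intro ae_form_intros ae_form_L2_inner(2) st dv lc L2_linearD(1)[OF st] L2_linearD(1)[OF dv] assms)
qed

lemma a_form_self: "a_form P u u = 2 * lame_mu P * sq_int \<Omega> (strain \<Omega> u) + lame_lambda P * sq_int \<Omega> (divergence \<Omega> u)"
  by (simp add: a_form_def L2_inner_self)

lemma a_form_nonneg: "0 \<le> a_form P u u"
  using coeffs by (simp add: a_form_self sq_int_nonneg)

lemma a_form_definite: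
  assumes "u \<in> H01_vec \<Omega>" "a_form P u u \<le> 0"
  shows "ae_eq \<Omega> u (\<lambda>x. 0)"
proof (rule H01_vec_strain_zero[OF Om assms(1)])
  have "0 \<le> lame_lambda P * sq_int \<Omega> (divergence \<Omega> u)"
    using coeffs by (simp add: sq_int_nonneg)
  then have "lame_mu P * sq_int \<Omega> (strain \<Omega> u) \<le> 0" using assms(2) unfolding a_form_self by linarith
  then show "sq_int \<Omega> (strain \<Omega> u) \<le> 0" using coeffs by (simp add: mult_le_0_iff)
qed

lemma b_form_ae:
  "v \<in> fst (L2 \<Omega>) \<Longrightarrow> ae_form \<Omega> (H01 \<Omega>) (\<lambda>q. b_form P q v)"
  "q \<in> H01 \<Omega> \<Longrightarrow> ae_form \<Omega> (H01_vec \<Omega>) (b_form P q)"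
  unfolding b_form_def[abs_def]
  by (intro ae_form_L2_inner(1) grad_linear lc, assumption)
     (intro ae_form_L2_inner(2) L2_linear_id H01_vec_subset_L2 lc L2_linearD(1)[OF grad_linear])

lemma cp_form_ae:
  "q \<in> H01 \<Omega> \<Longrightarrow> ae_form \<Omega> (H01 \<Omega>) (\<lambda>p. cp_form P p q)"
  "q \<in> H01 \<Omega> \<Longrightarrow> ae_form \<Omega> (H01 \<Omega>) (cp_form P q)"
  unfolding cp_form_def[abs_def]
  by (intro ae_form_L2_inner(1) admissible_L2_linear[OF K] grad_linear lc L2_linearD(1)[OF grad_linear], assumption)
     (intro ae_form_L2_inner(2) grad_linear lc L2_linearD(1)[OF admissible_L2_linear[OF K grad_linear]])

lemma cT_form_ae:
  "q \<in> H01 \<Omega> \<Longrightarrow> ae_form \<Omega> (H01 \<Omega>) (\<lambda>p. cT_form P p q)"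
  "q \<in> H01 \<Omega> \<Longrightarrow> ae_form \<Omega> (H01 \<Omega>) (cT_form P q)"
  unfolding cT_form_def[abs_def]
  by (intro ae_form_L2_inner(1) admissible_L2_linear[OF Th] grad_linear lc L2_linearD(1)[OF grad_linear], assumption)
     (intro ae_form_L2_inner(2) grad_linear lc L2_linearD(1)[OF admissible_L2_linear[OF Th grad_linear]])

lemma mass_ae:
  "h \<in> fst (L2 \<Omega>) \<Longrightarrow> ae_form \<Omega> (H01 \<Omega>) (\<lambda>q. L2_inner \<Omega> q h)"
  "h \<in> fst (L2 \<Omega>) \<Longrightarrow> ae_form \<Omega> (H01 \<Omega>) (L2_inner \<Omega> h)"
  "k \<in> fst (L2 \<Omega>) \<Longrightarrow> ae_form \<Omega> (H01_vec \<Omega>) (\<lambda>q. L2_inner \<Omega> q k)"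
  "k \<in> fst (L2 \<Omega>) \<Longrightarrow> ae_form \<Omega> (H01_vec \<Omega>) (L2_inner \<Omega> k)"
  using ae_form_L2_inner[OF L2_linear_id[OF H01_subset_L2] _ lc(1)]
    ae_form_L2_inner[OF L2_linear_id[OF H01_vec_subset_L2] _ lc(2)] by blast+

lemma convection_ae_left:
  "(\<lambda>x. s x *\<^sub>R w x) \<in> fst (L2 \<Omega>) \<Longrightarrow> ae_form \<Omega> (H01 \<Omega>) (\<lambda>T. convection P w T s)"
  unfolding convection_eq by (intro ae_form_L2_inner(1) grad_linear lc)

lemma convection_ae_right:
  "L2_linear \<Omega> X (\<lambda>s x. s x *\<^sub>R w x) \<Longrightarrow> lin_closed X \<Longrightarrow> T \<in> H01 \<Omega> \<Longrightarrow> ae_form \<Omega> X (convection P w T)"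
  unfolding convection_eq[abs_def] by (intro ae_form_L2_inner(2) L2_linearD(1)[OF grad_linear])

definition cut_field :: "(real ^ 'd \<Rightarrow> real) \<Rightarrow> real ^ 'd \<Rightarrow> real ^ 'd" where
  "cut_field p = cutoff (cut_M D) (darcy P p)"

lemma darcy_L2: "p \<in> H01 \<Omega> \<Longrightarrow> darcy P p \<in> fst (L2 \<Omega>)"
  unfolding darcy_def[abs_def] by (rule L2_linearD(1)[OF admissible_L2_linear[OF K grad_linear]])

lemma cut_field: "p \<in> H01 \<Omega> \<Longrightarrow> cut_field p \<in> borel_measurable (lebesgue_on \<Omega>)"
  "norm (cut_field p x) \<le> cut_M D"
  unfolding cut_field_def
  by (rule borel_measurable_cutoff[OF L2_measurable[OF darcy_L2]], assumption)
     (rule norm_cutoff_le[OF cut])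

lemma cut_field_cong: "ae_eq \<Omega> p p' \<Longrightarrow> cut_field p = cut_field p'"
  using grad_cong[OF Om(1), of p p'] by (simp add: cut_field_def darcy_def[abs_def])

text \<open>The cut-off bounds the field, so multiplication by it maps all of \<open>H01\<close>
  into \<open>L2\<close>. The uncut velocity in \<open>RT_form\<close> is handled on the bounded
  discrete functions instead.\<close>

lemma cut_field_linear:
  assumes "p \<in> H01 \<Omega>"
  shows "L2_linear \<Omega> (H01 \<Omega>) (\<lambda>s x. s x *\<^sub>R cut_field p x)"
proof (rule L2_linear_pointwise[OF L2_linear_id[OF H01_subset_L2], where C = "cut_M D"])
  show "linear (\<lambda>y :: real. y *\<^sub>R cut_field p x)" for x by (rule linearI) (simp_all add: algebra_simps)
  show "norm (y *\<^sub>R cut_field p x) \<le> cut_M D * norm y" for x and y :: real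
    using mult_right_mono[OF cut_field(2)[of p x] abs_ge_zero[of y]] by (simp add: mult.commute)
qed (use cut_field(1)[OF assms] in \<open>intro borel_measurable_scaleR\<close>)

lemma cut_convection_ae:
  assumes "p \<in> H01 \<Omega>" "T \<in> H01 \<Omega>"
  shows "ae_form \<Omega> (H01 \<Omega>) (\<lambda>T'. convection P (cut_field p) T' T)" "ae_form \<Omega> (H01 \<Omega>) (convection P (cut_field p) T)"
  using assms
  by (auto intro!: convection_ae_left convection_ae_right L2_linearD(1)[OF cut_field_linear] cut_field_linear lc)

text \<open>The smallness of the time step absorbs the convection into diffusion and half of the mass term.\<close>

lemma diffusion_convection_ge:
  assumes p: "p \<in> H01 \<Omega>" and T: "T \<in> H01 \<Omega>"
  shows "\<tau> * cT_form P T T - \<tau> * convection P (cut_field p) T T \<ge> - (a\<^sub>0 P / 2) * sq_int \<Omega> T"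
proof -
  let ?g = "grad \<Omega> T"
  have \<theta>: "\<theta>_m > 0" using Th by (simp add: admissible_tensor_def)
  note g = L2_linearD(1)[OF grad_linear T] and sw = L2_linearD(1)[OF cut_field_linear[OF p] T]
  have TL: "T \<in> fst (L2 \<Omega>)" using T H01_subset_L2 by blast
  have "convection P (cut_field p) T T \<le>
      (LINT x|lebesgue_on \<Omega>. \<theta>_m * (norm (?g x))\<^sup>2 + (cut_M D)\<^sup>2 / (4 * \<theta>_m) * (norm (T x))\<^sup>2)"
    unfolding convection_eq L2_inner_def
  proof (rule integral_mono)
    fix x
    have "?g x \<bullet> (T x *\<^sub>R cut_field p x) \<le> norm (?g x) * norm (T x *\<^sub>R cut_field p x)"
      by (rule norm_cauchy_schwarz)
    also have "\<dots> \<le> norm (?g x) * (\<bar>T x\<bar> * cut_M D)"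
      by (intro mult_left_mono) (simp_all add: mult_left_mono cut_field(2))
    also have "\<dots> \<le> \<theta>_m * (norm (?g x))\<^sup>2 + (cut_M D)\<^sup>2 / (4 * \<theta>_m) * (norm (T x))\<^sup>2"
    proof -
      \<comment> \<open>Dividing the square by \<open>4 * \<theta>_m\<close> normalizes the cross
        term to coefficient 1; this fixes the weight
        \<open>(cut_M D)\<^sup>2 / (4 * \<theta>_m)\<close> of the mass term.\<close>
      have "0 \<le> (2 * \<theta>_m * norm (?g x) - \<bar>T x\<bar> * cut_M D)\<^sup>2 / (4 * \<theta>_m)" using \<theta> by simp
      also have "\<dots> = \<theta>_m * (norm (?g x))\<^sup>2 + (cut_M D)\<^sup>2 / (4 * \<theta>_m) * (norm (T x))\<^sup>2 - norm (?g x) * (\<bar>T x\<bar> * cut_M D)"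
        using \<theta> by (simp add: power2_diff power_mult_distrib field_simps) (simp add: power2_eq_square)
      finally show ?thesis by simp
    qed
    finally show "?g x \<bullet> (T x *\<^sub>R cut_field p x) \<le> \<theta>_m * (norm (?g x))\<^sup>2 + (cut_M D)\<^sup>2 / (4 * \<theta>_m) * (norm (T x))\<^sup>2" .
  qed (intro L2_prod_integrable g sw Bochner_Integration.integrable_add integrable_mult_right L2_square_integrable TL)+
  also have "\<dots> = \<theta>_m * sq_int \<Omega> ?g + (cut_M D)\<^sup>2 / (4 * \<theta>_m) * sq_int \<Omega> T"
    using L2_square_integrable[OF g] L2_square_integrable[OF TL] by (simp add: sq_int_def)
  also have "\<dots> \<le> cT_form P T T + (cut_M D)\<^sup>2 / (4 * \<theta>_m) * sq_int \<Omega> T"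
    using admissible_coercive[OF Th g L2_linearD(1)[OF admissible_L2_linear[OF Th grad_linear] T]]
    by (simp add: cT_form_def)
  finally have "\<tau> * convection P (cut_field p) T T \<le> \<tau> * (cT_form P T T + (cut_M D)\<^sup>2 / (4 * \<theta>_m) * sq_int \<Omega> T)"
    using tau by (intro mult_left_mono) auto
  moreover have "\<tau> * ((cut_M D)\<^sup>2 / (4 * \<theta>_m)) \<le> a\<^sub>0 P / 2"
    using time_step \<theta> cut by (simp add: field_simps)
  then have "\<tau> * ((cut_M D)\<^sup>2 / (4 * \<theta>_m)) * sq_int \<Omega> T \<le> a\<^sub>0 P / 2 * sq_int \<Omega> T"
    by (intro mult_right_mono sq_int_nonneg)
  ultimately show ?thesis by (simp add: algebra_simps)
qed

lemma cp_form_ge: "q \<in> H01 \<Omega> \<Longrightarrow> k_m * sq_int \<Omega> (grad \<Omega> q) \<le> cp_form P q q"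
  unfolding cp_form_def
  by (rule admissible_coercive[OF K L2_linearD(1)[OF grad_linear] L2_linearD(1)[OF admissible_L2_linear[OF K grad_linear]]])

lemma k_m_pos: "k_m > 0" using K by (simp add: admissible_tensor_def)

lemma cp_form_nonneg: "q \<in> H01 \<Omega> \<Longrightarrow> 0 \<le> cp_form P q q"
  using cp_form_ge[of q] k_m_pos mult_nonneg_nonneg[of k_m "sq_int \<Omega> (grad \<Omega> q)"] sq_int_nonneg[of \<Omega> "grad \<Omega> q"]
  by linarith

lemma H01_mass_definite:
  assumes "q \<in> H01 \<Omega>" "c > 0" "c * sq_int \<Omega> q \<le> 0"
  shows "ae_eq \<Omega> q (\<lambda>x. 0)"
  using assms H01_subset_L2 by (intro sq_int_eq_0) (auto simp: mult_le_0_iff)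

section \<open>Projections\<close>

lemma Ru_exists_unique:
  assumes w: "w \<in> H01_vec \<Omega>"
  shows "\<exists>r. is_Ru P D w r" "is_Ru P D w r \<Longrightarrow> is_Ru P D w r' \<Longrightarrow> ae_eq \<Omega> r r'"
proof -
  have "ae_form \<Omega> (H01_vec \<Omega>) (\<lambda>u. a_form P u v)" if "v \<in> V_h P D" for v
    using that spaces_subset(1) a_form_ae by blast
  note proj = galerkin_projection[OF spaces_subset(1) spaces_lin_closed(1) spaces_separated(1) this
      ae_form_subset[OF a_form_ae(2) spaces_subset(1)] a_form_definite[OF subsetD[OF spaces_subset(1)]] w]
  show "\<exists>r. is_Ru P D w r" using proj(1) unfolding is_Ru_def Bex_def .
  show "is_Ru P D w r \<Longrightarrow> is_Ru P D w r' \<Longrightarrow> ae_eq \<Omega> r r'"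
    using proj(2)[of r r'] unfolding is_Ru_def by blast
qed

lemma cp_form_definite:
  assumes "q \<in> H01 \<Omega>" "cp_form P q q \<le> 0"
  shows "ae_eq \<Omega> q (\<lambda>x. 0)"
proof (rule H01_grad_zero[OF Om assms(1)])
  have "k_m * sq_int \<Omega> (grad \<Omega> q) \<le> 0" using cp_form_ge[OF assms(1)] assms(2) by simp
  then show "sq_int \<Omega> (grad \<Omega> q) \<le> 0" using k_m_pos by (simp add: mult_le_0_iff)
qed

lemma Rp_exists_unique:
  assumes w: "w \<in> H01 \<Omega>"
  shows "\<exists>r. is_Rp P D w r" "is_Rp P D w r \<Longrightarrow> is_Rp P D w r' \<Longrightarrow> ae_eq \<Omega> r r'"
proof -
  have "ae_form \<Omega> (H01 \<Omega>) (\<lambda>u. cp_form P u v)" if "v \<in> Q_h P D" for v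
    using that spaces_subset(2) cp_form_ae by blast
  note proj = galerkin_projection[OF spaces_subset(2) spaces_lin_closed(2) spaces_separated(2) this
      ae_form_subset[OF cp_form_ae(2) spaces_subset(2)] cp_form_definite[OF subsetD[OF spaces_subset(2)]] w]
  show "\<exists>r. is_Rp P D w r" using proj(1) unfolding is_Rp_def Bex_def .
  show "is_Rp P D w r \<Longrightarrow> is_Rp P D w r' \<Longrightarrow> ae_eq \<Omega> r r'"
    using proj(2)[of r r'] unfolding is_Rp_def by blast
qed

text \<open>The Darcy velocity of the initial pressure is only square integrable, so the convection form
  is linear on \<open>S_h\<close> because discrete functions are bounded.\<close>

lemma S_h_velocity_linear:
  assumes w: "w \<in> fst (L2 \<Omega>)"
  shows "L2_linear \<Omega> (S_h P D) (\<lambda>s x. s x *\<^sub>R w x)"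
  unfolding L2_linear_def
proof (intro conjI ballI allI impI)
  fix s assume s: "s \<in> S_h P D"
  then have pp: "s \<in> piecewise_poly (mesh D) (deg_T D)" by (simp add: S_h_def)
  obtain C where C: "AE x in lebesgue_on \<Omega>. \<bar>s x\<bar> \<le> C"
    using piecewise_poly_bounded[OF mesh(1,2) Om_sets mesh(3) pp] by blast
  show "(\<lambda>x. s x *\<^sub>R w x) \<in> fst (L2 \<Omega>)"
  proof (rule L2_dominated[OF w])
    show "(\<lambda>x. s x *\<^sub>R w x) \<in> borel_measurable (lebesgue_on \<Omega>)"
      by (intro borel_measurable_scaleR L2_measurable w spaces_L2(3) s)
    show "AE x in lebesgue_on \<Omega>. norm (s x *\<^sub>R w x) \<le> C * norm (w x)"
      using C by eventually_elim (simp add: mult_right_mono)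
  qed
next
  fix s r c
  show "ae_eq \<Omega> (\<lambda>x. (s x + c *\<^sub>R r x) *\<^sub>R w x) (\<lambda>x. s x *\<^sub>R w x + c *\<^sub>R r x *\<^sub>R w x)"
    by (rule AE_I2) (simp add: scaleR_add_left)
  show "ae_eq \<Omega> s r \<Longrightarrow> ae_eq \<Omega> (\<lambda>x. s x *\<^sub>R w x) (\<lambda>x. r x *\<^sub>R w x)"
    by (erule eventually_mono) simp
qed

text \<open>The two slots live on different spaces: the first must accept a difference with the
  initial temperature, which is only in \<open>H01\<close>, whereas the test function must be
  bounded.\<close>

lemma RT_form_ae:
  assumes p: "p \<in> H01 \<Omega>"
  shows "s \<in> S_h P D \<Longrightarrow> ae_form \<Omega> (H01 \<Omega>) (\<lambda>w. RT_form P \<delta> p w s)"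
    and "w \<in> H01 \<Omega> \<Longrightarrow> ae_form \<Omega> (S_h P D) (RT_form P \<delta> p w)"
proof -
  note v = S_h_velocity_linear[OF darcy_L2[OF p]]
  show "ae_form \<Omega> (H01 \<Omega>) (\<lambda>w. RT_form P \<delta> p w s)" if s: "s \<in> S_h P D"
    unfolding RT_form_def using s spaces_subset(3)
    by (intro ae_form_intros cT_form_ae convection_ae_left L2_linearD(1)[OF v] mass_ae spaces_L2) auto
  show "ae_form \<Omega> (S_h P D) (RT_form P \<delta> p w)" if w: "w \<in> H01 \<Omega>"
    unfolding RT_form_def[abs_def] using H01_subset_L2
    by (intro ae_form_intros ae_form_subset[OF cT_form_ae(2)] ae_form_subset[OF mass_ae(2)]
        convection_ae_right v spaces_lin_closed spaces_subset) (use w in auto)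
qed

text \<open>Coercivity controls the full \<open>H1\<close> norm. Its summand for the empty list of
  directions is the squared \<open>L2\<close> norm of \<open>w\<close>, since
  \<open>weak_deriv \<Omega> [] w\<close> agrees with \<open>w\<close> almost everywhere.\<close>

lemma RT_form_definite:
  assumes coer: "RT_coercive P \<delta> p" and w: "w \<in> H01 \<Omega>" "RT_form P \<delta> p w w \<le> 0"
  shows "ae_eq \<Omega> w (\<lambda>x. 0)"
proof -
  obtain c where c: "c > 0" "c * (snd (Hk \<Omega> 1) w)\<^sup>2 \<le> RT_form P \<delta> p w w"
    using coer w(1) by (auto simp: RT_coercive_def)
  then have "c * (snd (Hk \<Omega> 1) w)\<^sup>2 \<le> 0" using w(2) by linarith
  then have "(\<Sum>bs\<in>order1. sq_int \<Omega> (weak_deriv \<Omega> bs w)) \<le> 0"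
    using c(1) unfolding H1_norm_square by (simp only: mult_le_0_iff) auto
  moreover have "sq_int \<Omega> (weak_deriv \<Omega> [] w) \<le> (\<Sum>bs\<in>order1. sq_int \<Omega> (weak_deriv \<Omega> bs w))"
    by (rule member_le_sum[OF order1(2) sq_int_nonneg order1(1)])
  ultimately have "sq_int \<Omega> (weak_deriv \<Omega> [] w) \<le> 0" by linarith
  then have z: "ae_eq \<Omega> (weak_deriv \<Omega> [] w) (\<lambda>x. 0)"
    by (rule sq_int_eq_0[OF H1_weak_deriv(1)[OF Om(1) H01_H1[OF w(1)] order1(2)]])
  have "ae_eq \<Omega> (weak_deriv \<Omega> [] w) w"
    by (rule weak_deriv_eq[OF Om(1) _ has_weak_deriv_Nil[OF L2_locally_integrable[OF Om_sets H1_L2[OF H01_H1[OF w(1)]]]]]) simp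
  with z show ?thesis by eventually_elim simp
qed

lemma RT_exists_unique:
  assumes p: "p \<in> H01 \<Omega>" and coer: "RT_coercive P (shift_\<delta> D) p" and w: "w \<in> H01 \<Omega>"
  shows "\<exists>r. is_RT P D p w r" "is_RT P D p w r \<Longrightarrow> is_RT P D p w r' \<Longrightarrow> ae_eq \<Omega> r r'"
proof -
  note proj = galerkin_projection[OF spaces_subset(3) spaces_lin_closed(3) spaces_separated(3) RT_form_ae(1)[OF p, where \<delta> = "shift_\<delta> D"]
      RT_form_ae(2)[OF p] RT_form_definite[OF coer subsetD[OF spaces_subset(3)]] w]
  show "\<exists>r. is_RT P D p w r" using proj(1) unfolding is_RT_def Bex_def .
  show "is_RT P D p w r \<Longrightarrow> is_RT P D p w r' \<Longrightarrow> ae_eq \<Omega> r r'"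
    using proj(2)[of r r'] unfolding is_RT_def by blast
qed

section \<open>The steps of the algorithm\<close>

lemma b_form_cong:
  "q \<in> H01 \<Omega> \<Longrightarrow> v \<in> fst (L2 \<Omega>) \<Longrightarrow> v' \<in> fst (L2 \<Omega>) \<Longrightarrow> ae_eq \<Omega> v v' \<Longrightarrow> b_form P q v = b_form P q v'"
  unfolding b_form_def by (rule L2_inner_cong[OF L2_linearD(1)[OF grad_linear] L2_linearD(1)[OF grad_linear]]) auto

text \<open>The difference quotient of two single levels, so that one step can be studied without
  the sequence it belongs to.\<close>

definition quot :: "(real ^ 'd \<Rightarrow> 'c::real_vector) \<Rightarrow> (real ^ 'd \<Rightarrow> 'c) \<Rightarrow> real ^ 'd \<Rightarrow> 'c" where
  "quot w v = (\<lambda>x. (w x - v x) /\<^sub>R \<tau>)"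

lemma bdiff_quot: "bdiff P D w n = quot (w n) (w (n - 1))"
  by (simp add: quot_def bdiff_def[abs_def])

lemma quot_L2:
  fixes w v :: "real ^ 'd \<Rightarrow> 'c::euclidean_space"
  assumes "w \<in> fst (L2 \<Omega>)" "v \<in> fst (L2 \<Omega>)"
  shows "quot w v \<in> fst (L2 \<Omega>)"
proof -
  have "(\<lambda>x. 0 + inverse \<tau> *\<^sub>R (w x + (-1) *\<^sub>R v x)) \<in> fst (L2 \<Omega>)"
    by (intro lin_closedD[OF lin_closed_L2] assms)
  then show ?thesis by (simp add: quot_def)
qed

lemma quot_cong:
  assumes "ae_eq \<Omega> w w'" "ae_eq \<Omega> v v'"
  shows "ae_eq \<Omega> (quot w v) (quot w' v')"
  using assms unfolding quot_def by eventually_elim simp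

lemma L2_inner_quot:
  assumes "w \<in> fst (L2 \<Omega>)" "v \<in> fst (L2 \<Omega>)" "q \<in> fst (L2 \<Omega>)"
  shows "L2_inner \<Omega> (quot w v) q = (L2_inner \<Omega> w q - L2_inner \<Omega> v q) / \<tau>"
  using L2_prod_integrable[OF assms(1,3)] L2_prod_integrable[OF assms(2,3)]
  by (simp add: quot_def L2_inner_def inner_diff_left divide_inverse mult.commute)

lemma b_form_quot:
  assumes "q \<in> H01 \<Omega>" "w \<in> fst (L2 \<Omega>)" "v \<in> fst (L2 \<Omega>)"
  shows "b_form P q (quot w v) = (b_form P q w - b_form P q v) / \<tau>"
  unfolding b_form_def L2_inner_commute[of \<Omega> "grad \<Omega> q"]
  by (rule L2_inner_quot[OF assms(2,3) L2_linearD(1)[OF grad_linear assms(1)]])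

text \<open>One step as an equation for the unknown \<open>w\<close>, with all other quantities as
  parameters: two runs can then be compared although their data agree only almost
  everywhere.\<close>

definition pressure_eq where
  "pressure_eq pn dT du gg w \<longleftrightarrow> (\<forall>q\<in>Q_h P D.
     c\<^sub>0 P * L2_inner \<Omega> (quot w pn) q - b\<^sub>0 P * L2_inner \<Omega> dT q - \<alpha> P * b_form P q du + cp_form P w q
     = L2_inner \<Omega> gg q)"

definition temperature_eq where
  "temperature_eq pn Tn dp du zz w \<longleftrightarrow> (\<forall>s\<in>S_h P D.
     a\<^sub>0 P * L2_inner \<Omega> (quot w Tn) s - b\<^sub>0 P * L2_inner \<Omega> dp s - \<beta> P * b_form P s du + cT_form P w s
     - convection P (cut_field pn) w s = L2_inner \<Omega> zz s)"

definition displacement_eq where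
  "displacement_eq un du p T ff w \<longleftrightarrow> (\<forall>v\<in>V_h P D.
     a_form P w v + \<alpha> P * b_form P p v + \<beta> P * b_form P T v + stab_\<gamma> D * L2_inner \<Omega> (quot w un) v
     - stab_\<gamma> D * L2_inner \<Omega> du v = L2_inner \<Omega> ff v)"

text \<open>Once the quotient is expanded, the old level moves to the right-hand side and the
  remaining form is mass plus diffusion. The uniqueness part admits two sets of data because it
  serves the induction over the levels.\<close>

lemma pressure_step:
  defines "B \<equiv> \<lambda>w q. c\<^sub>0 P / \<tau> * L2_inner \<Omega> w q + cp_form P w q"
  assumes data: "pn \<in> fst (L2 \<Omega>)" "dT \<in> fst (L2 \<Omega>)" "du \<in> fst (L2 \<Omega>)" "gg \<in> fst (L2 \<Omega>)"
  shows "\<exists>w\<in>Q_h P D. pressure_eq pn dT du gg w"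
    and "w \<in> Q_h P D \<Longrightarrow> w' \<in> Q_h P D \<Longrightarrow> pressure_eq pn dT du gg w \<Longrightarrow> pressure_eq pn' dT' du' gg w' \<Longrightarrow>
      pn' \<in> fst (L2 \<Omega>) \<Longrightarrow> dT' \<in> fst (L2 \<Omega>) \<Longrightarrow> du' \<in> fst (L2 \<Omega>) \<Longrightarrow>
      ae_eq \<Omega> pn pn' \<Longrightarrow> ae_eq \<Omega> dT dT' \<Longrightarrow> ae_eq \<Omega> du du' \<Longrightarrow> ae_eq \<Omega> w w'"
proof -
  note sub = subsetD[OF spaces_subset(2)]
  let ?F = "\<lambda>pn dT du q. L2_inner \<Omega> gg q + c\<^sub>0 P / \<tau> * L2_inner \<Omega> pn q + b\<^sub>0 P * L2_inner \<Omega> dT q + \<alpha> P * b_form P q du"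
  have eq: "pressure_eq pn dT du gg w \<longleftrightarrow> (\<forall>q\<in>Q_h P D. B w q = ?F pn dT du q)"
    if "w \<in> Q_h P D" "pn \<in> fst (L2 \<Omega>)" for w pn dT du
    unfolding pressure_eq_def B_def
    by (rule ball_cong[OF refl]) (auto simp: L2_inner_quot spaces_L2 that diff_divide_distrib right_diff_distrib)
  have B1: "ae_form \<Omega> (Q_h P D) (\<lambda>w. B w q)" if "q \<in> Q_h P D" for q
    unfolding B_def
    by (rule ae_form_subset[OF _ spaces_subset(2)]) (intro ae_form_intros mass_ae cp_form_ae sub spaces_L2 that)
  have B2: "ae_form \<Omega> (Q_h P D) (B w)" if "w \<in> Q_h P D" for w
    unfolding B_def
    by (rule ae_form_subset[OF _ spaces_subset(2)]) (intro ae_form_intros mass_ae cp_form_ae sub spaces_L2 that)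
  have def: "ae_eq \<Omega> w (\<lambda>x. 0)" if "w \<in> Q_h P D" "B w w \<le> 0" for w
    using that(2) cp_form_nonneg[OF sub[OF that(1)]] coeffs tau
    by (intro H01_mass_definite[OF sub[OF that(1)], of "c\<^sub>0 P / \<tau>"]) (auto simp: B_def L2_inner_self)
  have F: "ae_form \<Omega> (Q_h P D) (?F pn dT du)"
    by (rule ae_form_subset[OF _ spaces_subset(2)]) (intro ae_form_intros mass_ae b_form_ae data)
  show "\<exists>w\<in>Q_h P D. pressure_eq pn dT du gg w"
    using variational_solution_exists[where B = "B", OF spaces_lin_closed(2) spaces_separated(2) B1 B2 def F] eq data by blast
  assume w: "w \<in> Q_h P D" "w' \<in> Q_h P D" "pressure_eq pn dT du gg w" "pressure_eq pn' dT' du' gg w'"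
    and data': "pn' \<in> fst (L2 \<Omega>)" "dT' \<in> fst (L2 \<Omega>)" "du' \<in> fst (L2 \<Omega>)"
    and ae: "ae_eq \<Omega> pn pn'" "ae_eq \<Omega> dT dT'" "ae_eq \<Omega> du du'"
  have "?F pn dT du q = ?F pn' dT' du' q" if "q \<in> Q_h P D" for q
    using L2_inner_cong_left[OF data(1) data'(1) spaces_L2(2)[OF that] ae(1)]
      L2_inner_cong_left[OF data(2) data'(2) spaces_L2(2)[OF that] ae(2)]
      b_form_cong[OF sub[OF that] data(3) data'(3) ae(3)] by simp
  then have "B w q = B w' q" if "q \<in> Q_h P D" for q
    using w eq[OF w(1) data(1)] eq[OF w(2) data'(1)] that by simp
  from variational_solution_unique[where B = "B", OF spaces_lin_closed(2) B1 def w(1,2) this] show "ae_eq \<Omega> w w'" .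
qed

lemma temperature_step:
  defines "B \<equiv> \<lambda>pn w s. a\<^sub>0 P / \<tau> * L2_inner \<Omega> w s + cT_form P w s - convection P (cut_field pn) w s"
  assumes pn: "pn \<in> Q_h P D"
    and data: "Tn \<in> fst (L2 \<Omega>)" "dp \<in> fst (L2 \<Omega>)" "du \<in> fst (L2 \<Omega>)" "zz \<in> fst (L2 \<Omega>)"
  shows "\<exists>w\<in>S_h P D. temperature_eq pn Tn dp du zz w"
    and "w \<in> S_h P D \<Longrightarrow> w' \<in> S_h P D \<Longrightarrow> temperature_eq pn Tn dp du zz w \<Longrightarrow> temperature_eq pn' Tn' dp' du' zz w' \<Longrightarrow>
      Tn' \<in> fst (L2 \<Omega>) \<Longrightarrow> dp' \<in> fst (L2 \<Omega>) \<Longrightarrow> du' \<in> fst (L2 \<Omega>) \<Longrightarrow> ae_eq \<Omega> pn pn' \<Longrightarrow>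
      ae_eq \<Omega> Tn Tn' \<Longrightarrow> ae_eq \<Omega> dp dp' \<Longrightarrow> ae_eq \<Omega> du du' \<Longrightarrow> ae_eq \<Omega> w w'"
proof -
  note sub = subsetD[OF spaces_subset(3)] and p = subsetD[OF spaces_subset(2) pn]
  let ?F = "\<lambda>Tn dp du s. L2_inner \<Omega> zz s + a\<^sub>0 P / \<tau> * L2_inner \<Omega> Tn s + b\<^sub>0 P * L2_inner \<Omega> dp s + \<beta> P * b_form P s du"
  have eq: "temperature_eq pn Tn dp du zz w \<longleftrightarrow> (\<forall>s\<in>S_h P D. B pn w s = ?F Tn dp du s)"
    if "w \<in> S_h P D" "Tn \<in> fst (L2 \<Omega>)" for w pn Tn dp du
    unfolding temperature_eq_def B_def
    by (rule ball_cong[OF refl]) (auto simp: L2_inner_quot spaces_L2 that diff_divide_distrib right_diff_distrib)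
  have B1: "ae_form \<Omega> (S_h P D) (\<lambda>w. B pn w s)" if "s \<in> S_h P D" for s
    unfolding B_def
    by (rule ae_form_subset[OF _ spaces_subset(3)])
       (intro ae_form_intros mass_ae cT_form_ae cut_convection_ae sub spaces_L2 that p)
  have B2: "ae_form \<Omega> (S_h P D) (B pn w)" if "w \<in> S_h P D" for w
    unfolding B_def
    by (rule ae_form_subset[OF _ spaces_subset(3)])
       (intro ae_form_intros mass_ae cT_form_ae cut_convection_ae sub spaces_L2 that p)
  have def: "ae_eq \<Omega> w (\<lambda>x. 0)" if "w \<in> S_h P D" "B pn w w \<le> 0" for w
  proof (rule H01_mass_definite[OF sub[OF that(1)]])
    show "a\<^sub>0 P / 2 > 0" using coeffs by simp
    \<comment> \<open>Multiplying by \<tau> makes \<open>diffusion_convection_ge\<close> applicable;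
      one half of the mass coefficient \<open>a\<^sub>0\<close> survives.\<close>
    have "\<tau> * B pn w w \<le> 0" using that(2) tau by (simp add: mult_le_0_iff)
    moreover have "\<tau> * B pn w w = a\<^sub>0 P * sq_int \<Omega> w + (\<tau> * cT_form P w w - \<tau> * convection P (cut_field pn) w w)"
      using tau by (simp add: B_def L2_inner_self algebra_simps)
    ultimately show "a\<^sub>0 P / 2 * sq_int \<Omega> w \<le> 0"
      using diffusion_convection_ge[OF p sub[OF that(1)]] by (simp add: field_simps)
  qed
  have F: "ae_form \<Omega> (S_h P D) (?F Tn dp du)"
    by (rule ae_form_subset[OF _ spaces_subset(3)]) (intro ae_form_intros mass_ae b_form_ae data)
  show "\<exists>w\<in>S_h P D. temperature_eq pn Tn dp du zz w"
    using variational_solution_exists[where B = "B pn", OF spaces_lin_closed(3) spaces_separated(3) B1 B2 def F] eq data by blast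
  assume w: "w \<in> S_h P D" "w' \<in> S_h P D" "temperature_eq pn Tn dp du zz w" "temperature_eq pn' Tn' dp' du' zz w'"
    and data': "Tn' \<in> fst (L2 \<Omega>)" "dp' \<in> fst (L2 \<Omega>)" "du' \<in> fst (L2 \<Omega>)"
    and ae: "ae_eq \<Omega> pn pn'" "ae_eq \<Omega> Tn Tn'" "ae_eq \<Omega> dp dp'" "ae_eq \<Omega> du du'"
  have "?F Tn dp du s = ?F Tn' dp' du' s" if "s \<in> S_h P D" for s
    using L2_inner_cong_left[OF data(1) data'(1) spaces_L2(3)[OF that] ae(2)]
      L2_inner_cong_left[OF data(2) data'(2) spaces_L2(3)[OF that] ae(3)]
      b_form_cong[OF sub[OF that] data(3) data'(3) ae(4)] by simp
  \<comment> \<open>The form depends on the data through the cut-off field, which is the same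
    function for both pressures, so one form governs both runs.\<close>
  moreover have "B pn' = B pn" by (simp add: B_def cut_field_cong[OF ae(1)])
  ultimately have "B pn w s = B pn w' s" if "s \<in> S_h P D" for s
    using w eq[OF w(1) data(1), of pn] eq[OF w(2) data'(1), of pn'] that by simp
  from variational_solution_unique[where B = "B pn", OF spaces_lin_closed(3) B1 def w(1,2) this] show "ae_eq \<Omega> w w'" .
qed

lemma displacement_step:
  defines "B \<equiv> \<lambda>w v. a_form P w v + stab_\<gamma> D / \<tau> * L2_inner \<Omega> w v"
  assumes data: "un \<in> fst (L2 \<Omega>)" "du \<in> fst (L2 \<Omega>)" "p \<in> Q_h P D" "T \<in> S_h P D" "ff \<in> fst (L2 \<Omega>)"
  shows "\<exists>w\<in>V_h P D. displacement_eq un du p T ff w"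
    and "w \<in> V_h P D \<Longrightarrow> w' \<in> V_h P D \<Longrightarrow> displacement_eq un du p T ff w \<Longrightarrow> displacement_eq un' du' p' T' ff w' \<Longrightarrow>
      un' \<in> fst (L2 \<Omega>) \<Longrightarrow> du' \<in> fst (L2 \<Omega>) \<Longrightarrow> ae_eq \<Omega> un un' \<Longrightarrow> ae_eq \<Omega> du du' \<Longrightarrow>
      ae_eq \<Omega> p p' \<Longrightarrow> ae_eq \<Omega> T T' \<Longrightarrow> ae_eq \<Omega> w w'"
proof -
  note sub = subsetD[OF spaces_subset(1)] and pT = subsetD[OF spaces_subset(2) data(3)] subsetD[OF spaces_subset(3) data(4)]
  let ?F = "\<lambda>un du p T v. L2_inner \<Omega> ff v + stab_\<gamma> D / \<tau> * L2_inner \<Omega> un v + stab_\<gamma> D * L2_inner \<Omega> du v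
    - \<alpha> P * b_form P p v - \<beta> P * b_form P T v"
  have eq: "displacement_eq un du p T ff w \<longleftrightarrow> (\<forall>v\<in>V_h P D. B w v = ?F un du p T v)"
    if "w \<in> V_h P D" "un \<in> fst (L2 \<Omega>)" for w un du p T
    unfolding displacement_eq_def B_def
    by (rule ball_cong[OF refl]) (auto simp: L2_inner_quot spaces_L2 that diff_divide_distrib right_diff_distrib)
  have B1: "ae_form \<Omega> (V_h P D) (\<lambda>w. B w v)" if "v \<in> V_h P D" for v
    unfolding B_def
    by (rule ae_form_subset[OF _ spaces_subset(1)]) (intro ae_form_intros mass_ae a_form_ae sub spaces_L2 that)
  have B2: "ae_form \<Omega> (V_h P D) (B w)" if "w \<in> V_h P D" for w
    unfolding B_def
    by (rule ae_form_subset[OF _ spaces_subset(1)]) (intro ae_form_intros mass_ae a_form_ae sub spaces_L2 that)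
  have def: "ae_eq \<Omega> w (\<lambda>x. 0)" if "w \<in> V_h P D" "B w w \<le> 0" for w
  proof -
    have "0 \<le> stab_\<gamma> D / \<tau> * sq_int \<Omega> w" using stab tau by (simp add: sq_int_nonneg)
    then show ?thesis
      using that(2) by (intro a_form_definite[OF sub[OF that(1)]]) (simp add: B_def L2_inner_self)
  qed
  have F: "ae_form \<Omega> (V_h P D) (?F un du p T)"
    by (rule ae_form_subset[OF _ spaces_subset(1)]) (intro ae_form_intros mass_ae b_form_ae data pT)
  show "\<exists>w\<in>V_h P D. displacement_eq un du p T ff w"
    using variational_solution_exists[where B = "B", OF spaces_lin_closed(1) spaces_separated(1) B1 B2 def F] eq data by blast
  assume w: "w \<in> V_h P D" "w' \<in> V_h P D" "displacement_eq un du p T ff w" "displacement_eq un' du' p' T' ff w'"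
    and data': "un' \<in> fst (L2 \<Omega>)" "du' \<in> fst (L2 \<Omega>)"
    and ae: "ae_eq \<Omega> un un'" "ae_eq \<Omega> du du'" "ae_eq \<Omega> p p'" "ae_eq \<Omega> T T'"
  \<comment> \<open>The new pressure and temperature enter only through their gradients, and these
    coincide as functions.\<close>
  have "?F un du p T v = ?F un' du' p' T' v" if "v \<in> V_h P D" for v
    using L2_inner_cong_left[OF data(1) data'(1) spaces_L2(1)[OF that] ae(1)]
      L2_inner_cong_left[OF data(2) data'(2) spaces_L2(1)[OF that] ae(2)]
      grad_cong[OF Om(1) ae(3)] grad_cong[OF Om(1) ae(4)] by (simp add: b_form_def)
  then have "B w v = B w' v" if "v \<in> V_h P D" for v
    using w eq[OF w(1) data(1)] eq[OF w(2) data'(1)] that by simp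
  from variational_solution_unique[where B = "B", OF spaces_lin_closed(1) B1 def w(1,2) this] show "ae_eq \<Omega> w w'" .
qed

text \<open>The parameters display the decoupling: the pressure sees only old quotients, the
  temperature the new pressure quotient but the old displacement quotient, the displacement both new
  scalars. Hence the three problems can be solved in this order.\<close>

lemma sequential_step_iff:
  assumes "1 \<le> n"
  shows "sequential_step P D n u p T \<longleftrightarrow>
    pressure_eq (p n) (quot (T n) (T (n - 1))) (quot (u n) (u (n - 1))) (g_src P (t_lev P D (n + 1))) (p (n + 1)) \<and>
    temperature_eq (p n) (T n) (quot (p (n + 1)) (p n)) (quot (u n) (u (n - 1))) (z_src P (t_lev P D (n + 1))) (T (n + 1)) \<and>
    displacement_eq (u n) (quot (u n) (u (n - 1))) (p (n + 1)) (T (n + 1)) (f_src P (t_lev P D (n + 1))) (u (n + 1))"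
  by (simp add: sequential_step_def pressure_eq_def temperature_eq_def displacement_eq_def bdiff_quot cut_field_def)

section \<open>The coupled first step\<close>

definition coupled_eq where
  "coupled_eq un pn Tn ff gg zz U p T \<longleftrightarrow> (\<forall>v\<in>V_h P D. \<forall>q\<in>Q_h P D. \<forall>s\<in>S_h P D.
     a_form P U v + \<alpha> P * b_form P p v + \<beta> P * b_form P T v = L2_inner \<Omega> ff v \<and>
     c\<^sub>0 P * L2_inner \<Omega> (quot p pn) q - b\<^sub>0 P * L2_inner \<Omega> (quot T Tn) q - \<alpha> P * b_form P q (quot U un) + cp_form P p q
       = L2_inner \<Omega> gg q \<and>
     a\<^sub>0 P * L2_inner \<Omega> (quot T Tn) s - b\<^sub>0 P * L2_inner \<Omega> (quot p pn) s - \<beta> P * b_form P s (quot U un)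
       + cT_form P T s - convection P (cut_field pn) T s = L2_inner \<Omega> zz s)"

lemma coupled_step_iff:
  "coupled_step P D 0 u p T \<longleftrightarrow>
    coupled_eq (u 0) (p 0) (T 0) (f_src P (t_lev P D 1)) (g_src P (t_lev P D 1)) (z_src P (t_lev P D 1)) (u 1) (p 1) (T 1)"
  by (simp add: coupled_step_def coupled_eq_def bdiff_quot cut_field_def)

definition momentum_form where "momentum_form U p T v = a_form P U v + \<alpha> P * b_form P p v + \<beta> P * b_form P T v"

text \<open>The left-hand side multiplied by \<tau>, with the old level removed. The coupling then
  involves \<open>U\<close> itself without a factor \<open>1 / \<tau>\<close>, so that it matches
  the term of the momentum equation with the opposite sign.\<close>

definition pressure_form where "pressure_form U p T q = c\<^sub>0 P * L2_inner \<Omega> p q - b\<^sub>0 P * L2_inner \<Omega> T q - \<alpha> P * b_form P q U + \<tau> * cp_form P p q"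

definition temperature_form where "temperature_form pn U p T s = a\<^sub>0 P * L2_inner \<Omega> T s - b\<^sub>0 P * L2_inner \<Omega> p s - \<beta> P * b_form P s U
  + \<tau> * cT_form P T s - \<tau> * convection P (cut_field pn) T s"

definition pressure_source where "pressure_source un pn Tn gg q = \<tau> * L2_inner \<Omega> gg q + c\<^sub>0 P * L2_inner \<Omega> pn q - b\<^sub>0 P * L2_inner \<Omega> Tn q - \<alpha> P * b_form P q un"

definition temperature_source where "temperature_source un pn Tn zz s = \<tau> * L2_inner \<Omega> zz s + a\<^sub>0 P * L2_inner \<Omega> Tn s - b\<^sub>0 P * L2_inner \<Omega> pn s - \<beta> P * b_form P s un"

lemma coupled_eq_iff:
  assumes "U \<in> V_h P D" "p \<in> Q_h P D" "T \<in> S_h P D" "un \<in> V_h P D" "pn \<in> Q_h P D" "Tn \<in> S_h P D"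
  shows "coupled_eq un pn Tn ff gg zz U p T \<longleftrightarrow> (\<forall>v\<in>V_h P D. \<forall>q\<in>Q_h P D. \<forall>s\<in>S_h P D.
    momentum_form U p T v = L2_inner \<Omega> ff v \<and> pressure_form U p T q = pressure_source un pn Tn gg q \<and> temperature_form pn U p T s = temperature_source un pn Tn zz s)"
proof -
  \<comment> \<open>Multiplication by \<tau> as an identity of real numbers, with the values of the
    forms opaque; the pressure equation is the case \<open>e = 0\<close>.\<close>
  have eq: "c * ((x - x0) / \<tau>) - b * ((y - y0) / \<tau>) - a * ((w - w0) / \<tau>) + d - e = r \<longleftrightarrow>
      c * x - b * y - a * w + \<tau> * d - \<tau> * e = \<tau> * r + c * x0 - b * y0 - a * w0" for a b c d e r x x0 y y0 w w0 :: real
  proof -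
    have "\<tau> * (c * ((x - x0) / \<tau>) - b * ((y - y0) / \<tau>) - a * ((w - w0) / \<tau>) + d - e - r) =
        c * x - b * y - a * w + \<tau> * d - \<tau> * e - (\<tau> * r + c * x0 - b * y0 - a * w0)"
    proof -
      have t: "\<tau> * (k * (d / \<tau>)) = k * d" for k d :: real using tau by simp
      show ?thesis by (simp only: right_diff_distrib distrib_left t)
    qed
    then show ?thesis using tau by (metis eq_iff_diff_eq_0 mult_eq_0_iff less_irrefl)
  qed
  have eq0: "c * ((x - x0) / \<tau>) - b * ((y - y0) / \<tau>) - a * ((w - w0) / \<tau>) + d = r \<longleftrightarrow>
      c * x - b * y - a * w + \<tau> * d = \<tau> * r + c * x0 - b * y0 - a * w0" for a b c d r x x0 y y0 w w0 :: real
    using eq[of c x x0 b y y0 a w w0 d 0 r] by simp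
  note q = subsetD[OF spaces_subset(2)] and s = subsetD[OF spaces_subset(3)]
  show ?thesis
    unfolding coupled_eq_def momentum_form_def pressure_form_def temperature_form_def pressure_source_def temperature_source_def
    using eq0 eq assms
    by (intro ball_cong refl conj_cong) (simp_all add: L2_inner_quot b_form_quot spaces_L2 q s)
qed

text \<open>Triples of fields are packed into one function with values in a product, so that the
  abstract existence and uniqueness results apply to the whole system at once.\<close>

definition coupled_space :: "(real ^ 'd \<Rightarrow> (real ^ 'd) \<times> real \<times> real) set" where
  "coupled_space = {w. (\<lambda>x. fst (w x)) \<in> V_h P D \<and> (\<lambda>x. fst (snd (w x))) \<in> Q_h P D \<and> (\<lambda>x. snd (snd (w x))) \<in> S_h P D}"

lemma coupled_spaceD:
  "w \<in> coupled_space \<Longrightarrow> (\<lambda>x. fst (w x)) \<in> V_h P D" "w \<in> coupled_space \<Longrightarrow> (\<lambda>x. fst (snd (w x))) \<in> Q_h P D"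
  "w \<in> coupled_space \<Longrightarrow> (\<lambda>x. snd (snd (w x))) \<in> S_h P D"
  by (simp_all add: coupled_space_def)

lemma lin_closed_coupled_space: "lin_closed coupled_space"
  using lin_closedD[OF spaces_lin_closed(1)] lin_closedD[OF spaces_lin_closed(2)] lin_closedD[OF spaces_lin_closed(3)]
  unfolding lin_closed_def coupled_space_def by simp

lemma linear_components:
  "linear (fst :: (real ^ 'd) \<times> real \<times> real \<Rightarrow> real ^ 'd)"
  "linear (\<lambda>y :: (real ^ 'd) \<times> real \<times> real. fst (snd y))"
  "linear (\<lambda>y :: (real ^ 'd) \<times> real \<times> real. snd (snd y))"
  by (rule linearI; simp)+

lemma separated_coupled_space: "separated \<Omega> coupled_space"
proof -
  \<comment> \<open>The index \<open>Inl j\<close> addresses a displacement component,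
    \<open>Inr True\<close> the pressure and \<open>Inr False\<close> the temperature.\<close>
  define X where "X i = (case i of Inl (j :: 'd) \<Rightarrow> piecewise_poly (mesh D) (deg_u D) |
     Inr b \<Rightarrow> piecewise_poly (mesh D) (if b then deg_p D else deg_T D))" for i
  define \<pi> where "\<pi> i y = (case i of Inl (j :: 'd) \<Rightarrow> fst y $ j |
     Inr b \<Rightarrow> if b then fst (snd y) else snd (snd y))" for i and y :: "(real ^ 'd) \<times> real \<times> real"
  show ?thesis
  proof (rule separated_projections[where I = UNIV and \<pi> = \<pi> and X = X])
    show "separated \<Omega> (X i)" for i
      using separated_piecewise_poly[OF mesh(1,2) Om_sets mesh(3)] by (simp add: X_def split: sum.split)
    show "linear (\<pi> i)" for i
      unfolding \<pi>_def by (cases i) (auto intro!: linearI)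
    show "(\<lambda>x. \<pi> i (w x)) \<in> X i" if "w \<in> coupled_space" for i w
      using coupled_spaceD[OF that] unfolding X_def \<pi>_def by (cases i) (auto simp: V_h_def Q_h_def S_h_def)
    show "y = 0" if "\<And>i. i \<in> UNIV \<Longrightarrow> \<pi> i y = 0" for y
      using that[of "Inr True"] that[of "Inr False"] that[of "Inl _"]
      by (simp add: \<pi>_def prod_eq_iff vec_eq_iff)
  qed simp
qed

lemma coupled_test_forms:
  assumes "U \<in> V_h P D" "p \<in> Q_h P D" "T \<in> S_h P D" "pn \<in> Q_h P D"
  shows "ae_form \<Omega> (V_h P D) (momentum_form U p T)" "ae_form \<Omega> (Q_h P D) (pressure_form U p T)" "ae_form \<Omega> (S_h P D) (temperature_form pn U p T)"
  unfolding momentum_form_def[abs_def] pressure_form_def[abs_def] temperature_form_def[abs_def]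
  by (rule ae_form_subset[OF _ spaces_subset(1)], intro ae_form_intros mass_ae a_form_ae b_form_ae
        cp_form_ae cT_form_ae cut_convection_ae spaces_L2 subsetD[OF spaces_subset(1)]
        subsetD[OF spaces_subset(2)] subsetD[OF spaces_subset(3)] assms)
     (rule ae_form_subset[OF _ spaces_subset(2)] ae_form_subset[OF _ spaces_subset(3)], intro ae_form_intros mass_ae a_form_ae b_form_ae
        cp_form_ae cT_form_ae cut_convection_ae spaces_L2 subsetD[OF spaces_subset(1)]
        subsetD[OF spaces_subset(2)] subsetD[OF spaces_subset(3)] assms)+

lemma coupled_source_forms:
  assumes "un \<in> fst (L2 \<Omega>)" "pn \<in> fst (L2 \<Omega>)" "Tn \<in> fst (L2 \<Omega>)"
  shows "ff \<in> fst (L2 \<Omega>) \<Longrightarrow> ae_form \<Omega> (V_h P D) (L2_inner \<Omega> ff)"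
    "gg \<in> fst (L2 \<Omega>) \<Longrightarrow> ae_form \<Omega> (Q_h P D) (pressure_source un pn Tn gg)"
    "gg \<in> fst (L2 \<Omega>) \<Longrightarrow> ae_form \<Omega> (S_h P D) (temperature_source un pn Tn gg)"
  unfolding pressure_source_def[abs_def] temperature_source_def[abs_def]
  by (rule ae_form_subset[OF _ spaces_subset(1)] ae_form_subset[OF _ spaces_subset(2)] ae_form_subset[OF _ spaces_subset(3)],
      intro ae_form_intros mass_ae b_form_ae assms, assumption?)+

text \<open>Adding the equations loses nothing, since the three test functions vary independently,
  and it collects the coupling terms in one sum where they cancel for \<open>t = w\<close>.\<close>

definition coupled_form where
  "coupled_form pn w t = momentum_form (\<lambda>x. fst (w x)) (\<lambda>x. fst (snd (w x))) (\<lambda>x. snd (snd (w x))) (\<lambda>x. fst (t x)) +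
     pressure_form (\<lambda>x. fst (w x)) (\<lambda>x. fst (snd (w x))) (\<lambda>x. snd (snd (w x))) (\<lambda>x. fst (snd (t x))) +
     temperature_form pn (\<lambda>x. fst (w x)) (\<lambda>x. fst (snd (w x))) (\<lambda>x. snd (snd (w x))) (\<lambda>x. snd (snd (t x)))"

lemma coupled_form_test:
  assumes "pn \<in> Q_h P D" "w \<in> coupled_space"
  shows "ae_form \<Omega> coupled_space (coupled_form pn w)"
  unfolding coupled_form_def[abs_def]
  by (intro ae_form_add ae_form_compose[OF coupled_test_forms(1)[OF _ _ _ assms(1)] linear_components(1)]
      ae_form_compose[OF coupled_test_forms(2)[OF _ _ _ assms(1)] linear_components(2)]
      ae_form_compose[OF coupled_test_forms(3) linear_components(3)] coupled_spaceD assms)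

lemma coupled_form_trial:
  assumes pn: "pn \<in> Q_h P D" and t: "t \<in> coupled_space"
  shows "ae_form \<Omega> coupled_space (\<lambda>w. coupled_form pn w t)"
proof -
  note V = subsetD[OF spaces_subset(1) coupled_spaceD(1)] and Q = subsetD[OF spaces_subset(2) coupled_spaceD(2)] and S = subsetD[OF spaces_subset(3) coupled_spaceD(3)]
  note c1 = ae_form_compose[OF _ linear_components(1) V] and c2 = ae_form_compose[OF _ linear_components(2) Q]
    and c3 = ae_form_compose[OF _ linear_components(3) S]
  note L = spaces_L2(1)[OF coupled_spaceD(1)[OF t]] spaces_L2(2)[OF coupled_spaceD(2)[OF t]] spaces_L2(3)[OF coupled_spaceD(3)[OF t]]
  note u = c1[OF a_form_ae(1)[OF V[OF t]]] c1[OF b_form_ae(2)[OF Q[OF t]]] c1[OF b_form_ae(2)[OF S[OF t]]]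
  note p = c2[OF b_form_ae(1)[OF L(1)]] c2[OF mass_ae(1)[OF L(2)]] c2[OF mass_ae(1)[OF L(3)]] c2[OF cp_form_ae(1)[OF Q[OF t]]]
  note T = c3[OF b_form_ae(1)[OF L(1)]] c3[OF mass_ae(1)[OF L(2)]] c3[OF mass_ae(1)[OF L(3)]] c3[OF cT_form_ae(1)[OF S[OF t]]]
    c3[OF cut_convection_ae(1)[OF subsetD[OF spaces_subset(2) pn] S[OF t]]]
  have "ae_form \<Omega> coupled_space (\<lambda>w. momentum_form (\<lambda>x. fst (w x)) (\<lambda>x. fst (snd (w x))) (\<lambda>x. snd (snd (w x))) (\<lambda>x. fst (t x)))"
    unfolding momentum_form_def by (rule ae_form_add[OF ae_form_add[OF u(1) ae_form_cmult[OF p(1)]] ae_form_cmult[OF T(1)]])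
  moreover have "ae_form \<Omega> coupled_space (\<lambda>w. pressure_form (\<lambda>x. fst (w x)) (\<lambda>x. fst (snd (w x))) (\<lambda>x. snd (snd (w x))) (\<lambda>x. fst (snd (t x))))"
    unfolding pressure_form_def
    by (rule ae_form_add[OF ae_form_diff[OF ae_form_diff[OF ae_form_cmult[OF p(2)] ae_form_cmult[OF T(2)]]
          ae_form_cmult[OF u(2)]] ae_form_cmult[OF p(4)]])
  moreover have "ae_form \<Omega> coupled_space (\<lambda>w. temperature_form pn (\<lambda>x. fst (w x)) (\<lambda>x. fst (snd (w x))) (\<lambda>x. snd (snd (w x))) (\<lambda>x. snd (snd (t x))))"
    unfolding temperature_form_def
    by (rule ae_form_diff[OF ae_form_add[OF ae_form_diff[OF ae_form_diff[OF ae_form_cmult[OF T(3)] ae_form_cmult[OF p(3)]]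
          ae_form_cmult[OF u(3)]] ae_form_cmult[OF T(4)]] ae_form_cmult[OF T(5)]])
  ultimately show ?thesis unfolding coupled_form_def by (intro ae_form_add)
qed

lemma coupled_form_definite:
  assumes pn: "pn \<in> Q_h P D" and w: "w \<in> coupled_space" and le: "coupled_form pn w w \<le> 0"
  shows "ae_eq \<Omega> w (\<lambda>x. 0)"
proof -
  define U p T where UpT: "U = (\<lambda>x. fst (w x))" "p = (\<lambda>x. fst (snd (w x)))" "T = (\<lambda>x. snd (snd (w x)))"
  have mem: "U \<in> V_h P D" "p \<in> Q_h P D" "T \<in> S_h P D" using coupled_spaceD[OF w] by (simp_all add: UpT)
  note U = subsetD[OF spaces_subset(1) mem(1)] and p = subsetD[OF spaces_subset(2) mem(2)] and T = subsetD[OF spaces_subset(3) mem(3)]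
  have "coupled_form pn w w = a_form P U U + c\<^sub>0 P * sq_int \<Omega> p + a\<^sub>0 P * sq_int \<Omega> T - 2 * b\<^sub>0 P * L2_inner \<Omega> T p
      + \<tau> * cp_form P p p + (\<tau> * cT_form P T T - \<tau> * convection P (cut_field pn) T T)"
    unfolding coupled_form_def momentum_form_def pressure_form_def temperature_form_def UpT[symmetric]
    by (simp add: L2_inner_self L2_inner_commute[of \<Omega> p T])
  moreover have "2 * b\<^sub>0 P * L2_inner \<Omega> T p \<le> 2 * b\<^sub>0 P * (sq_int \<Omega> T / 4 + sq_int \<Omega> p)"
    using L2_inner_le[OF spaces_L2(3)[OF mem(3)] spaces_L2(2)[OF mem(2)]] coeffs by (intro mult_left_mono) auto
  moreover have "0 \<le> \<tau> * cp_form P p p" using cp_form_nonneg[OF p] tau by simp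
  moreover have "- (a\<^sub>0 P / 2) * sq_int \<Omega> T \<le> \<tau> * cT_form P T T - \<tau> * convection P (cut_field pn) T T"
    by (rule diffusion_convection_ge[OF subsetD[OF spaces_subset(2) pn] T])
  ultimately have total: "a_form P U U + (c\<^sub>0 P - 2 * b\<^sub>0 P) * sq_int \<Omega> p + (a\<^sub>0 P / 2 - b\<^sub>0 P / 2) * sq_int \<Omega> T \<le> 0"
    using le by (simp add: algebra_simps)
  \<comment> \<open>Since \<open>a\<^sub>0 \<ge> 2 * b\<^sub>0\<close>, the difference
    \<open>a\<^sub>0 - b\<^sub>0\<close> is at least \<open>b\<^sub>0\<close>, hence strictly
    positive even in the limiting case.\<close>
  have pos: "a\<^sub>0 P / 2 - b\<^sub>0 P / 2 > 0" using storage(2) coeffs by linarith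
  have nn: "0 \<le> (c\<^sub>0 P - 2 * b\<^sub>0 P) * sq_int \<Omega> p" "0 \<le> (a\<^sub>0 P / 2 - b\<^sub>0 P / 2) * sq_int \<Omega> T"
    using storage(1) pos by (simp_all add: sq_int_nonneg)
  have "ae_eq \<Omega> U (\<lambda>x. 0)"
    using total nn by (intro a_form_definite[OF U]) linarith
  moreover have "ae_eq \<Omega> p (\<lambda>x. 0)"
    using total nn a_form_nonneg[of U] by (intro H01_mass_definite[OF p storage(1)]) linarith
  moreover have "ae_eq \<Omega> T (\<lambda>x. 0)"
    using total nn a_form_nonneg[of U] by (intro H01_mass_definite[OF T pos]) linarith
  ultimately show ?thesis unfolding UpT by eventually_elim (simp add: prod_eq_iff)
qed

lemma coupled_solution:
  assumes data: "un \<in> V_h P D" "pn \<in> Q_h P D" "Tn \<in> S_h P D"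
    and src: "ff \<in> fst (L2 \<Omega>)" "gg \<in> fst (L2 \<Omega>)" "zz \<in> fst (L2 \<Omega>)"
  shows "\<exists>U\<in>V_h P D. \<exists>p\<in>Q_h P D. \<exists>T\<in>S_h P D. coupled_eq un pn Tn ff gg zz U p T"
proof -
  let ?F = "\<lambda>t. L2_inner \<Omega> ff (\<lambda>x. fst (t x)) + pressure_source un pn Tn gg (\<lambda>x. fst (snd (t x))) + temperature_source un pn Tn zz (\<lambda>x. snd (snd (t x)))"
  note F = coupled_source_forms[OF spaces_L2(1)[OF data(1)] spaces_L2(2)[OF data(2)] spaces_L2(3)[OF data(3)]]
  have "ae_form \<Omega> coupled_space ?F"
    by (intro ae_form_add ae_form_compose[OF F(1) linear_components(1)]
        ae_form_compose[OF F(2) linear_components(2)] ae_form_compose[OF F(3) linear_components(3)] coupled_spaceD src)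
  from variational_solution_exists[where B = "coupled_form pn", OF lin_closed_coupled_space separated_coupled_space coupled_form_trial[OF data(2)]
      coupled_form_test[OF data(2)] coupled_form_definite[OF data(2)] this]
  obtain w where w: "w \<in> coupled_space" "\<And>t. t \<in> coupled_space \<Longrightarrow> coupled_form pn w t = ?F t" by blast
  define U p T where UpT: "U = (\<lambda>x. fst (w x))" "p = (\<lambda>x. fst (snd (w x)))" "T = (\<lambda>x. snd (snd (w x)))"
  have mem: "U \<in> V_h P D" "p \<in> Q_h P D" "T \<in> S_h P D" using coupled_spaceD[OF w(1)] by (simp_all add: UpT)
  note zero = lin_closedD(1)[OF spaces_lin_closed(1)] lin_closedD(1)[OF spaces_lin_closed(2)] lin_closedD(1)[OF spaces_lin_closed(3)]
  note B0 = coupled_test_forms[OF mem data(2), THEN ae_formD(1), THEN linear_form_zero]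
  note F0 = F(1)[OF src(1), THEN ae_formD(1), THEN linear_form_zero] F(2)[OF src(2), THEN ae_formD(1), THEN linear_form_zero]
    F(3)[OF src(3), THEN ae_formD(1), THEN linear_form_zero]
  \<comment> \<open>A test triple is assembled from arbitrary \<open>v\<close>, \<open>q\<close>,
    \<open>s\<close>; setting two of them to zero isolates each single equation.\<close>
  have test: "momentum_form U p T v + pressure_form U p T q + temperature_form pn U p T s = L2_inner \<Omega> ff v + pressure_source un pn Tn gg q + temperature_source un pn Tn zz s"
    if "v \<in> V_h P D" "q \<in> Q_h P D" "s \<in> S_h P D" for v q s
    using w(2)[of "\<lambda>x. (v x, q x, s x)"] that by (simp add: coupled_space_def coupled_form_def UpT)
  have "momentum_form U p T v = L2_inner \<Omega> ff v" if "v \<in> V_h P D" for v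
    using test[OF that zero(2,3)] by (simp add: B0 F0 zero)
  moreover have "pressure_form U p T q = pressure_source un pn Tn gg q" if "q \<in> Q_h P D" for q
    using test[OF zero(1) that zero(3)] by (simp add: B0 F0 zero)
  moreover have "temperature_form pn U p T s = temperature_source un pn Tn zz s" if "s \<in> S_h P D" for s
    using test[OF zero(1,2) that] by (simp add: B0 F0 zero)
  ultimately have "coupled_eq un pn Tn ff gg zz U p T"
    using mem data by (subst coupled_eq_iff) auto
  then show ?thesis using mem by blast
qed

text \<open>Both runs solve the same problem for triples: the right-hand sides agree because the old
  levels agree almost everywhere, and the forms agree because of
  \<open>cut_field_cong\<close>.\<close>

lemma coupled_unique:
  assumes data: "un \<in> V_h P D" "pn \<in> Q_h P D" "Tn \<in> S_h P D" "un' \<in> V_h P D" "pn' \<in> Q_h P D" "Tn' \<in> S_h P D"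
    and mem: "U \<in> V_h P D" "p \<in> Q_h P D" "T \<in> S_h P D" "U' \<in> V_h P D" "p' \<in> Q_h P D" "T' \<in> S_h P D"
    and ae: "ae_eq \<Omega> un un'" "ae_eq \<Omega> pn pn'" "ae_eq \<Omega> Tn Tn'"
    and sol: "coupled_eq un pn Tn ff gg zz U p T" "coupled_eq un' pn' Tn' ff gg zz U' p' T'"
  shows "ae_eq \<Omega> U U'" "ae_eq \<Omega> p p'" "ae_eq \<Omega> T T'"
proof -
  let ?w = "\<lambda>x. (U x, p x, T x)" and ?w' = "\<lambda>x. (U' x, p' x, T' x)"
  have pressure_source: "pressure_source un pn Tn gg q = pressure_source un' pn' Tn' gg q" if "q \<in> Q_h P D" for q
    unfolding pressure_source_def
    using L2_inner_cong_left[OF spaces_L2(2)[OF data(2)] spaces_L2(2)[OF data(5)] spaces_L2(2)[OF that] ae(2)]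
      L2_inner_cong_left[OF spaces_L2(3)[OF data(3)] spaces_L2(3)[OF data(6)] spaces_L2(2)[OF that] ae(3)]
      b_form_cong[OF subsetD[OF spaces_subset(2) that] spaces_L2(1)[OF data(1)] spaces_L2(1)[OF data(4)] ae(1)] by simp
  have temperature_source: "temperature_source un pn Tn zz s = temperature_source un' pn' Tn' zz s" if "s \<in> S_h P D" for s
    unfolding temperature_source_def
    using L2_inner_cong_left[OF spaces_L2(2)[OF data(2)] spaces_L2(2)[OF data(5)] spaces_L2(3)[OF that] ae(2)]
      L2_inner_cong_left[OF spaces_L2(3)[OF data(3)] spaces_L2(3)[OF data(6)] spaces_L2(3)[OF that] ae(3)]
      b_form_cong[OF subsetD[OF spaces_subset(3) that] spaces_L2(1)[OF data(1)] spaces_L2(1)[OF data(4)] ae(1)] by simp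
  have w: "?w \<in> coupled_space" "?w' \<in> coupled_space" using mem by (simp_all add: coupled_space_def)
  have cf: "cut_field pn' = cut_field pn" by (rule cut_field_cong[OF ae(2), symmetric])
  have "coupled_form pn ?w t = coupled_form pn ?w' t" if t: "t \<in> coupled_space" for t
    using sol coupled_spaceD[OF t] pressure_source temperature_source unfolding coupled_eq_iff[OF mem(1-3) data(1-3)] coupled_eq_iff[OF mem(4-6) data(4-6)]
    by (simp add: coupled_form_def temperature_form_def cf)
  from variational_solution_unique[where B = "coupled_form pn", OF lin_closed_coupled_space coupled_form_trial[OF data(2)] coupled_form_definite[OF data(2)] w this]
  have "ae_eq \<Omega> ?w ?w'" .
  then show "ae_eq \<Omega> U U'" "ae_eq \<Omega> p p'" "ae_eq \<Omega> T T'" by (auto elim: eventually_mono)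
qed

section \<open>Time stepping\<close>

text \<open>Complete induction, since the quotients at step \<open>k\<close> read the levels
  \<open>k\<close> and \<open>k - 1\<close>. The two runs may have different lengths, so a run that
  stops early can be compared as well.\<close>

lemma sequential_solution_unique:
  assumes coer: "RT_coercive P (shift_\<delta> D) (p_init P)" and init: "initial_regularity P"
    and src: "\<And>n. 1 \<le> n \<Longrightarrow> n \<le> m \<Longrightarrow> f_src P (t_lev P D n) \<in> fst (L2 \<Omega>) \<and>
      g_src P (t_lev P D n) \<in> fst (L2 \<Omega>) \<and> z_src P (t_lev P D n) \<in> fst (L2 \<Omega>)"
    and sol: "sequential_solution P D m u p T" "sequential_solution P D m' u' p' T'"
    and n: "n \<le> m" "n \<le> m'"
  shows "ae_eq \<Omega> (u n) (u' n) \<and> ae_eq \<Omega> (p n) (p' n) \<and> ae_eq \<Omega> (T n) (T' n)"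
  using n
proof (induction n rule: less_induct)
  case (less n)
  have mem: "u k \<in> V_h P D" "p k \<in> Q_h P D" "T k \<in> S_h P D" "u' k \<in> V_h P D" "p' k \<in> Q_h P D" "T' k \<in> S_h P D"
    if "k \<le> n" for k
    using sol that less.prems unfolding sequential_solution_def by auto
  note L2 = mem(1)[THEN spaces_L2(1)] mem(2)[THEN spaces_L2(2)] mem(3)[THEN spaces_L2(3)]
    mem(4)[THEN spaces_L2(1)] mem(5)[THEN spaces_L2(2)] mem(6)[THEN spaces_L2(3)]
  have reg: "p_init P \<in> H01 \<Omega>" "T_init P \<in> H01 \<Omega>" "u_init P \<in> H01_vec \<Omega>"
    using init by (simp_all add: initial_regularity_def)
  \<comment> \<open>Each kind of level has its own rule: projection, coupled system, sequential
    step.\<close>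
  consider "n = 0" | "n = 1" | k where "n = Suc k" "1 \<le> k"
    by (cases n) (auto simp: Suc_le_eq)
  then show ?case
  proof cases
    case 1
    then show ?thesis
      using sol Ru_exists_unique(2)[OF reg(3)] Rp_exists_unique(2)[OF reg(1)] RT_exists_unique(2)[OF reg(1) coer reg(2)]
      by (auto simp: sequential_solution_def)
  next
    case 2
    have "coupled_step P D 0 u p T" "coupled_step P D 0 u' p' T'"
      using sol less.prems 2 by (simp_all add: sequential_solution_def)
    then show ?thesis
      using less.IH[of 0] less.prems 2
        coupled_unique[of "u 0" "p 0" "T 0" "u' 0" "p' 0" "T' 0" "u 1" "p 1" "T 1" "u' 1" "p' 1" "T' 1"] mem[of 0] mem[of 1]
      unfolding coupled_step_iff by simp
  next
    case 3
    have steps: "sequential_step P D k u p T" "sequential_step P D k u' p' T'"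
      using sol less.prems 3 by (simp_all add: sequential_solution_def)
    have srcn: "f_src P (t_lev P D (Suc k)) \<in> fst (L2 \<Omega>)" "g_src P (t_lev P D (Suc k)) \<in> fst (L2 \<Omega>)"
      "z_src P (t_lev P D (Suc k)) \<in> fst (L2 \<Omega>)"
      using src[of "Suc k"] less.prems 3 by auto
    have le: "k \<le> n" "k - 1 \<le> n" "Suc k \<le> n" using 3 by auto
    have IH: "ae_eq \<Omega> (u k) (u' k)" "ae_eq \<Omega> (p k) (p' k)" "ae_eq \<Omega> (T k) (T' k)"
      "ae_eq \<Omega> (u (k - 1)) (u' (k - 1))" "ae_eq \<Omega> (T (k - 1)) (T' (k - 1))"
      using less.IH[of k] less.IH[of "k - 1"] less.prems 3 by auto
    note du = quot_cong[OF IH(1,4)] quot_L2[OF L2(1)[OF le(1)] L2(1)[OF le(2)]] quot_L2[OF L2(4)[OF le(1)] L2(4)[OF le(2)]]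
    note dT = quot_cong[OF IH(3,5)] quot_L2[OF L2(3)[OF le(1)] L2(3)[OF le(2)]] quot_L2[OF L2(6)[OF le(1)] L2(6)[OF le(2)]]
    note st = steps[unfolded sequential_step_iff[OF 3(2)] Suc_eq_plus1[symmetric]]
    have pk: "ae_eq \<Omega> (p (Suc k)) (p' (Suc k))"
      by (rule pressure_step(2)[OF L2(2)[OF le(1)] dT(2) du(2) srcn(2) mem(2)[OF le(3)] mem(5)[OF le(3)]
            st(1)[THEN conjunct1] st(2)[THEN conjunct1] L2(5)[OF le(1)] dT(3) du(3) IH(2) dT(1) du(1)])
    note dp = quot_cong[OF pk IH(2)] quot_L2[OF L2(2)[OF le(3)] L2(2)[OF le(1)]] quot_L2[OF L2(5)[OF le(3)] L2(5)[OF le(1)]]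
    have Tk: "ae_eq \<Omega> (T (Suc k)) (T' (Suc k))"
      by (rule temperature_step(2)[OF mem(2)[OF le(1)] L2(3)[OF le(1)] dp(2) du(2) srcn(3) mem(3)[OF le(3)] mem(6)[OF le(3)]
            st(1)[THEN conjunct2, THEN conjunct1] st(2)[THEN conjunct2, THEN conjunct1]
            L2(6)[OF le(1)] dp(3) du(3) IH(2,3) dp(1) du(1)])
    have "ae_eq \<Omega> (u (Suc k)) (u' (Suc k))"
      by (rule displacement_step(2)[OF L2(1)[OF le(1)] du(2) mem(2)[OF le(3)] mem(3)[OF le(3)] srcn(1) mem(1)[OF le(3)] mem(4)[OF le(3)]
            st(1)[THEN conjunct2, THEN conjunct2] st(2)[THEN conjunct2, THEN conjunct2]
            L2(4)[OF le(1)] du(3) IH(1) du(1) pk Tk])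
    with pk Tk show ?thesis by (simp add: 3(1))
  qed
qed

text \<open>Induction on the number of levels: the new level is written into the three sequences by
  a function update at \<open>Suc m\<close>.\<close>

lemma sequential_solution_exists:
  assumes coer: "RT_coercive P (shift_\<delta> D) (p_init P)" and init: "initial_regularity P"
    and src: "\<And>n. 1 \<le> n \<Longrightarrow> n \<le> m \<Longrightarrow> f_src P (t_lev P D n) \<in> fst (L2 \<Omega>) \<and>
      g_src P (t_lev P D n) \<in> fst (L2 \<Omega>) \<and> z_src P (t_lev P D n) \<in> fst (L2 \<Omega>)"
  shows "\<exists>u p T. sequential_solution P D m u p T"
  using src
proof (induction m)
  case 0
  have reg: "p_init P \<in> H01 \<Omega>" "T_init P \<in> H01 \<Omega>" "u_init P \<in> H01_vec \<Omega>"
    using init by (simp_all add: initial_regularity_def)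
  obtain ru rp rT where r: "is_Ru P D (u_init P) ru" "is_Rp P D (p_init P) rp" "is_RT P D (p_init P) (T_init P) rT"
    using Ru_exists_unique(1)[OF reg(3)] Rp_exists_unique(1)[OF reg(1)] RT_exists_unique(1)[OF reg(1) coer reg(2)] by blast
  \<comment> \<open>Only level 0 is constrained here, so constant sequences serve.\<close>
  then have "sequential_solution P D 0 (\<lambda>_. ru) (\<lambda>_. rp) (\<lambda>_. rT)"
    unfolding sequential_solution_def by (simp add: is_Ru_def is_Rp_def is_RT_def)
  then show ?case by blast
next
  case (Suc m)
  obtain u p T where sol: "sequential_solution P D m u p T" using Suc.IH Suc.prems by auto
  have mem: "u k \<in> V_h P D" "p k \<in> Q_h P D" "T k \<in> S_h P D" if "k \<le> m" for k
    using sol that unfolding sequential_solution_def by auto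
  have src: "f_src P (t_lev P D (Suc m)) \<in> fst (L2 \<Omega>)" "g_src P (t_lev P D (Suc m)) \<in> fst (L2 \<Omega>)"
    "z_src P (t_lev P D (Suc m)) \<in> fst (L2 \<Omega>)"
    using Suc.prems[of "Suc m"] by auto
  have "\<exists>U\<in>V_h P D. \<exists>q\<in>Q_h P D. \<exists>S\<in>S_h P D.
      (m = 0 \<longrightarrow> coupled_step P D 0 (u(1 := U)) (p(1 := q)) (T(1 := S))) \<and>
      (1 \<le> m \<longrightarrow> sequential_step P D m (u(Suc m := U)) (p(Suc m := q)) (T(Suc m := S)))"
  proof (cases "m = 0")
    case True
    then show ?thesis
      using coupled_solution[OF mem(1)[of 0] mem(2)[of 0] mem(3)[of 0] src] by (simp add: coupled_step_iff)
  next
    case False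
    then have m: "1 \<le> m" by simp
    \<comment> \<open>The step reads the old levels \<open>m - 1\<close> and \<open>m\<close>, which
      the update at \<open>Suc m\<close> leaves alone.\<close>
    have ne: "m - 1 \<noteq> Suc m" "m \<noteq> Suc m" by auto
    note L2 = spaces_L2(1)[OF mem(1)] spaces_L2(2)[OF mem(2)] spaces_L2(3)[OF mem(3)]
    have le: "m \<le> m" "m - 1 \<le> m" by auto
    note du = quot_L2[OF L2(1)[OF le(1)] L2(1)[OF le(2)]] and dT = quot_L2[OF L2(3)[OF le(1)] L2(3)[OF le(2)]]
    obtain q where q: "q \<in> Q_h P D"
      "pressure_eq (p m) (quot (T m) (T (m - 1))) (quot (u m) (u (m - 1))) (g_src P (t_lev P D (Suc m))) q"
      using pressure_step(1)[OF L2(2)[OF le(1)] dT du src(2)] by blast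
    obtain S where S: "S \<in> S_h P D"
      "temperature_eq (p m) (T m) (quot q (p m)) (quot (u m) (u (m - 1))) (z_src P (t_lev P D (Suc m))) S"
      using temperature_step(1)[OF mem(2)[OF le(1)] L2(3)[OF le(1)] quot_L2[OF spaces_L2(2)[OF q(1)] L2(2)[OF le(1)]] du src(3)] by blast
    obtain U where U: "U \<in> V_h P D"
      "displacement_eq (u m) (quot (u m) (u (m - 1))) q S (f_src P (t_lev P D (Suc m))) U"
      using displacement_step(1)[OF L2(1)[OF le(1)] du q(1) S(1) src(1)] by blast
    have "sequential_step P D m (u(Suc m := U)) (p(Suc m := q)) (T(Suc m := S))"
      unfolding sequential_step_iff[OF m] using q(2) S(2) U(2) ne by simp
    then show ?thesis using q(1) S(1) U(1) False by blast
  qed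
  then obtain U q S where new: "U \<in> V_h P D" "q \<in> Q_h P D" "S \<in> S_h P D"
    "m = 0 \<Longrightarrow> coupled_step P D 0 (u(1 := U)) (p(1 := q)) (T(1 := S))"
    "1 \<le> m \<Longrightarrow> sequential_step P D m (u(Suc m := U)) (p(Suc m := q)) (T(Suc m := S))" by blast
  let ?u = "u(Suc m := U)" and ?p = "p(Suc m := q)" and ?T = "T(Suc m := S)"
  \<comment> \<open>Equations of earlier steps survive the update because they read levels up to
    \<open>m\<close> only.\<close>
  have "coupled_step P D 0 ?u ?p ?T"
  proof (cases "m = 0")
    case False
    then have "coupled_step P D 0 u p T" using sol by (simp add: sequential_solution_def)
    then show ?thesis using False by (simp add: coupled_step_iff)
  qed (use new(4) in simp)
  moreover have "sequential_step P D n ?u ?p ?T" if n: "1 \<le> n" "n < Suc m" for n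
  proof (cases "n = m")
    case False
    then have "sequential_step P D n u p T" using sol n by (simp add: sequential_solution_def)
    moreover have "n - 1 \<noteq> Suc m" "n \<noteq> Suc m" using n by auto
    ultimately show ?thesis using False n(1) by (simp add: sequential_step_iff)
  qed (use new(5) n in simp)
  ultimately have "sequential_solution P D (Suc m) ?u ?p ?T"
    using sol new(1-3) mem unfolding sequential_solution_def by (auto simp: le_Suc_eq)
  then show ?case by blast
qed

end

text \<open>Letting \<open>m\<close> range over shorter runs as well makes uniqueness a statement
  about each level on its own: a level is determined by the algorithm up to it, whatever happens
  later.\<close>

theorem theorem3p1:
  fixes P :: "('d::finite) tpe_problem"
    and D :: "'d discretization"
    and u u_t :: "real \<Rightarrow> real ^ 'd \<Rightarrow> real ^ 'd"
    and p T p_t T_t :: "real \<Rightarrow> real ^ 'd \<Rightarrow> real"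
    and k_m k_M \<theta>_m \<theta>_M l \<sigma> :: real
  assumes dim: "CARD('d) = 2 \<or> CARD('d) = 3"
    and domain: "convex_polyhedral_domain (Omega P)" "t_f P > 0"
    and A1: "admissible_tensor (Omega P) (K_ten P) k_m k_M"
            "admissible_tensor (Omega P) (\<Theta>_ten P) \<theta>_m \<theta>_M"
    and A2: "a\<^sub>0 P > 0" "b\<^sub>0 P > 0" "c\<^sub>0 P > 0" "\<alpha> P > 0" "\<beta> P > 0"
            "lame_mu P > 0" "lame_lambda P > 0"
    and A3: "c\<^sub>0 P - 2 * b\<^sub>0 P > 0" "a\<^sub>0 P - 2 * b\<^sub>0 P \<ge> 0"
    and A4: "source_regularity P"
    and A5: "initial_regularity P"
    and exact: "weak_solution P u p T u_t p_t T_t"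
    and A6: "l > real CARD('d)"
            "solution_regularity P l (deg_u D) (deg_p D) (deg_T D) u p T u_t p_t T_t"
    and degrees: "deg_u D \<ge> 1" "deg_p D \<ge> 1" "deg_T D \<ge> 1"
    and mesh: "regular_triangulation (Omega P) \<sigma> (mesh D)"
    and steps: "N_steps D > 0"
    and point_values: "\<forall>n\<in>{1..N_steps D}.
            f_src P (t_lev P D n) \<in> fst (L2 (Omega P)) \<and>
            g_src P (t_lev P D n) \<in> fst (L2 (Omega P)) \<and>
            z_src P (t_lev P D n) \<in> fst (L2 (Omega P))"
    and params: "cut_M D > 0" "stab_\<gamma> D > 0"
    and shift: "RT_coercive P (shift_\<delta> D) (p_init P)"
    and time_step: "tau P D \<le> 2 * \<theta>_m * a\<^sub>0 P / (cut_M D)\<^sup>2"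
  shows "\<exists>u\<^sub>h p\<^sub>h T\<^sub>h. sequential_solution P D (N_steps D) u\<^sub>h p\<^sub>h T\<^sub>h \<and>
           (\<forall>m\<le>N_steps D. \<forall>u' p' T'. sequential_solution P D m u' p' T' \<longrightarrow>
              (\<forall>n\<le>m. AE x in lebesgue_on (Omega P).
                 u' n x = u\<^sub>h n x \<and> p' n x = p\<^sub>h n x \<and> T' n x = T\<^sub>h n x))"
proof -
  have Om: "open (Omega P)" "bounded (Omega P)"
    using domain(1) polytope_imp_bounded[of "closure (Omega P)"] bounded_subset[OF _ closure_subset]
    by (auto simp: convex_polyhedral_domain_def)
  have \<T>: "finite (mesh D)" "\<And>K. K \<in> mesh D \<Longrightarrow> compact K" "Omega P \<subseteq> \<Union>(mesh D)"
    using mesh closure_subset[of "Omega P"]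
    by (auto simp: regular_triangulation_def triangulation_def intro: compact_simplex)
  have \<tau>: "tau P D > 0" using domain(2) steps by (simp add: tau_def)
  interpret discrete_problem P D k_m k_M \<theta>_m \<theta>_M
    by unfold_locales (use Om \<T> \<tau> A1 A2 A3 params time_step in auto)
  have src: "f_src P (t_lev P D n) \<in> fst (L2 (Omega P)) \<and> g_src P (t_lev P D n) \<in> fst (L2 (Omega P)) \<and>
      z_src P (t_lev P D n) \<in> fst (L2 (Omega P))" if "1 \<le> n" "n \<le> N_steps D" for n
    using point_values that by auto
  obtain u\<^sub>h p\<^sub>h T\<^sub>h where sol: "sequential_solution P D (N_steps D) u\<^sub>h p\<^sub>h T\<^sub>h"
    using sequential_solution_exists[OF shift A5 src] by blast
  have "AE x in lebesgue_on (Omega P). u' n x = u\<^sub>h n x \<and> p' n x = p\<^sub>h n x \<and> T' n x = T\<^sub>h n x"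
    if "m \<le> N_steps D" "sequential_solution P D m u' p' T'" "n \<le> m" for m u' p' T' n
  proof -
    have "ae_eq (Omega P) (u\<^sub>h n) (u' n) \<and> ae_eq (Omega P) (p\<^sub>h n) (p' n) \<and> ae_eq (Omega P) (T\<^sub>h n) (T' n)"
      by (rule sequential_solution_unique[OF shift A5 src sol that(2)]) (use that in auto)
    then show ?thesis by (auto elim: eventually_elim2 eventually_mono)
  qed
  then show ?thesis using sol by blast
qed

end
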